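(* There is a deterministic algorithm that, given a directed acyclic multigraph $G=(V,A)$ with $n$ vertices and $m$ arcs and an integer $k$, finds, for every ordered pair of vertices $s,t$, all $s$-$t$-latest cuts of size at most $k$, in $O(2^{O(k^2)}\cdot mn)$ total time.
   Context: Arcs have unit capacities; parallel arcs allowed, each with its own identity. A set $M\subseteq A$ is an $s$-$t$ cut if $t$ is unreachable from $s$ in $G\setminus M$. $T_M$ = set of vertices from which $t$ is reachable in $G\setminus M$. $M>M'$ iff $T_M\subsetneq T_{M'}$. An $s$-$t$ cut $M$ is $s$-$t$-latest iff there is no $s$-$t$ cut $M''$ with $M''>M$ and $|M''|\le|M|$.
   Formalization: The cuts found are the s-t-latest cuts that are also inclusion-minimal (non-minimal latest cuts can be too numerous to list in the stated time), and the time bound has max(m,n)·n in place of mn, which is unattainable when m is much smaller than n (e.g. m = 0). *)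

theory Defs
  imports Main "Graph_Theory.Digraph"
begin

section \<open>Latest cuts in directed multigraphs\<close>

definition delete_arcs :: "('a, 'b) pre_digraph \<Rightarrow> 'b set \<Rightarrow> ('a, 'b) pre_digraph" where
  "delete_arcs G M = G\<lparr>arcs := arcs G - M\<rparr>"

definition st_cut :: "('a, 'b) pre_digraph \<Rightarrow> 'a \<Rightarrow> 'a \<Rightarrow> 'b set \<Rightarrow> bool" where
  "st_cut G s t M \<longleftrightarrow> M \<subseteq> arcs G \<and> \<not> s \<rightarrow>\<^sup>*\<^bsub>delete_arcs G M\<^esub> t"

definition target_side :: "('a, 'b) pre_digraph \<Rightarrow> 'a \<Rightarrow> 'b set \<Rightarrow> 'a set" where
  "target_side G t M = {v \<in> verts G. v \<rightarrow>\<^sup>*\<^bsub>delete_arcs G M\<^esub> t}"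

definition later :: "('a, 'b) pre_digraph \<Rightarrow> 'a \<Rightarrow> 'b set \<Rightarrow> 'b set \<Rightarrow> bool" where
  "later G t M M' \<longleftrightarrow> target_side G t M \<subset> target_side G t M'"

definition st_latest :: "('a, 'b) pre_digraph \<Rightarrow> 'a \<Rightarrow> 'a \<Rightarrow> 'b set \<Rightarrow> bool" where
  "st_latest G s t M \<longleftrightarrow> st_cut G s t M \<and>
     \<not> (\<exists>M''. st_cut G s t M'' \<and> later G t M'' M \<and> card M'' \<le> card M)"

text \<open>
  A cut may be padded with arcs that play no role in separating \<open>s\<close> from \<open>t\<close>, and padded cuts
  can satisfy \<^const>\<open>st_latest\<close>: if \<open>s\<close> is isolated and the arcs of the graph are \<open>N\<close> arcs
  with distinct tails entering \<open>t\<close>, then every set of arcs is latest. There are too many such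
  sets to be listed within the time bound, so the cuts to be enumerated are those that are
  also inclusion-minimal.
\<close>

definition minimal_st_cut :: "('a, 'b) pre_digraph \<Rightarrow> 'a \<Rightarrow> 'a \<Rightarrow> 'b set \<Rightarrow> bool" where
  "minimal_st_cut G s t M \<longleftrightarrow> st_cut G s t M \<and> (\<forall>M'. M' \<subset> M \<longrightarrow> \<not> st_cut G s t M')"


section \<open>A word RAM\<close>

text \<open>
  Programs operate on finitely many random-access arrays of natural numbers (those named in the
  program text); a register is cell \<open>0\<close> of an array. Every operation costs one time unit.
  The parameter \<open>W\<close> is the size of the universe of machine words: an execution in which some
  evaluated value or address is not below \<open>W\<close> gets stuck. A bound on \<open>W\<close> thus bounds the word
  length, so that the unit-cost measure cannot be exploited by computing with huge numbers.
\<close>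

type_synonym state = "string \<Rightarrow> nat \<Rightarrow> nat"

datatype exp =
    Const nat
  | Read string exp
  | Plus exp exp
  | Minus exp exp
  | Times exp exp

fun val :: "state \<Rightarrow> exp \<Rightarrow> nat" where
  "val \<sigma> (Const i) = i"
| "val \<sigma> (Read x e) = \<sigma> x (val \<sigma> e)"
| "val \<sigma> (Plus e e') = val \<sigma> e + val \<sigma> e'"
| "val \<sigma> (Minus e e') = val \<sigma> e - val \<sigma> e'"
| "val \<sigma> (Times e e') = val \<sigma> e * val \<sigma> e'"

fun cost :: "exp \<Rightarrow> nat" where
  "cost (Const i) = 1"
| "cost (Read x e) = 1 + cost e"
| "cost (Plus e e') = 1 + cost e + cost e'"
| "cost (Minus e e') = 1 + cost e + cost e'"
| "cost (Times e e') = 1 + cost e + cost e'"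

fun fits :: "nat \<Rightarrow> state \<Rightarrow> exp \<Rightarrow> bool" where
  "fits W \<sigma> (Const i) \<longleftrightarrow> i < W"
| "fits W \<sigma> (Read x e) \<longleftrightarrow> fits W \<sigma> e \<and> \<sigma> x (val \<sigma> e) < W"
| "fits W \<sigma> (Plus e e') \<longleftrightarrow> fits W \<sigma> e \<and> fits W \<sigma> e' \<and> val \<sigma> e + val \<sigma> e' < W"
| "fits W \<sigma> (Minus e e') \<longleftrightarrow> fits W \<sigma> e \<and> fits W \<sigma> e'"
| "fits W \<sigma> (Times e e') \<longleftrightarrow> fits W \<sigma> e \<and> fits W \<sigma> e' \<and> val \<sigma> e * val \<sigma> e' < W"

text \<open>Conditions test for a nonzero value; \<open>Assign x i e\<close> is \<open>x[i] := e\<close>.\<close>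

datatype com =
    Skip
  | Assign string exp exp
  | Seq com com
  | If exp com com
  | While exp com

text \<open>\<open>run W P \<sigma> T \<sigma>'\<close>: started in \<open>\<sigma>\<close>, program \<open>P\<close> halts in \<open>\<sigma>'\<close> after exactly \<open>T\<close> time units.\<close>

inductive run :: "nat \<Rightarrow> com \<Rightarrow> state \<Rightarrow> nat \<Rightarrow> state \<Rightarrow> bool" for W where
  Skip: "run W Skip \<sigma> 1 \<sigma>"
| Assign: "fits W \<sigma> i \<Longrightarrow> fits W \<sigma> e \<Longrightarrow>
    run W (Assign x i e) \<sigma> (1 + cost i + cost e) (\<sigma>(x := (\<sigma> x)(val \<sigma> i := val \<sigma> e)))"
| Seq: "run W P \<sigma> T \<sigma>' \<Longrightarrow> run W Q \<sigma>' T' \<sigma>'' \<Longrightarrow> run W (Seq P Q) \<sigma> (T + T') \<sigma>''"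
| IfTrue: "fits W \<sigma> e \<Longrightarrow> val \<sigma> e \<noteq> 0 \<Longrightarrow> run W P \<sigma> T \<sigma>' \<Longrightarrow>
    run W (If e P Q) \<sigma> (1 + cost e + T) \<sigma>'"
| IfFalse: "fits W \<sigma> e \<Longrightarrow> val \<sigma> e = 0 \<Longrightarrow> run W Q \<sigma> T \<sigma>' \<Longrightarrow>
    run W (If e P Q) \<sigma> (1 + cost e + T) \<sigma>'"
| WhileFalse: "fits W \<sigma> e \<Longrightarrow> val \<sigma> e = 0 \<Longrightarrow> run W (While e P) \<sigma> (1 + cost e) \<sigma>"
| WhileTrue: "fits W \<sigma> e \<Longrightarrow> val \<sigma> e \<noteq> 0 \<Longrightarrow> run W P \<sigma> T \<sigma>' \<Longrightarrow>
    run W (While e P) \<sigma>' T' \<sigma>'' \<Longrightarrow> run W (While e P) \<sigma> (1 + cost e + T + T') \<sigma>''"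

inductive_cases run_SkipE: "run W Skip \<sigma> T \<sigma>'"
inductive_cases run_AssignE: "run W (Assign x i e) \<sigma> T \<sigma>'"
inductive_cases run_SeqE: "run W (Seq P Q) \<sigma> T \<sigma>'"
inductive_cases run_IfE: "run W (If e P Q) \<sigma> T \<sigma>'"
inductive_cases run_WhileE: "run W (While e P) \<sigma> T \<sigma>'"

lemma run_deterministic:
  assumes "run W P \<sigma> T1 \<sigma>1" and "run W P \<sigma> T2 \<sigma>2"
  shows "T1 = T2 \<and> \<sigma>1 = \<sigma>2"
  using assms
proof (induction arbitrary: T2 \<sigma>2 rule: run.induct)
  case (Skip \<sigma>)
  from Skip.prems show ?case by (rule run_SkipE) simp
next
  case (Assign \<sigma> i e x)
  from Assign.prems show ?case by (rule run_AssignE) simp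
next
  case (Seq P \<sigma> T \<sigma>' Q T' \<sigma>'')
  from Seq.prems obtain S \<rho> S' where T2: "T2 = S + S'"
    and "run W P \<sigma> S \<rho>" "run W Q \<rho> S' \<sigma>2"
    by (rule run_SeqE)
  with Seq.IH(1)[of S \<rho>] have "T = S" "run W Q \<sigma>' S' \<sigma>2" by simp_all
  with Seq.IH(2)[of S' \<sigma>2] T2 show ?case by simp
next
  case (IfTrue \<sigma> e P T \<sigma>' Q)
  from IfTrue.prems obtain S where "T2 = Suc (cost e + S)" "run W P \<sigma> S \<sigma>2"
    by (rule run_IfE) (simp_all add: IfTrue.hyps)
  with IfTrue.IH[of S \<sigma>2] show ?case by simp
next
  case (IfFalse \<sigma> e Q T \<sigma>' P)
  from IfFalse.prems obtain S where "T2 = Suc (cost e + S)" "run W Q \<sigma> S \<sigma>2"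
    by (rule run_IfE) (simp_all add: IfFalse.hyps)
  with IfFalse.IH[of S \<sigma>2] show ?case by simp
next
  case (WhileFalse \<sigma> e P)
  from WhileFalse.prems show ?case
    by (rule run_WhileE) (simp_all add: WhileFalse.hyps)
next
  case (WhileTrue \<sigma> e P T \<sigma>' T' \<sigma>'')
  from WhileTrue.prems obtain S \<rho> S' where T2: "T2 = Suc (cost e + S + S')"
    and "run W P \<sigma> S \<rho>" "run W (While e P) \<rho> S' \<sigma>2"
    by (rule run_WhileE) (simp_all add: WhileTrue.hyps)
  with WhileTrue.IH(1)[of S \<rho>] have "T = S" "run W (While e P) \<sigma>' S' \<sigma>2" by simp_all
  with WhileTrue.IH(2)[of S' \<sigma>2] T2 show ?case by simp
qed


section \<open>Input and output conventions\<close>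

text \<open>
  A graph with \<open>n\<close> vertices and \<open>m\<close> arcs has vertex set \<open>{..<n}\<close> and arc set \<open>{..<m}\<close>, and is given
  by the arrays of tails and heads in arbitrary order. All other memory is initially zero.
\<close>

definition input_state :: "(nat, nat) pre_digraph \<Rightarrow> nat \<Rightarrow> nat \<Rightarrow> nat \<Rightarrow> state" where
  "input_state G n m k = (\<lambda>_ _. 0)
     (''n'' := (\<lambda>_. 0)(0 := n),
      ''m'' := (\<lambda>_. 0)(0 := m),
      ''k'' := (\<lambda>_. 0)(0 := k),
      ''tail'' := (\<lambda>i. if i < m then tail G i else 0),
      ''head'' := (\<lambda>i. if i < m then head G i else 0))"

text \<open>
  The output is an explicit listing: the cuts found for \<open>(s, t)\<close> are those whose indices are in
  the interval stored for this pair (at position \<open>s * n + t\<close>), and the arcs of a cut are listed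
  in the interval of \<open>''cut_arcs''\<close> stored for its index.
\<close>

definition output_cut :: "state \<Rightarrow> nat \<Rightarrow> nat set" where
  "output_cut \<sigma> c = \<sigma> ''cut_arcs'' ` {\<sigma> ''cut_begin'' c ..< \<sigma> ''cut_end'' c}"

definition output_cuts :: "nat \<Rightarrow> state \<Rightarrow> nat \<Rightarrow> nat \<Rightarrow> nat set set" where
  "output_cuts n \<sigma> s t =
     output_cut \<sigma> ` {\<sigma> ''pair_begin'' (s * n + t) ..< \<sigma> ''pair_end'' (s * n + t)}"

end

theory Submission
  imports Defs
begin

text \<open>
  Fix \<open>t\<close> and treat the out-arcs of \<open>s\<close> one at a time. For a set \<open>E\<close> of arcs, let \<open>L(E)\<close> be the set of
  latest minimal cuts of size at most \<open>k\<close> that separate all arcs of \<open>E\<close> from \<open>t\<close>. By submodularity,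
  every cut in \<open>L(E \<union> F)\<close> is a union of one in \<open>L(E)\<close> and one in \<open>L(F)\<close>, and \<open>L({e})\<close> consists of
  cuts in \<open>L\<close> of the out-arcs of the head of \<open>e\<close> and possibly \<open>{e}\<close>. So the pairwise unions form a
  superset of \<open>L(E \<union> {e})\<close>, whose size is bounded because \<open>|L| \<le> 4^k\<close>.

  A candidate \<open>M\<close> is rejected if some candidate \<open>N \<noteq> M\<close> is no larger than the set of arcs of \<open>M\<close> that
  \<open>N\<close> cuts off from \<open>t\<close>. A latest cut \<open>N\<close> cuts off an arc \<open>b \<notin> N\<close> iff it contains a member of
  \<open>L\<close> of the out-arcs of the head of \<open>b\<close>, which are already known if arcs are treated in reverse
  topological order. Hence an update takes time depending on \<open>k\<close> only, and there are \<open>m n\<close> updates.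
\<close>

section \<open>Vertex cuts and latest cuts\<close>

text \<open>Everything rests on one exchange: if a cut N is no larger than the part of M that it
  closes, N may replace that part, and the result is no larger and closes at least as much.
  Uncrossing closures with \<open>card_bd_submodular\<close> passes this property on to parts of a
  cut. Arcs are taken as nodes so that a part of the out-arcs of a vertex is a legitimate set of
  sources.

  The obstacle is to compare candidates without searching the graph. The containment test is exact
  only if N is itself best; for other candidates it may underestimate what N closes. This suffices:
  an underestimate never rejects a best cut, and for a cut that is not best \<open>ex_best\<close>
  yields a best witness, which is among the candidates.

  The constants come from R = 2 * 16^k, a bound on the 4^k * (4^k + 1) possible candidates.
  Selection nests five loops of at most R rounds, which gives R^5 per update. The factor
  \<open>max m n * n\<close> is due to the pairs of vertices: even without any arcs, each pair with
  s \<noteq> t has the empty cut to report.\<close>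

text \<open>
  The nodes of this digraph are the arcs of the given one, \<open>sc e f\<close> says that the head of \<open>e\<close> is the
  tail of \<open>f\<close>, and \<open>ex e\<close> that the head of \<open>e\<close> is \<open>t\<close>. Cuts become vertex cuts that may contain sources.
\<close>

locale exit_digraph =
  fixes sc :: "'b \<Rightarrow> 'b \<Rightarrow> bool" and ex :: "'b \<Rightarrow> bool"
begin

inductive opn :: "'b set \<Rightarrow> 'b set \<Rightarrow> 'b \<Rightarrow> bool" for A M where
  opn_exit: "e \<in> A \<Longrightarrow> e \<notin> M \<Longrightarrow> ex e \<Longrightarrow> opn A M e"
| opn_step: "e \<in> A \<Longrightarrow> e \<notin> M \<Longrightarrow> sc e f \<Longrightarrow> opn A M f \<Longrightarrow> opn A M e"

text \<open>On subsets of A this is a closure operator, and \<open>bd\<close> recovers a minimal cut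
  from its closure: \<open>bd A (cl A M) = M\<close>. Arguments about cuts thus become arguments
  about closed sets.\<close>

definition cl :: "'b set \<Rightarrow> 'b set \<Rightarrow> 'b set" where
  "cl A M = {e \<in> A. \<not> opn A M e}"

definition bd :: "'b set \<Rightarrow> 'b set \<Rightarrow> 'b set" where
  "bd A D = {e \<in> D. ex e \<or> (\<exists>f\<in>A - D. sc e f)}"

text \<open>With \<open>N \<subset> M\<close> the last condition yields minimality, with \<open>M \<subseteq> cl A N\<close> it says that \<open>M\<close> is latest.\<close>

definition best :: "'b set \<Rightarrow> 'b set \<Rightarrow> 'b set \<Rightarrow> bool" where
  "best A E M \<longleftrightarrow> M \<subseteq> A \<and> E \<subseteq> cl A M \<and>
     (\<forall>N\<subseteq>A. E \<subseteq> cl A N \<and> card N \<le> card (M \<inter> cl A N) \<longrightarrow> N = M)"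

lemma bestD:
  assumes "best A E M" "N \<subseteq> A" "E \<subseteq> cl A N" "card N \<le> card (M \<inter> cl A N)"
  shows "N = M"
  using assms by (simp add: best_def)

definition succs :: "'b set \<Rightarrow> 'b \<Rightarrow> 'b set" where
  "succs A e = {f \<in> A. sc e f}"

section \<open>Closure and boundary\<close>

lemma opn_in: "opn A M e \<Longrightarrow> e \<in> A \<and> e \<notin> M"
  by (auto elim: opn.cases)

lemma cl_subset: "cl A M \<subseteq> A"
  by (auto simp: cl_def)

lemma cl_extensive: "M \<subseteq> A \<Longrightarrow> M \<subseteq> cl A M"
  by (auto simp: cl_def dest: opn_in)

text \<open>Every node of a path that witnesses openness for M is itself open. It lies outside
  \<open>cl A M\<close>, hence outside N, so the same path witnesses openness for N.\<close>

lemma cl_least: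
  assumes "N \<subseteq> cl A M" shows "cl A N \<subseteq> cl A M"
proof -
  have "opn A N e" if "opn A M e" for e
    using that
  proof induction
    case (opn_exit e)
    then have "opn A M e" by (rule opn.opn_exit)
    with opn_exit assms show ?case by (auto simp: cl_def intro: opn.opn_exit)
  next
    case (opn_step e f)
    then have "opn A M e" by (blast intro: opn.opn_step)
    with opn_step assms show ?case by (auto simp: cl_def intro: opn.opn_step)
  qed
  then show ?thesis by (auto simp: cl_def)
qed

lemma cl_mono: "N \<subseteq> M \<Longrightarrow> M \<subseteq> A \<Longrightarrow> cl A N \<subseteq> cl A M"
  by (meson cl_extensive cl_least order_trans)

lemma bd_cl: "bd A (cl A M) \<subseteq> M"
  by (auto simp: bd_def cl_def intro: opn_exit opn_step)

text \<open>A path from D to an exit has a last node in D, and this node is in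
  \<open>bd A D\<close>. So a path that avoids the boundary never meets D.\<close>

lemma cl_bd:
  assumes "D \<subseteq> A" shows "D \<subseteq> cl A (bd A D)"
proof -
  have "e \<notin> D" if "opn A (bd A D) e" for e
    using that by induction (auto simp: bd_def dest: opn_in)
  with assms show ?thesis by (auto simp: cl_def)
qed

lemma bd_subset: "bd A D \<subseteq> D"
  by (auto simp: bd_def)

lemma succs_closed:
  assumes "e \<in> cl A M" "e \<notin> M" shows "\<not> ex e" "succs A e \<subseteq> cl A M"
  using assms by (auto simp: cl_def succs_def intro: opn_exit opn_step)

lemma cl_succs:
  assumes "e \<in> A" "\<not> ex e" "succs A e \<subseteq> cl A M" shows "e \<in> cl A M"
proof -
  have False if "opn A M e"
    using that assms(2,3) by cases (auto simp: cl_def succs_def dest: opn_in)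
  with assms(1) show ?thesis by (auto simp: cl_def)
qed

text \<open>Checked node by node: a boundary node of the intersection or of the union is a boundary
  node of D or of D', and one that belongs to both boundaries is a boundary node of both D and
  D'.\<close>

lemma card_bd_submodular:
  assumes "finite A" "D \<subseteq> A" "D' \<subseteq> A"
  shows "card (bd A (D \<inter> D')) + card (bd A (D \<union> D')) \<le> card (bd A D) + card (bd A D')"
proof -
  have fin: "finite (bd A S)" if "S \<subseteq> A" for S
    using that assms(1) bd_subset by (meson finite_subset)
  let ?I = "bd A (D \<inter> D')" and ?U = "bd A (D \<union> D')"
  have "card ?I + card ?U = card (?I \<union> ?U) + card (?I \<inter> ?U)"
    by (rule card_Un_Int) (rule fin; use assms in blast)+
  also have "\<dots> \<le> card (bd A D \<union> bd A D') + card (bd A D \<inter> bd A D')"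
  proof (rule add_mono)
    show "card (?I \<union> ?U) \<le> card (bd A D \<union> bd A D')"
      by (rule card_mono) (use assms fin in \<open>auto simp: bd_def\<close>)
    show "card (?I \<inter> ?U) \<le> card (bd A D \<inter> bd A D')"
      by (rule card_mono) (use assms fin in \<open>auto simp: bd_def\<close>)
  qed
  also have "\<dots> = card (bd A D) + card (bd A D')"
    by (rule card_Un_Int[symmetric]) (use assms fin in auto)
  finally show ?thesis .
qed

section \<open>Uncrossing: best cuts decompose into best cuts\<close>

lemma best_minimal:
  assumes "finite A" "best A E M" "N \<subseteq> M" "E \<subseteq> cl A N" shows "N = M"
proof -
  from assms have "N \<subseteq> A" "finite M" by (auto simp: best_def intro: finite_subset)
  moreover from this assms have "card N \<le> card (M \<inter> cl A N)"
    using cl_extensive[of N A] by (intro card_mono) auto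
  ultimately show ?thesis using assms by (auto simp: best_def)
qed

lemma bd_cl_eq:
  assumes "M \<subseteq> A" "E \<subseteq> cl A M" "\<And>N. N \<subseteq> M \<Longrightarrow> E \<subseteq> cl A N \<Longrightarrow> N = M"
  shows "bd A (cl A M) = M"
  by (rule assms(3)[OF bd_cl]) (rule order_trans[OF assms(2) cl_bd[OF cl_subset]])

lemma ex_minimal_cut:
  assumes "finite M" "E \<subseteq> cl A M"
  obtains N where "N \<subseteq> M" "E \<subseteq> cl A N" "\<And>N'. N' \<subseteq> N \<Longrightarrow> E \<subseteq> cl A N' \<Longrightarrow> N' = N"
proof -
  let ?S = "{N. N \<subseteq> M \<and> E \<subseteq> cl A N}"
  have "finite ?S" "?S \<noteq> {}" using assms by auto
  from finite_has_minimal[OF this] obtain N where N: "N \<in> ?S" "\<And>b. b \<in> ?S \<Longrightarrow> b \<subseteq> N \<Longrightarrow> N = b"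
    by auto
  show ?thesis by (rule that[of N]) (use N in blast)+
qed

text \<open>N is a minimal part of M that closes E. A competitor N' is uncrossed with M: the
  boundary of the union of the closures encloses M and cannot be smaller than M, so by submodularity
  the boundary of the intersection is no larger than N'. Since it contains the part of N that N'
  closes, all inequalities are tight, and minimality of N makes this boundary, N and N'
  equal.\<close>

lemma best_split:
  assumes fin: "finite A" and M: "best A (E \<union> F) M"
  obtains N where "N \<subseteq> M" "best A E N"
proof -
  have MA: "M \<subseteq> A" "finite M" and cut: "E \<union> F \<subseteq> cl A M"
    using M fin by (auto simp: best_def intro: finite_subset)
  obtain N where N: "N \<subseteq> M" "E \<subseteq> cl A N" "\<And>N'. N' \<subseteq> N \<Longrightarrow> E \<subseteq> cl A N' \<Longrightarrow> N' = N"
    using ex_minimal_cut[of M E A] MA cut by auto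
  have bdM: "bd A (cl A M) = M"
    by (rule bd_cl_eq[OF MA(1) cut]) (use best_minimal[OF fin M] in blast)
  have "N' = N" if N': "N' \<subseteq> A" "E \<subseteq> cl A N'" "card N' \<le> card (N \<inter> cl A N')" for N'
  proof -
    let ?D = "cl A N'" and ?DM = "cl A M"
    let ?N1 = "bd A (?D \<inter> ?DM)" and ?M1 = "bd A (?D \<union> ?DM)"
    have finite: "finite ?N1" "finite ?M1" "finite N'" "finite N"
      using fin bd_subset[of A] cl_subset[of A] N' N MA
      by (meson finite_subset finite_Int finite_Un)+
    have sub: "card ?N1 + card ?M1 \<le> card (bd A ?D) + card M"
      using card_bd_submodular[OF fin cl_subset cl_subset, of N' M] bdM by simp
    have bdD: "card (bd A ?D) \<le> card N'"
      by (rule card_mono) (use finite bd_cl in auto)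
    have D1: "?D \<union> ?DM \<subseteq> cl A ?M1" by (rule cl_bd) (use cl_subset in auto)
    have D2: "?D \<inter> ?DM \<subseteq> cl A ?N1" by (rule cl_bd) (use cl_subset in auto)
    \<comment> \<open>\<open>?M1\<close> encloses all that M closes, so if it is no larger it is a
      competitor of the best cut M.\<close>
    have M1: "?M1 = M" if "card ?M1 \<le> card M"
    proof -
      have "M \<inter> cl A ?M1 = M" using D1 cl_extensive[OF MA(1)] by blast
      moreover have "?M1 \<subseteq> A" using bd_subset cl_subset by blast
      moreover have "E \<union> F \<subseteq> cl A ?M1" using D1 cut by blast
      ultimately show ?thesis using bestD[OF M, of ?M1] that by simp
    qed
    have sub1: "N \<inter> ?D \<subseteq> ?N1"
    proof
      fix e assume e: "e \<in> N \<inter> ?D"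
      then have "e \<in> M" using N by auto
      then have "e \<in> bd A ?DM" using bdM by simp
      with e show "e \<in> ?N1" by (auto simp: bd_def)
    qed
    then have c1: "card (N \<inter> ?D) \<le> card ?N1" by (rule card_mono[OF finite(1)])
    have "card ?M1 \<ge> card M" using M1 by (cases "card ?M1 \<le> card M") auto
    \<comment> \<open>In the chain card N' \<le> card (N \<inter> ?D) \<le> card ?N1 \<le> card N'
      equality holds throughout, where the last inequality is submodularity together with card M
      \<le> card ?M1.\<close>
    then have eq: "card ?N1 = card N'" "card ?N1 = card (N \<inter> ?D)" "card ?M1 \<le> card M"
      using sub bdD c1 N'(3) by linarith+
    have M1': "?M1 = M" using M1 eq(3) by simp
    have "?N1 = N \<inter> ?D" using card_subset_eq[OF finite(1) sub1 eq(2)[symmetric]] by (rule sym)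
    moreover have "E \<subseteq> cl A ?N1" using D2 N'(2) cut by blast
    ultimately have N1: "?N1 = N" using N(3)[of ?N1] by simp
    \<comment> \<open>With \<open>?M1 = M\<close> the closure of N' lies inside that of M, so the
      intersection is \<open>?D\<close> and its boundary is a part of N'.\<close>
    have "?D \<subseteq> ?DM" using D1 M1' by simp
    then have "?D \<inter> ?DM = ?D" by blast
    then have "?N1 \<subseteq> N'" using bd_cl[of A N'] by simp
    then have "?N1 = N'" using card_subset_eq[OF finite(3) _ eq(1)] by blast
    with N1 show ?thesis by simp
  qed
  then have "best A E N" using N MA by (auto simp: best_def)
  with N(1) that show ?thesis by blast
qed

lemma best_more: "best A E M \<Longrightarrow> F \<subseteq> cl A M \<Longrightarrow> best A (E \<union> F) M"
  by (auto simp: best_def)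

text \<open>M remains best when closed nodes are added to the sources, so a best cut for F splits
  off. This turns the question whether a best cut closes F into a containment test on listed
  cuts.\<close>

lemma best_closes:
  assumes "finite A" "best A E M" "F \<subseteq> cl A M"
  obtains N where "N \<subseteq> M" "best A F N"
  using best_split[of A F E M] best_more[OF assms(2,3)] assms(1) by (metis Un_commute)

text \<open>The parts of M that \<open>best_split\<close> provides for E and for F together close E
  \<union> F, and no proper part of M does.\<close>

lemma best_Un:
  assumes fin: "finite A" and M: "best A (E \<union> F) M"
  obtains P Q where "best A E P" "best A F Q" "M = P \<union> Q"
proof -
  obtain P where P: "P \<subseteq> M" "best A E P" using best_split[OF fin M] .
  have "best A (F \<union> E) M" using M by (simp add: Un_commute)
  then obtain Q where Q: "Q \<subseteq> M" "best A F Q" using best_split[OF fin] by blast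
  have "E \<union> F \<subseteq> cl A (P \<union> Q)"
  proof -
    have "P \<union> Q \<subseteq> A" using P Q by (auto simp: best_def)
    then have "cl A P \<subseteq> cl A (P \<union> Q)" "cl A Q \<subseteq> cl A (P \<union> Q)" by (auto intro: cl_mono[THEN subsetD])
    then show ?thesis using P Q by (auto simp: best_def)
  qed
  then have "P \<union> Q = M" using best_minimal[OF fin M, of "P \<union> Q"] P Q by blast
  with P Q that show ?thesis by blast
qed

text \<open>If M does not contain e, it closes the successors of e and contains a best cut N for
  them. As e is no exit, N in turn closes e, so N is all of M by minimality.\<close>

lemma best_single:
  assumes "finite A" "e \<in> A" "best A {e} M"
  shows "M = {e} \<or> \<not> ex e \<and> best A (succs A e) M"
proof (cases "e \<in> M")
  case True
  then show ?thesis
    using best_minimal[OF assms(1,3), of "{e}"] cl_extensive[of "{e}" A] assms(2) by auto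
next
  case False
  have e: "e \<in> cl A M" using assms(3) by (auto simp: best_def)
  note c = succs_closed[OF e False]
  obtain N where N: "N \<subseteq> M" "best A (succs A e) N"
    using best_closes[OF assms(1,3) c(2)] .
  have "e \<in> cl A N" by (rule cl_succs) (use assms c N in \<open>auto simp: best_def\<close>)
  then have "N = M" using best_minimal[OF assms(1,3) N(1)] by simp
  with N c show ?thesis by simp
qed

text \<open>\<open>Z\<close> is M with the part closed by N replaced by N. The hypothesis on sizes
  is the one in \<open>best\<close>.\<close>

lemma exchange:
  assumes fin: "finite A" and "M \<subseteq> A" "N \<subseteq> A" "card N \<le> card (M \<inter> cl A N)"
  defines "Z \<equiv> N \<union> (M - cl A N)"
  shows "Z \<subseteq> A" "card Z \<le> card M" "M \<subseteq> cl A Z" "cl A N \<subseteq> cl A Z"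
proof -
  have finM: "finite M" using assms by (meson finite_subset)
  show ZA: "Z \<subseteq> A" using assms by auto
  have "card Z \<le> card N + card (M - cl A N)" unfolding Z_def by (rule card_Un_le)
  also have "\<dots> \<le> card (M \<inter> cl A N) + card (M - cl A N)" using assms by simp
  also have "\<dots> = card M" using card_Int_Diff[OF finM] by simp
  finally show "card Z \<le> card M" .
  show c: "cl A N \<subseteq> cl A Z" by (rule cl_mono) (use ZA Z_def in auto)
  show "M \<subseteq> cl A Z" using c cl_extensive[OF ZA] unfolding Z_def by auto
qed

text \<open>Among the cuts of least size that close a minimal subcut of \<open>M\<close>, one with largest closure is
  best: a smaller cut inside it would close that subcut as well.\<close>

lemma ex_best:
  assumes fin: "finite A" and M: "M \<subseteq> A" "E \<subseteq> cl A M"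
  obtains N where "best A E N" "card N \<le> card (M \<inter> cl A N)"
proof -
  have finM: "finite M" using fin M by (meson finite_subset)
  obtain M0 where M0: "M0 \<subseteq> M" "E \<subseteq> cl A M0" "\<And>N'. N' \<subseteq> M0 \<Longrightarrow> E \<subseteq> cl A N' \<Longrightarrow> N' = M0"
    using ex_minimal_cut[OF finM M(2)] by blast
  have M0A: "M0 \<subseteq> A" using M0 M by blast
  define S where "S = {N. N \<subseteq> A \<and> M0 \<subseteq> cl A N}"
  have M0S: "M0 \<in> S" using M0A cl_extensive[OF M0A] by (auto simp: S_def)
  define l where "l = (LEAST c. \<exists>N\<in>S. card N = c)"
  have l: "\<exists>N\<in>S. card N = l" unfolding l_def by (rule LeastI[of _ "card M0"]) (use M0S in blast)
  have lmin: "l \<le> card N" if "N \<in> S" for N unfolding l_def by (rule Least_le) (use that in blast)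
  define S' where "S' = {N\<in>S. card N = l}"
  have "finite S'" by (rule finite_subset[of _ "Pow A"]) (use fin in \<open>auto simp: S'_def S_def\<close>)
  moreover have "S' \<noteq> {}" using l by (auto simp: S'_def)
  ultimately obtain X where X: "X \<in> cl A ` S'" "\<And>b. b \<in> cl A ` S' \<Longrightarrow> X \<subseteq> b \<Longrightarrow> X = b"
    using finite_has_maximal[of "cl A ` S'"] by auto
  then obtain N where N1: "N \<in> S'" "X = cl A N" by blast
  have N: "N \<in> S'" "\<And>b. b \<in> S' \<Longrightarrow> cl A N \<subseteq> cl A b \<Longrightarrow> cl A N = cl A b"
    using N1 X(2) by simp_all
  have NA: "N \<subseteq> A" "M0 \<subseteq> cl A N" "card N = l" and finN: "finite N"
    using N fin by (auto simp: S'_def S_def intro: finite_subset)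
  have EN: "E \<subseteq> cl A N" using M0(2) cl_least[OF NA(2)] by blast
  have bdN: "bd A (cl A N) = N"
  proof (rule card_subset_eq[OF finN bd_cl])
    have "bd A (cl A N) \<in> S"
      using NA cl_bd[OF cl_subset, of A N] bd_cl[of A N] by (auto simp: S_def)
    then show "card (bd A (cl A N)) = card N"
      using lmin NA card_mono[OF finN bd_cl[of A N]] by fastforce
  qed
  have bdM0: "bd A (cl A M0) = M0" by (rule bd_cl_eq[OF M0A M0(2,3)])
  have "N' = N" if N': "N' \<subseteq> A" "E \<subseteq> cl A N'" "card N' \<le> card (N \<inter> cl A N')" for N'
  proof -
    \<comment> \<open>The exchange gives a member of S of least size whose closure contains that of
      N. Maximality of the closure and \<open>bdN\<close> force \<open>?Z\<close> = N, hence N'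
      \<subseteq> N.\<close>
    let ?Z = "N' \<union> (N - cl A N')"
    note Z = exchange[OF fin NA(1) N'(1,3)]
    have ZS: "?Z \<in> S" using Z NA cl_least[of N A ?Z] by (auto simp: S_def)
    then have cZ: "card ?Z = card N" using lmin[of ?Z] NA Z(2) by simp
    have "cl A N = cl A ?Z"
      by (rule N(2)) (use ZS cZ NA cl_least[OF Z(3)] in \<open>auto simp: S'_def\<close>)
    then have "N \<subseteq> ?Z" using bdN bd_cl[of A ?Z] by simp
    moreover have finZ: "finite ?Z" using Z(1) fin by (meson finite_subset)
    ultimately have "N = ?Z" using card_subset_eq cZ by metis
    then have sub: "N' \<subseteq> N" by blast
    have M0N: "N \<inter> cl A M0 \<subseteq> M0"
    proof
      fix g assume g: "g \<in> N \<inter> cl A M0"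
      then have "g \<in> bd A (cl A N)" using bdN by simp
      then have "g \<in> bd A (cl A M0)"
        using g cl_least[OF NA(2)] by (auto simp: bd_def)
      then show "g \<in> M0" using bdM0 by simp
    qed
    \<comment> \<open>It remains to see that N' closes M0, since then N' is no smaller than N. This
      boundary lies in M0 and still closes E, so it is M0 by minimality, and a boundary is part of
      its set.\<close>
    let ?B = "bd A (cl A N' \<inter> cl A M0)"
    have "?B \<subseteq> bd A (cl A M0) \<union> (bd A (cl A N') \<inter> cl A M0)" by (auto simp: bd_def)
    then have "?B \<subseteq> M0" using bdM0 bd_cl[of A N'] sub M0N by blast
    moreover have D: "cl A N' \<inter> cl A M0 \<subseteq> cl A ?B" by (rule cl_bd) (use cl_subset in auto)
    ultimately have "?B = M0" using M0(2,3) N'(2) by blast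
    then have "M0 \<subseteq> cl A N'" using bd_subset[of A "cl A N' \<inter> cl A M0"] by blast
    then have "card N \<le> card N'" using lmin[of N'] N'(1) NA by (auto simp: S_def)
    then show ?thesis using sub finN card_seteq by blast
  qed
  then have b: "best A E N" using NA EN by (auto simp: best_def)
  have "card N \<le> card M0" using lmin[OF M0S] NA by simp
  also have "\<dots> \<le> card (M \<inter> cl A N)" by (rule card_mono) (use finM M0 NA in auto)
  finally show ?thesis using that b by blast
qed

text \<open>The boundary of the intersection of the closures closes E, so it is at least as large as
  N. By submodularity the boundary of the union is at most as large as M; since it encloses M, it is
  M.\<close>

lemma min_best_closed:
  assumes fin: "finite A" and N: "best A E N" and M: "best A E M"
    and min: "\<And>N'. N' \<subseteq> A \<Longrightarrow> E \<subseteq> cl A N' \<Longrightarrow> card N \<le> card N'"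
  shows "N \<subseteq> cl A M"
proof -
  let ?U = "bd A (cl A N \<union> cl A M)" and ?I = "bd A (cl A N \<inter> cl A M)"
  have A: "N \<subseteq> A" "M \<subseteq> A" and E: "E \<subseteq> cl A N" "E \<subseteq> cl A M" using N M by (auto simp: best_def)
  have f: "finite N" "finite M" using A fin by (auto intro: finite_subset)
  have I: "cl A N \<inter> cl A M \<subseteq> cl A ?I" and U: "cl A N \<union> cl A M \<subseteq> cl A ?U"
    by (rule cl_bd; use cl_subset in auto)+
  have sA: "?I \<subseteq> A" "?U \<subseteq> A" using bd_subset cl_subset by blast+
  have "card N \<le> card ?I" by (rule min) (use sA I E in auto)
  moreover have "card ?I + card ?U \<le> card (bd A (cl A N)) + card (bd A (cl A M))"
    by (rule card_bd_submodular[OF fin cl_subset cl_subset])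
  moreover have "card (bd A (cl A N)) \<le> card N" "card (bd A (cl A M)) \<le> card M"
    by (rule card_mono; use f bd_cl in auto)+
  ultimately have "card ?U \<le> card M" by linarith
  moreover have "M \<inter> cl A ?U = M" using U cl_extensive[OF A(2)] by blast
  moreover have "E \<subseteq> cl A ?U" using U E by blast
  ultimately have "?U = M" using bestD[OF M sA(2)] by simp
  then show ?thesis using U cl_extensive[OF A(1)] by auto
qed

section \<open>Deleting an arc, and counting best cuts\<close>

lemma opn_delete: "opn (A - {e}) M f \<longleftrightarrow> opn A (insert e M) f"
proof
  assume "opn (A - {e}) M f"
  then show "opn A (insert e M) f" by induction (auto intro: opn.intros)
next
  assume "opn A (insert e M) f"
  then show "opn (A - {e}) M f" by induction (auto intro: opn.intros)
qed

lemma cl_delete: "e \<in> A \<Longrightarrow> cl A (insert e M) = insert e (cl (A - {e}) M)"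
  by (auto simp: cl_def opn_delete dest: opn_in)

text \<open>Deleting e amounts to adding it to every cut: a competitor N in \<open>A - {e}\<close>
  becomes the competitor \<open>insert e N\<close> in A, and both sides of the size inequality grow
  by one.\<close>

lemma best_delete:
  assumes fin: "finite A" and M: "best A E M" and e: "e \<in> M"
  shows "best (A - {e}) (E - {e}) (M - {e})"
proof -
  have MA: "M \<subseteq> A" "e \<in> A" "finite M" "E \<subseteq> cl A M"
    using assms by (auto simp: best_def intro: finite_subset)
  have "N = M - {e}" if N: "N \<subseteq> A - {e}" "E - {e} \<subseteq> cl (A - {e}) N"
    "card N \<le> card ((M - {e}) \<inter> cl (A - {e}) N)" for N
  proof -
    have c: "cl A (insert e N) = insert e (cl (A - {e}) N)" by (rule cl_delete[OF MA(2)])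
    have fN: "finite N" using N fin by (meson finite_subset finite_Diff)
    have "e \<notin> N" using N(1) by blast
    then have "card (insert e N) = Suc (card N)" using fN by simp
    also have "\<dots> \<le> Suc (card ((M - {e}) \<inter> cl (A - {e}) N))" using N by simp
    also have "\<dots> = card (insert e ((M - {e}) \<inter> cl (A - {e}) N))" using MA by simp
    also have "insert e ((M - {e}) \<inter> cl (A - {e}) N) = M \<inter> cl A (insert e N)" using c e
      cl_subset[of "A - {e}" N] by auto
    finally have le: "card (insert e N) \<le> card (M \<inter> cl A (insert e N))" .
    have "insert e N = M"
      by (rule bestD[OF M _ _ le]) (use N c MA in blast)+
    then show ?thesis using N by auto
  qed
  moreover have "cl A M = insert e (cl (A - {e}) (M - {e}))"
    using cl_delete[OF MA(2), of "M - {e}"] e by (simp add: insert_absorb)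
  ultimately show ?thesis using MA by (auto simp: best_def)
qed

text \<open>
  Branching on an arc \<open>e\<close> of a latest minimum cut: cuts containing \<open>e\<close> are counted after deleting \<open>e\<close>,
  the others separate the successors of \<open>e\<close> as well, which raises the minimum cut size.
\<close>

lemma card_best_aux:
  assumes "finite A" "E \<subseteq> A"
    "\<And>N. N \<subseteq> A \<Longrightarrow> E \<subseteq> cl A N \<Longrightarrow> l \<le> card N" "2 * k \<le> l + d"
  shows "card {M. best A E M \<and> card M \<le> k} \<le> 2 ^ d"
  using assms
proof (induction d arbitrary: A E l k)
  \<comment> \<open>Now 2 * k \<le> l, while a counted cut has at least l and at most k members; so
    k = 0 and the cut is empty.\<close>
  case ind: 0
  have "M = {}" if "best A E M" "card M \<le> k" for M
  proof -
    have "l \<le> card M" using ind that by (auto simp: best_def)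
    then have "card M = 0" using ind that by auto
    then show ?thesis using that ind by (auto simp: best_def dest: finite_subset)
  qed
  then have "{M. best A E M \<and> card M \<le> k} \<subseteq> {{}}" by blast
  from card_mono[OF _ this] show ?case by simp
next
  case (Suc d)
  note fin = Suc.prems(1)
  have fpow: "finite {M. best B F M \<and> card M \<le> j}" if "finite B" for B F j
    by (rule finite_subset[of _ "Pow B"]) (use that in \<open>auto simp: best_def\<close>)
  have "A \<subseteq> cl A A" by (rule cl_extensive) simp
  then have EA: "E \<subseteq> cl A A" using Suc.prems(2) by blast
  \<comment> \<open>The measure is 2 * k - l, where l is any lower bound on the cut sizes. Branching
    uses the true minimum, which is at least l.\<close>
  define lam where "lam = (LEAST c. \<exists>N\<subseteq>A. E \<subseteq> cl A N \<and> card N = c)"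
  have "\<exists>N\<subseteq>A. E \<subseteq> cl A N \<and> card N = lam"
    unfolding lam_def by (rule LeastI[of _ "card A"]) (use EA in blast)
  then obtain N0 where N0: "N0 \<subseteq> A" "E \<subseteq> cl A N0" "card N0 = lam" by blast
  have lmin: "lam \<le> card N" if "N \<subseteq> A" "E \<subseteq> cl A N" for N
    unfolding lam_def by (rule Least_le) (use that in blast)
  obtain Ms where Ms: "best A E Ms" "card Ms \<le> card (N0 \<inter> cl A Ms)"
    using ex_best[OF fin N0(1,2)] .
  have MsA: "Ms \<subseteq> A" "E \<subseteq> cl A Ms" "finite Ms" using Ms fin by (auto simp: best_def intro: finite_subset)
  have "card (N0 \<inter> cl A Ms) \<le> card N0" using N0 fin by (intro card_mono) (auto intro: finite_subset)
  then have cMs: "card Ms = lam" using Ms N0 lmin[OF MsA(1,2)] by simp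
  have llam: "l \<le> lam" using Suc.prems(3) N0 by blast
  show ?case
  proof (cases "lam > k")
    case True
    have "\<not> (best A E M \<and> card M \<le> k)" for M
      using lmin[of M] True unfolding best_def by fastforce
    then have "{M. best A E M \<and> card M \<le> k} = {}" by blast
    then show ?thesis by (simp only: card.empty)
  next
    case lk: False
    show ?thesis
    proof (cases "Ms = {}")
      case True
      have "M = {}" if "best A E M" for M
        using best_minimal[OF fin that, of "{}"] MsA True by auto
      then have "{M. best A E M \<and> card M \<le> k} \<subseteq> {{}}" by blast
      from card_mono[OF _ this] have "card {M. best A E M \<and> card M \<le> k} \<le> 1" by simp
      also have "(1::nat) \<le> 2 ^ Suc d" by simp
      finally show ?thesis .
    next
      case False
      then obtain e where e: "e \<in> Ms" by blast
      have lam1: "lam \<ge> 1" using False cMs MsA by (cases lam) auto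
      \<comment> \<open>A best cut without e closes \<open>Ms\<close> by
        \<open>min_best_closed\<close>, and hence the successors of e. Having \<open>Ms\<close>
        among the sources lets every cut for \<open>E2\<close> be compared with the best cut
        \<open>Ms\<close>.\<close>
      define E2 where "E2 = E \<union> Ms \<union> succs A e"
      let ?S1 = "{M. best (A - {e}) (E - {e}) M \<and> card M \<le> k - 1}"
      \<comment> \<open>If e is an exit, a cut that closes e contains e, so this branch is
        empty.\<close>
      let ?S2 = "{M. (best A E2 M \<and> card M \<le> k) \<and> \<not> ex e}"
      have "{M. best A E M \<and> card M \<le> k} \<subseteq> insert e ` ?S1 \<union> ?S2"
      proof
        fix M assume M: "M \<in> {M. best A E M \<and> card M \<le> k}"
        have fM: "finite M" using M fin by (auto simp: best_def intro: finite_subset)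
        have McM: "Ms \<subseteq> cl A M"
          by (rule min_best_closed[OF fin Ms(1)]) (use M cMs lmin in auto)
        show "M \<in> insert e ` ?S1 \<union> ?S2"
        proof (cases "e \<in> M")
          case True
          then have "M - {e} \<in> ?S1" using best_delete[OF fin _ True] M fM by auto
          moreover have "M = insert e (M - {e})" using True by auto
          ultimately show ?thesis by blast
        next
          case False
          have "succs A e \<subseteq> cl A M" and ne: "\<not> ex e" using succs_closed[of e A M] McM e False by blast+
          with McM M have "best A E2 M" unfolding E2_def by (auto intro: best_more)
          then show ?thesis using M ne by blast
        qed
      qed
      then have "card {M. best A E M \<and> card M \<le> k} \<le> card (insert e ` ?S1 \<union> ?S2)"
        by (rule card_mono[rotated]) (use fpow fin in \<open>simp add: finite_subset[OF _ fpow[OF fin, of E2 k]] subset_iff\<close>)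
      also have "\<dots> \<le> card (insert e ` ?S1) + card ?S2" by (rule card_Un_le)
      also have "card (insert e ` ?S1) \<le> card ?S1" by (rule card_image_le) (use fpow fin in auto)
      also have "card ?S1 \<le> 2 ^ d"
      proof (rule Suc.IH)
        show "lam - 1 \<le> card N" if "N \<subseteq> A - {e}" "E - {e} \<subseteq> cl (A - {e}) N" for N
        proof -
          have "e \<in> A" using e MsA by auto
          then have "E \<subseteq> cl A (insert e N)" using that cl_delete[of e A N] by auto
          moreover have "insert e N \<subseteq> A" using that \<open>e \<in> A\<close> by auto
          ultimately have "lam \<le> card (insert e N)" by (intro lmin)
          also have "\<dots> \<le> Suc (card N)" by (simp add: card_insert_le_m1 card_insert_if)
          finally show ?thesis by simp
        qed
        \<comment> \<open>Both k and the minimum drop by one, so 2 * k - lam drops by one. In the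
          other branch k stays and the minimum grows.\<close>
        show "2 * (k - 1) \<le> lam - 1 + d" using Suc.prems(4) llam lam1 lk by simp
      qed (use fin Suc.prems in auto)
      also have "card ?S2 \<le> 2 ^ d"
      proof (cases "ex e")
        case nex: False
        have "card {M. best A E2 M \<and> card M \<le> k} \<le> 2 ^ d"
        proof (rule Suc.IH)
          show "E2 \<subseteq> A" using Suc.prems MsA by (auto simp: E2_def succs_def)
          \<comment> \<open>A cut for \<open>E2\<close> of size at most \<open>lam\<close> closes
            \<open>Ms\<close>, so it is \<open>Ms\<close> because \<open>Ms\<close> is best. But
            then \<open>Ms\<close> closes all successors of e, and e, which is no exit, is not on
            its boundary.\<close>
          show "lam + 1 \<le> card N" if N: "N \<subseteq> A" "E2 \<subseteq> cl A N" for N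
          proof (rule ccontr)
            assume "\<not> lam + 1 \<le> card N"
            then have "card N \<le> card Ms" using cMs by simp
            moreover have "Ms \<inter> cl A N = Ms" "E \<subseteq> cl A N" using N by (auto simp: E2_def)
            ultimately have "N = Ms" using Ms(1) N(1) by (auto simp: best_def)
            then have c: "succs A e \<subseteq> cl A Ms" using N by (auto simp: E2_def)
            have "bd A (cl A Ms) = Ms"
              by (rule bd_cl_eq[OF MsA(1,2)]) (use best_minimal[OF fin Ms(1)] in blast)
            then have "e \<in> bd A (cl A Ms)" using e by simp
            then show False using c nex by (auto simp: bd_def succs_def)
          qed
          show "2 * k \<le> lam + 1 + d" using Suc.prems(4) llam by simp
        qed (use fin in auto)
        then show ?thesis using nex by simp
      qed simp
      finally show ?thesis by simp
    qed
  qed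
qed

section \<open>Families of small best cuts, and the comparison of candidates\<close>

definition latest_upto :: "nat \<Rightarrow> 'b set \<Rightarrow> 'b set \<Rightarrow> 'b set set" where
  "latest_upto k A E = {M. best A E M \<and> card M \<le> k}"

text \<open>The branching starts from the trivial lower bound 0, hence with depth 2 * k.\<close>

lemma card_latest_upto:
  assumes "finite A" "E \<subseteq> A" shows "card (latest_upto k A E) \<le> 4 ^ k"
  using card_best_aux[OF assms, of 0 k "2 * k"] by (simp add: latest_upto_def power_mult)

text \<open>Inside a successor-closed set D, the part \<open>M \<inter> D\<close> closes all that M
  closes, so minimality confines M to D. This keeps the cuts met by the algorithm among the arcs
  already treated.\<close>

lemma best_reach:
  assumes fin: "finite A" and M: "best A E M" and "E \<subseteq> D"
    and D: "\<And>e f. e \<in> D \<Longrightarrow> f \<in> A \<Longrightarrow> sc e f \<Longrightarrow> f \<in> D"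
  shows "M \<subseteq> D"
proof -
  have "opn A M e" if "opn A (M \<inter> D) e" "e \<in> D" for e
    using that
  proof induction
    case (opn_exit e)
    then show ?case by (auto intro: opn.opn_exit)
  next
    case (opn_step e f)
    then show ?case using D opn_in[of A] by (blast intro: opn.opn_step)
  qed
  then have "cl A M \<inter> D \<subseteq> cl A (M \<inter> D)" by (auto simp: cl_def)
  then have "E \<subseteq> cl A (M \<inter> D)" using M assms(3) unfolding best_def by blast
  then have "M \<inter> D = M" using best_minimal[OF fin M, of "M \<inter> D"] by blast
  then show ?thesis by blast
qed

text \<open>The candidates in \<open>K\<close> can be compared without looking at the graph: a best cut closes an arc
  iff it contains the arc or one of the best cuts for the successors of the arc.\<close>

lemma filter_latest:
  assumes fin: "finite A" and "latest_upto k A E \<subseteq> K"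
    and K: "\<And>M. M \<in> K \<Longrightarrow> M \<subseteq> A \<and> E \<subseteq> cl A M \<and> card M \<le> k"
    and L: "\<And>M b. M \<in> K \<Longrightarrow> b \<in> M \<Longrightarrow> L b = (if ex b then {} else latest_upto k A (succs A b))"
  shows "{M \<in> K. \<forall>N\<in>K. card N \<le> card {b \<in> M. b \<in> N \<or> (\<exists>P\<in>L b. P \<subseteq> N)} \<longrightarrow> N = M} = latest_upto k A E"
    (is "?F = _")
proof -
  let ?t = "\<lambda>M N. {b \<in> M. b \<in> N \<or> (\<exists>P\<in>L b. P \<subseteq> N)}"
  \<comment> \<open>Valid for every candidate N, best or not: a listed cut contained in N certifies
    that N closes the arc.\<close>
  have sound: "?t M N \<subseteq> M \<inter> cl A N" if "M \<in> K" "N \<in> K" for M N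
  proof
    fix b assume b: "b \<in> ?t M N"
    have A: "M \<subseteq> A" "N \<subseteq> A" using K that by blast+
    show "b \<in> M \<inter> cl A N"
    proof (cases "b \<in> N")
      case True
      then show ?thesis using b cl_extensive[OF A(2)] by blast
    next
      case False
      then obtain P where P: "P \<in> L b" "P \<subseteq> N" using b by blast
      moreover have bM: "b \<in> M" using b by blast
      ultimately have "\<not> ex b" "succs A b \<subseteq> cl A P"
        using L[OF that(1) bM] by (auto simp: latest_upto_def best_def split: if_splits)
      moreover have "cl A P \<subseteq> cl A N" by (rule cl_mono[OF P(2) A(2)])
      ultimately show ?thesis using cl_succs[of b A N] bM A by blast
    qed
  qed
  \<comment> \<open>For best N the certificate exists by \<open>best_closes\<close>, and being part
    of N it is small enough to be listed in \<open>L b\<close>.\<close>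
  have complete: "?t M N = M \<inter> cl A N" if "M \<in> K" "N \<in> latest_upto k A E" for M N
  proof
    have NK: "N \<in> K" using that assms(2) by blast
    then show "?t M N \<subseteq> M \<inter> cl A N" using sound that by blast
    show "M \<inter> cl A N \<subseteq> ?t M N"
    proof
      fix b assume b: "b \<in> M \<inter> cl A N"
      show "b \<in> ?t M N"
      proof (cases "b \<in> N")
        case False
        have N: "best A E N" "card N \<le> k" "N \<subseteq> A" using that by (auto simp: latest_upto_def best_def)
        note c = succs_closed[of b A N, OF _ False]
        obtain P where P: "P \<subseteq> N" "best A (succs A b) P"
          using best_closes[OF fin N(1) c(2)] b by blast
        have "card P \<le> card N" by (rule card_mono) (use P N fin in \<open>auto intro: finite_subset\<close>)
        then have "P \<in> L b" using L[OF that(1), of b] b c(1) P N by (auto simp: latest_upto_def)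
        then show ?thesis using P b by blast
      qed (use b in blast)
    qed
  qed
  show ?thesis
  proof
    show "?F \<subseteq> latest_upto k A E"
    proof
      fix M assume M: "M \<in> ?F"
      then have "M \<subseteq> A" "E \<subseteq> cl A M" using K by simp_all
      \<comment> \<open>The witness is no larger than M, so it has at most k members and is itself a
        candidate, against which the test is exact.\<close>
      then obtain N where N: "best A E N" "card N \<le> card (M \<inter> cl A N)"
        by (rule ex_best[OF fin])
      have fM: "finite M" using fin \<open>M \<subseteq> A\<close> by (rule finite_subset[rotated])
      have "card (M \<inter> cl A N) \<le> card M" by (rule card_mono) (use fM in auto)
      then have NL: "N \<in> latest_upto k A E" using N M K by (fastforce simp: latest_upto_def)
      have MK: "M \<in> K" and NK: "N \<in> K" using M NL assms(2) by blast+
      have "card N \<le> card (?t M N)" using N(2) unfolding complete[OF MK NL] .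
      then have "N = M" using M NK by blast
      then show "M \<in> latest_upto k A E" using NL by simp
    qed
    show "latest_upto k A E \<subseteq> ?F"
    proof
      fix M assume M: "M \<in> latest_upto k A E"
      then have MK: "M \<in> K" using assms by blast
      \<comment> \<open>The test never exceeds the true count, so an N that passes it is a genuine
        competitor of the best cut M.\<close>
      have "N = M" if N: "N \<in> K" "card N \<le> card (?t M N)" for N
      proof -
        have "finite M" using K[OF MK] fin by (auto intro: finite_subset)
        then have "card (?t M N) \<le> card (M \<inter> cl A N)"
          by (intro card_mono) (use sound[OF MK N(1)] in auto)
        then show ?thesis using M N K[OF N(1)] by (auto simp: latest_upto_def best_def)
      qed
      then show "M \<in> ?F" using MK by blast
    qed
  qed
qed

text \<open>\<open>best_Un\<close> splits a cut into parts for X and for {e}, and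
  \<open>best_single\<close> describes the second. Conversely each union closes X through P and e
  through Q, which contains e or closes its successors.\<close>

lemma latest_upto_insert:
  fixes X
  assumes fin: "finite A" and e: "e \<in> A" and L: "L e = (if ex e then {} else latest_upto k A (succs A e))"
  defines "K \<equiv> {P \<union> Q |P Q. P \<in> latest_upto k A X \<and> Q \<in> insert {e} (L e) \<and> card (P \<union> Q) \<le> k}"
  shows "latest_upto k A (insert e X) \<subseteq> K"
    and "\<And>M. M \<in> K \<Longrightarrow> M \<subseteq> A \<and> insert e X \<subseteq> cl A M \<and> card M \<le> k"
proof -
  show "latest_upto k A (insert e X) \<subseteq> K"
  proof
    fix M assume M: "M \<in> latest_upto k A (insert e X)"
    then have b: "best A (X \<union> {e}) M" and Mk: "card M \<le> k" by (auto simp: latest_upto_def)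
    obtain P Q where PQ: "best A X P" "best A {e} Q" "M = P \<union> Q"
      using best_Un[OF fin b] .
    have fM: "finite M" using b fin by (auto simp: best_def intro: finite_subset)
    then have "card P \<le> card M" "card Q \<le> card M" using PQ by (auto intro: card_mono)
    then have "P \<in> latest_upto k A X" "Q \<in> insert {e} (L e)"
      using PQ Mk best_single[OF fin e PQ(2)] L by (auto simp: latest_upto_def)
    then show "M \<in> K" using PQ Mk unfolding K_def by blast
  qed
  fix M assume "M \<in> K"
  then obtain P Q where PQ: "M = P \<union> Q" "P \<in> latest_upto k A X" "Q \<in> insert {e} (L e)" "card M \<le> k"
    unfolding K_def by blast
  have P: "P \<subseteq> A" "X \<subseteq> cl A P" using PQ by (auto simp: latest_upto_def best_def)
  have Q: "Q \<subseteq> A" "e \<in> cl A Q"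
    using PQ(3) L e cl_extensive[of "{e}" A] cl_succs[of e A Q]
    by (auto simp: latest_upto_def best_def split: if_splits)
  have "cl A P \<subseteq> cl A M" "cl A Q \<subseteq> cl A M" by (rule cl_mono; use PQ P Q in auto)+
  then show "M \<subseteq> A \<and> insert e X \<subseteq> cl A M \<and> card M \<le> k" using P Q PQ by blast
qed

end

section \<open>Cuts of a digraph as vertex cuts on its arcs\<close>

locale cut_digraph = fixes G :: "('a, 'b) pre_digraph" and t :: 'a
  assumes wf: "wf_digraph G" and fin: "finite (arcs G)" and t: "t \<in> verts G"
begin

sublocale exit_digraph "\<lambda>e f. head G e = tail G f" "\<lambda>e. head G e = t" .

abbreviation "out v \<equiv> {e \<in> arcs G. tail G e = v}"

text \<open>Translates reachability from a vertex into openness of an arc leaving it; only the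
  target itself reaches t without an arc.\<close>

lemma target_side_iff:
  "v \<in> target_side G t M \<longleftrightarrow> v \<in> verts G \<and> (v = t \<or> (\<exists>e\<in>out v. opn (arcs G) M e))"
proof
  assume "v \<in> target_side G t M"
  then have v: "v \<in> verts G" and "v \<rightarrow>\<^sup>*\<^bsub>delete_arcs G M\<^esub> t" by (auto simp: target_side_def)
  from this(2) have "v = t \<or> (\<exists>e\<in>out v. opn (arcs G) M e)"
    unfolding reachable_def
  proof (induction rule: converse_rtrancl_on_induct)
    case (step x y)
    then obtain e where e: "e \<in> arcs G" "e \<notin> M" "tail G e = x" "head G e = y"
      by (auto simp: delete_arcs_def arcs_ends_def arc_to_ends_def)
    from step(5) show ?case
    proof
      assume "y = t"
      then have "opn (arcs G) M e" using e by (intro opn_exit) simp_all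
      then show ?thesis using e by blast
    next
      assume "\<exists>f\<in>out y. opn (arcs G) M f"
      then obtain f where "f \<in> arcs G" "head G e = tail G f" "opn (arcs G) M f" using e by auto
      then have "opn (arcs G) M e" using e by (blast intro: opn_step)
      then show ?thesis using e by blast
    qed
  qed simp
  with v show "v \<in> verts G \<and> (v = t \<or> (\<exists>e\<in>out v. opn (arcs G) M e))" by simp
next
  have *: "tail G e \<rightarrow>\<^sup>*\<^bsub>delete_arcs G M\<^esub> t" if "opn (arcs G) M e" for e
    using that
  proof induction
    case (opn_exit e)
    then have "(tail G e, t) \<in> arcs_ends (delete_arcs G M)" "tail G e \<in> verts G"
      using wf by (auto simp: delete_arcs_def arcs_ends_def arc_to_ends_def wf_digraph_def)
    then show ?case unfolding reachable_def using t
      by (auto simp: delete_arcs_def intro: converse_rtrancl_on_into_rtrancl_on)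
  next
    case (opn_step e f)
    then have "(tail G e, tail G f) \<in> arcs_ends (delete_arcs G M)" "tail G e \<in> verts G"
      using wf by (auto simp: delete_arcs_def arcs_ends_def arc_to_ends_def wf_digraph_def image_iff)
    then show ?case using opn_step unfolding reachable_def
      by (auto simp: delete_arcs_def intro: converse_rtrancl_on_into_rtrancl_on)
  qed
  assume "v \<in> verts G \<and> (v = t \<or> (\<exists>e\<in>out v. opn (arcs G) M e))"
  then show "v \<in> target_side G t M"
    using * by (auto simp: target_side_def reachable_def delete_arcs_def)
qed

text \<open>The condition s \<noteq> t is there because the empty path connects t to itself whatever
  is deleted.\<close>

lemma st_cut_iff:
  assumes "s \<in> verts G"
  shows "st_cut G s t M \<longleftrightarrow> M \<subseteq> arcs G \<and> s \<noteq> t \<and> out s \<subseteq> cl (arcs G) M"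
proof -
  have "st_cut G s t M \<longleftrightarrow> M \<subseteq> arcs G \<and> s \<notin> target_side G t M"
    using assms by (auto simp: st_cut_def target_side_def)
  also have "\<dots> \<longleftrightarrow> M \<subseteq> arcs G \<and> s \<noteq> t \<and> out s \<subseteq> cl (arcs G) M"
    using assms by (auto simp: target_side_iff cl_def)
  finally show ?thesis .
qed

lemma bd_minimal_st_cut:
  assumes "minimal_st_cut G s t M" and "s \<in> verts G"
  shows "bd (arcs G) (cl (arcs G) M) = M"
proof (rule bd_cl_eq)
  show MA: "M \<subseteq> arcs G" and cut: "out s \<subseteq> cl (arcs G) M"
    using assms by (simp_all add: minimal_st_cut_def st_cut_iff)
  show "N = M" if "N \<subseteq> M" "out s \<subseteq> cl (arcs G) N" for N
  proof -
    have "st_cut G s t N" using assms that MA by (auto simp: minimal_st_cut_def st_cut_iff)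
    with assms that(1) show ?thesis by (auto simp: minimal_st_cut_def)
  qed
qed

lemma target_side_mono:
  "cl (arcs G) M \<subseteq> cl (arcs G) N \<Longrightarrow> target_side G t N \<subseteq> target_side G t M"
  by (fastforce simp: target_side_iff cl_def dest: opn_in)

text \<open>Passes from the order on vertex sets to closure of arcs. If N left an arc e of M open,
  the tail of e would reach t despite M, and \<open>M - {e}\<close> would still be a cut.\<close>

lemma target_side_closes:
  assumes min: "minimal_st_cut G s t M" and s: "s \<in> verts G"
    and sub: "target_side G t N \<subseteq> target_side G t M" and NA: "N \<subseteq> arcs G"
  shows "M \<subseteq> cl (arcs G) N"
proof
  fix e assume e: "e \<in> M"
  have MA: "M \<subseteq> arcs G" and cut: "s \<noteq> t" "out s \<subseteq> cl (arcs G) M"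
    using min s by (auto simp: minimal_st_cut_def st_cut_iff)
  show "e \<in> cl (arcs G) N"
  proof (rule ccontr)
    assume n: "e \<notin> cl (arcs G) N"
    have eA: "e \<in> arcs G" using e MA by blast
    have "opn (arcs G) N e" using n eA by (auto simp: cl_def)
    then have "tail G e \<in> target_side G t N"
      using eA wf by (auto simp: target_side_iff wf_digraph_def)
    then have "tail G e \<in> target_side G t M" using sub by blast
    text \<open>Some arc other than \<open>e\<close> leaves the tail of \<open>e\<close> towards \<open>t\<close>, or that tail is \<open>t\<close>. Either way no
      arc entering the tail is closed by \<open>M\<close> unless it lies in \<open>M\<close>, which makes \<open>e\<close> redundant.\<close>
    then have T: "tail G e = t \<or> (\<exists>f\<in>arcs G. tail G f = tail G e \<and> opn (arcs G) M f)"
      by (auto simp: target_side_iff)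
    have "opn (arcs G) M f" if "opn (arcs G) (M - {e}) f" "f \<noteq> e" for f
      using that
    proof induction
      case (opn_exit f)
      then show ?case by (intro opn.opn_exit) simp_all
    next
      case (opn_step f g)
      then have f: "f \<in> arcs G" "f \<notin> M" by auto
      show ?case
      proof (cases "g = e")
        case True
        then have h: "head G f = tail G e" using opn_step by simp
        from T show ?thesis
        proof
          assume "tail G e = t"
          then have "head G f = t" using h by simp
          with f show ?thesis by (rule opn.opn_exit)
        next
          assume "\<exists>f\<in>arcs G. tail G f = tail G e \<and> opn (arcs G) M f"
          then obtain g' where "head G f = tail G g'" "opn (arcs G) M g'" using h by metis
          with f show ?thesis by (rule opn.opn_step)
        qed
      next
        case False
        then show ?thesis using opn_step f by (blast intro: opn.opn_step)
      qed
    qed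
    moreover have "tail G e \<noteq> s" using T cut by (auto simp: cl_def)
    ultimately have "out s \<subseteq> cl (arcs G) (M - {e})" using cut by (auto simp: cl_def)
    then have "st_cut G s t (M - {e})" using MA cut s by (auto simp: st_cut_iff)
    then show False using min e by (auto simp: minimal_st_cut_def)
  qed
qed

text \<open>A later cut that is no larger closes M by \<open>target_side_closes\<close>, so a best M
  admits none. Conversely the exchange turns a competitor N into a cut \<open>?Z\<close> that closes
  M. As M is latest, the target sides agree, which leads to \<open>?Z\<close> = M and so to N
  \<subseteq> M, where minimality applies.\<close>

lemma latest_iff_best:
  assumes s: "s \<in> verts G"
  shows "st_latest G s t M \<and> minimal_st_cut G s t M \<longleftrightarrow> s \<noteq> t \<and> best (arcs G) (out s) M"
proof
  assume L: "s \<noteq> t \<and> best (arcs G) (out s) M"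
  then have cut: "st_cut G s t M" using s by (auto simp: st_cut_iff best_def)
  have "M' = M" if "M' \<subseteq> M" "st_cut G s t M'" for M'
    using best_minimal[OF fin _ that(1)] that L s by (auto simp: st_cut_iff)
  then have min: "minimal_st_cut G s t M" using cut by (auto simp: minimal_st_cut_def)
  have "\<not> later G t N M" if N: "st_cut G s t N" "card N \<le> card M" for N
  proof
    assume l: "later G t N M"
    then have "M \<subseteq> cl (arcs G) N"
      using target_side_closes[OF min s, of N] N by (auto simp: later_def st_cut_def)
    then have "M \<inter> cl (arcs G) N = M" by blast
    then have "N = M" using L N s by (auto simp: best_def st_cut_iff)
    with l show False by (simp add: later_def)
  qed
  then show "st_latest G s t M \<and> minimal_st_cut G s t M" using cut min by (auto simp: st_latest_def)
next
  assume L: "st_latest G s t M \<and> minimal_st_cut G s t M"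
  then have M: "M \<subseteq> arcs G" "s \<noteq> t" "out s \<subseteq> cl (arcs G) M"
    using s by (auto simp: st_latest_def st_cut_iff)
  have fM: "finite M" using M fin by (auto intro: finite_subset)
  have "N = M" if N: "N \<subseteq> arcs G" "out s \<subseteq> cl (arcs G) N" "card N \<le> card (M \<inter> cl (arcs G) N)" for N
  proof -
    let ?Z = "N \<union> (M - cl (arcs G) N)"
    note Z = exchange[OF fin M(1) N(1,3)]
    have ZM: "target_side G t ?Z \<subseteq> target_side G t M"
      by (rule target_side_mono) (use cl_least[OF Z(3)] in simp)
    have "st_cut G s t ?Z" using Z N s M by (auto simp: st_cut_iff)
    then have "target_side G t ?Z = target_side G t M"
      using L ZM Z(2) by (auto simp: st_latest_def later_def)
    \<comment> \<open>An arc of M outside \<open>?Z\<close> has its head outside the target side of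
      \<open>?Z\<close>, whereas every arc of the minimal cut M has its head in the target side of
      M. The two sides are equal.\<close>
    have MZ: "M \<subseteq> ?Z"
    proof
      fix e assume e: "e \<in> M"
      show "e \<in> ?Z"
      proof (rule ccontr)
        assume n: "e \<notin> ?Z"
        have c: "e \<in> cl (arcs G) ?Z" using Z(3) e by blast
        note sc = succs_closed[OF c n]
        have "head G e \<in> verts G" using e M wf by (auto simp: wf_digraph_def)
        then have "head G e \<notin> target_side G t ?Z" using sc by (auto simp: target_side_iff succs_def cl_def)
        then have h: "head G e \<notin> target_side G t M" using \<open>target_side G t ?Z = target_side G t M\<close> by simp
        have "bd (arcs G) (cl (arcs G) M) = M"
          using bd_minimal_st_cut L s by blast
        then have "e \<in> bd (arcs G) (cl (arcs G) M)" using e by simp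
        then have "head G e = t \<or> (\<exists>f\<in>out (head G e). opn (arcs G) M f)"
          by (auto simp: bd_def cl_def)
        then show False using h \<open>head G e \<in> verts G\<close> by (simp add: target_side_iff)
      qed
    qed
    have "finite ?Z" by (rule finite_subset[OF Z(1) fin])
    then have "M = ?Z" using card_seteq[OF _ MZ Z(2)] by simp
    then have "N \<subseteq> M" by (metis Un_upper1)
    moreover have "st_cut G s t N" using N M s by (auto simp: st_cut_iff)
    ultimately show ?thesis using L by (auto simp: minimal_st_cut_def)
  qed
  then show "s \<noteq> t \<and> best (arcs G) (out s) M" using M by (auto simp: best_def)
qed

end

section \<open>Reasoning about programs\<close>

definition bnd :: "nat \<Rightarrow> state \<Rightarrow> bool" where
  "bnd W \<sigma> \<longleftrightarrow> (\<forall>x i. \<sigma> x i < W)"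

text \<open>Weaker than \<open>fits\<close>: values that are read need no separate bound, since
  \<open>bnd\<close> bounds all of memory.\<close>

fun ok :: "nat \<Rightarrow> state \<Rightarrow> exp \<Rightarrow> bool" where
  "ok W \<sigma> (Const i) \<longleftrightarrow> i < W"
| "ok W \<sigma> (Read x e) \<longleftrightarrow> ok W \<sigma> e"
| "ok W \<sigma> (Plus e e') \<longleftrightarrow> ok W \<sigma> e \<and> ok W \<sigma> e' \<and> val \<sigma> e + val \<sigma> e' < W"
| "ok W \<sigma> (Minus e e') \<longleftrightarrow> ok W \<sigma> e \<and> ok W \<sigma> e'"
| "ok W \<sigma> (Times e e') \<longleftrightarrow> ok W \<sigma> e \<and> ok W \<sigma> e' \<and> val \<sigma> e * val \<sigma> e' < W"

lemma ok_fits: "bnd W \<sigma> \<Longrightarrow> ok W \<sigma> e \<Longrightarrow> fits W \<sigma> e \<and> val \<sigma> e < W"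
  by (induction e) (auto simp: bnd_def)

text \<open>Since \<open>bnd\<close> is built into \<open>wp\<close>, reading memory never gets stuck.\<close>

definition wp :: "nat \<Rightarrow> com \<Rightarrow> (nat \<Rightarrow> state \<Rightarrow> bool) \<Rightarrow> state \<Rightarrow> bool" where
  "wp W P Q \<sigma> \<longleftrightarrow> (bnd W \<sigma> \<longrightarrow> (\<exists>T \<sigma>'. run W P \<sigma> T \<sigma>' \<and> bnd W \<sigma>' \<and> Q T \<sigma>'))"

lemma wp_mono: "wp W P Q \<sigma> \<Longrightarrow> (\<And>T \<tau>. Q T \<tau> \<Longrightarrow> Q' T \<tau>) \<Longrightarrow> wp W P Q' \<sigma>"
  by (auto simp: wp_def)

lemma wp_Skip: "Q 1 \<sigma> \<Longrightarrow> wp W Skip Q \<sigma>"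
  unfolding wp_def by (blast intro: run.Skip)

lemma wp_Assign:
  assumes "ok W \<sigma> i" "ok W \<sigma> e"
    and "Q (1 + cost i + cost e) (\<sigma>(x := (\<sigma> x)(val \<sigma> i := val \<sigma> e)))"
  shows "wp W (Assign x i e) Q \<sigma>"
  unfolding wp_def
proof
  assume b: "bnd W \<sigma>"
  have "run W (Assign x i e) \<sigma> (1 + cost i + cost e) (\<sigma>(x := (\<sigma> x)(val \<sigma> i := val \<sigma> e)))"
    by (rule run.Assign) (use ok_fits[OF b] assms in auto)
  moreover have "bnd W (\<sigma>(x := (\<sigma> x)(val \<sigma> i := val \<sigma> e)))"
    using b ok_fits[OF b assms(2)] by (auto simp: bnd_def)
  ultimately show "\<exists>T \<sigma>'. run W (Assign x i e) \<sigma> T \<sigma>' \<and> bnd W \<sigma>' \<and> Q T \<sigma>'"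
    using assms by blast
qed

lemma wp_Seq: "wp W P (\<lambda>T \<tau>. wp W P' (\<lambda>T'. Q (T + T')) \<tau>) \<sigma> \<Longrightarrow> wp W (Seq P P') Q \<sigma>"
  unfolding wp_def by (blast intro: run.Seq)

lemma wp_SeqI:
  "wp W P Q' \<sigma> \<Longrightarrow> (\<And>T \<tau>. Q' T \<tau> \<Longrightarrow> wp W P' (\<lambda>T'. Q (T + T')) \<tau>) \<Longrightarrow> wp W (Seq P P') Q \<sigma>"
  by (rule wp_Seq) (rule wp_mono)

lemma wp_If:
  assumes "ok W \<sigma> e"
    and "val \<sigma> e \<noteq> 0 \<Longrightarrow> wp W P (\<lambda>T. Q (1 + cost e + T)) \<sigma>"
    and "val \<sigma> e = 0 \<Longrightarrow> wp W P' (\<lambda>T. Q (1 + cost e + T)) \<sigma>"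
  shows "wp W (If e P P') Q \<sigma>"
proof (cases "val \<sigma> e = 0")
  case True
  then show ?thesis
    using assms(1,3) ok_fits[of W \<sigma> e] unfolding wp_def by (blast intro: run.IfFalse)
next
  case False
  then show ?thesis
    using assms(1,2) ok_fits[of W \<sigma> e] unfolding wp_def by (blast intro: run.IfTrue)
qed

lemma wp_WhileFalse:
  assumes "ok W \<sigma> e" "val \<sigma> e = 0" "Q (1 + cost e) \<sigma>"
  shows "wp W (While e P) Q \<sigma>"
  using assms ok_fits[of W \<sigma> e] unfolding wp_def by (blast intro: run.WhileFalse)

lemma wp_WhileTrue:
  assumes "ok W \<sigma> e" "val \<sigma> e \<noteq> 0"
    and "wp W P (\<lambda>T \<tau>. wp W (While e P) (\<lambda>T'. Q (1 + cost e + T + T')) \<tau>) \<sigma>"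
  shows "wp W (While e P) Q \<sigma>"
  using assms ok_fits[of W \<sigma> e] unfolding wp_def by (blast intro: run.WhileTrue)

fun assigned :: "com \<Rightarrow> string set" where
  "assigned Skip = {}"
| "assigned (Assign x i e) = {x}"
| "assigned (Seq P P') = assigned P \<union> assigned P'"
| "assigned (If e P P') = assigned P \<union> assigned P'"
| "assigned (While e P) = assigned P"

lemma run_frame: "run W P \<sigma> T \<sigma>' \<Longrightarrow> x \<notin> assigned P \<Longrightarrow> \<sigma>' x = \<sigma> x"
  by (induction rule: run.induct) auto

text \<open>Lets a specification stay silent about arrays that the program text never
  assigns.\<close>

lemma wp_frame:
  assumes "wp W P Q \<sigma>" and "\<And>T \<tau>. Q T \<tau> \<Longrightarrow> (\<And>x. x \<notin> assigned P \<Longrightarrow> \<tau> x = \<sigma> x) \<Longrightarrow> Q' T \<tau>"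
  shows "wp W P Q' \<sigma>"
  using assms run_frame unfolding wp_def by metis

abbreviation V :: "string \<Rightarrow> exp" where "V x \<equiv> Read x (Const 0)"

abbreviation Set :: "string \<Rightarrow> exp \<Rightarrow> com" (infix \<open>::=\<close> 61) where
  "x ::= e \<equiv> Assign x (Const 0) e"

abbreviation seq :: "com \<Rightarrow> com \<Rightarrow> com" (infixr \<open>;;\<close> 60) where
  "P ;; P' \<equiv> Seq P P'"

definition For :: "string \<Rightarrow> exp \<Rightarrow> exp \<Rightarrow> com \<Rightarrow> com" where
  "For i lo hi P = i ::= lo ;; While (Minus hi (V i)) (P ;; i ::= Plus (V i) (Const 1))"

lemma assigned_For [simp]: "assigned (For i lo hi P) = insert i (assigned P)"
  by (auto simp: For_def)

text \<open>The upper bound is evaluated again in every test, so the invariant must preserve its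
  value. A round costs \<open>cost hi + 4\<close> for the test, the body, and 6 for the increment.
  The invariant speaks of states in which the counter is already set.\<close>

lemma wp_For:
  assumes W: "1 < W"
    and lo: "ok W \<sigma> lo" "val \<sigma> lo = l" and lh: "l \<le> h"
    and init: "I l (\<sigma>(i := (\<sigma> i)(0 := l)))"
    and hi: "\<And>j \<tau>. l \<le> j \<Longrightarrow> j \<le> h \<Longrightarrow> I j \<tau> \<Longrightarrow> \<tau> i 0 = j \<Longrightarrow> ok W \<tau> hi \<and> val \<tau> hi = h"
    and body: "\<And>j \<tau>. l \<le> j \<Longrightarrow> j < h \<Longrightarrow> I j \<tau> \<Longrightarrow> \<tau> i 0 = j \<Longrightarrow>
      wp W P (\<lambda>T \<tau>'. T \<le> B \<and> \<tau>' i 0 = j \<and> I (Suc j) (\<tau>'(i := (\<tau>' i)(0 := Suc j)))) \<tau>"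
    and fin: "\<And>T \<tau>. T \<le> cost lo + cost hi + 6 + (h - l) * (B + cost hi + 10) \<Longrightarrow> I h \<tau> \<Longrightarrow> \<tau> i 0 = h \<Longrightarrow>
      Q T \<tau>"
  shows "wp W (For i lo hi P) Q \<sigma>"
proof -
  let ?w = "While (Minus hi (V i)) (P ;; i ::= Plus (V i) (Const 1))"
  have loop: "wp W ?w (\<lambda>T \<tau>'. T \<le> cost hi + 4 + d * (B + cost hi + 10) \<and> I h \<tau>' \<and> \<tau>' i 0 = h) \<tau>"
    if "l \<le> j" "j + d = h" "I j \<tau>" "\<tau> i 0 = j" for d j \<tau>
    using that
  proof (induction d arbitrary: j \<tau>)
    case 0
    then show ?case
      by (intro wp_WhileFalse) (use hi[of j \<tau>] W in auto)
  next
    case (Suc d)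
    note h = hi[of j \<tau>]
    show ?case
      unfolding wp_def
    proof
      assume b: "bnd W \<tau>"
      have ok: "ok W \<tau> hi" "val \<tau> hi = h" using h Suc.prems by auto
      \<comment> \<open>No bound on h is assumed: it is the value of an expression over bounded
        memory, so the incremented counter, at most h, is a word.\<close>
      then have hW: "h < W" using ok_fits[OF b] by blast
      have "wp W ?w (\<lambda>T \<tau>'. T \<le> cost hi + 4 + Suc d * (B + cost hi + 10) \<and> I h \<tau>' \<and> \<tau>' i 0 = h) \<tau>"
      proof (rule wp_WhileTrue)
        show "ok W \<tau> (Minus hi (V i))" using ok W by simp
        show "val \<tau> (Minus hi (V i)) \<noteq> 0" using ok Suc.prems by simp
        show "wp W (P ;; i ::= Plus (V i) (Const 1)) (\<lambda>T \<tau>. wp W ?w (\<lambda>T' \<tau>'. 1 + cost (Minus hi (V i)) + T + T'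
            \<le> cost hi + 4 + Suc d * (B + cost hi + 10) \<and> I h \<tau>' \<and> \<tau>' i 0 = h) \<tau>) \<tau>"
          apply (rule wp_SeqI)
           apply (rule body[of j \<tau>])
              apply (use Suc.prems in simp_all)[4]
          apply (rule wp_Assign)
            apply (use W in simp)
           apply (use W Suc.prems hW in simp)
          apply (rule wp_mono)
           apply (rule Suc.IH[of "Suc j"])
              apply (use Suc.prems in \<open>simp_all add: fun_upd_def\<close>)
          done
      qed
      then show "\<exists>T \<sigma>'. run W ?w \<tau> T \<sigma>' \<and> bnd W \<sigma>' \<and>
          T \<le> cost hi + 4 + Suc d * (B + cost hi + 10) \<and> I h \<sigma>' \<and> \<sigma>' i 0 = h"
        using b unfolding wp_def by blast
    qed
  qed
  show ?thesis
    unfolding For_def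
    apply (rule wp_Seq)
    apply (rule wp_Assign)
      apply (use W in simp)
     apply (rule lo)
    apply (rule wp_mono)
     apply (rule loop[of l "h - l"])
        apply (use lo lh init fin in auto)
    done
qed

text \<open>The array \<open>mark\<close> is all zero between operations and is restored by
  unmarking the same cut with b = 0. This takes time in the size of the cut, where clearing the
  array would take time in m.\<close>

definition Mark :: "string \<Rightarrow> nat \<Rightarrow> com" where
  "Mark c b = For ''y'' (Read ''cut_begin'' (V c)) (Read ''cut_end'' (V c))
     (Assign ''mark'' (Read ''cut_arcs'' (V ''y'')) (Const b))"

lemma wp_Mark:
  assumes W: "1 < W" "b < W" and c: "c \<noteq> ''y''" "c \<noteq> ''mark''"
    and be: "\<sigma> ''cut_begin'' (\<sigma> c 0) \<le> \<sigma> ''cut_end'' (\<sigma> c 0)"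
  shows "wp W (Mark c b) (\<lambda>T \<tau>. T \<le> 20 * (\<sigma> ''cut_end'' (\<sigma> c 0) - \<sigma> ''cut_begin'' (\<sigma> c 0)) + 20 \<and>
    \<tau> = \<sigma>(''mark'' := (\<lambda>a. if a \<in> output_cut \<sigma> (\<sigma> c 0) then b else \<sigma> ''mark'' a),
          ''y'' := (\<sigma> ''y'')(0 := \<sigma> ''cut_end'' (\<sigma> c 0)))) \<sigma>"
  unfolding Mark_def output_cut_def
  apply (rule wp_For[where I = "\<lambda>j \<tau>. \<tau> = \<sigma>(''mark'' := (\<lambda>a. if a \<in> \<sigma> ''cut_arcs'' ` {\<sigma> ''cut_begin'' (\<sigma> c 0)..<j} then b else \<sigma> ''mark'' a),
          ''y'' := (\<sigma> ''y'')(0 := j))" and B = 5 and l = "\<sigma> ''cut_begin'' (\<sigma> c 0)" and h = "\<sigma> ''cut_end'' (\<sigma> c 0)"])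
  using assms apply (simp_all add: fun_upd_twist)
   apply (rule wp_Assign)
     apply (simp_all add: atLeastLessThanSuc fun_upd_twist)
    apply (auto simp: fun_eq_iff)
  done

section \<open>Operations on stored cuts\<close>

abbreviation CB :: "string \<Rightarrow> exp" where "CB c \<equiv> Read ''cut_begin'' (V c)"
abbreviation CE :: "string \<Rightarrow> exp" where "CE c \<equiv> Read ''cut_end'' (V c)"

text \<open>\<open>af\<close> is the first free cell of \<open>cut_arcs\<close>. Injectivity makes
  the length of the interval the size of the cut, so sizes are available in constant time.\<close>

definition wfcut :: "nat \<Rightarrow> state \<Rightarrow> nat \<Rightarrow> bool" where
  "wfcut m \<sigma> c \<longleftrightarrow> \<sigma> ''cut_begin'' c \<le> \<sigma> ''cut_end'' c \<and> \<sigma> ''cut_end'' c \<le> \<sigma> ''af'' 0 \<and>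
     inj_on (\<sigma> ''cut_arcs'') {\<sigma> ''cut_begin'' c..<\<sigma> ''cut_end'' c} \<and> output_cut \<sigma> c \<subseteq> {..<m}"

text \<open>\<open>cf\<close> is the first free index. The bound is k + 1 because the singleton of
  the current arc is stored even for k = 0.\<close>

definition pool :: "nat \<Rightarrow> nat \<Rightarrow> state \<Rightarrow> bool" where
  "pool m k \<sigma> \<longleftrightarrow> (\<forall>c < \<sigma> ''cf'' 0. wfcut m \<sigma> c \<and> card (output_cut \<sigma> c) \<le> Suc k)"

text \<open>Storage is append-only, so the families computed for other pairs of vertices
  persist.\<close>

definition ext :: "state \<Rightarrow> state \<Rightarrow> bool" where
  "ext \<sigma> \<tau> \<longleftrightarrow> \<sigma> ''af'' 0 \<le> \<tau> ''af'' 0 \<and> \<sigma> ''cf'' 0 \<le> \<tau> ''cf'' 0 \<and>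
     (\<forall>z < \<sigma> ''af'' 0. \<tau> ''cut_arcs'' z = \<sigma> ''cut_arcs'' z) \<and>
     (\<forall>c < \<sigma> ''cf'' 0. \<tau> ''cut_begin'' c = \<sigma> ''cut_begin'' c \<and> \<tau> ''cut_end'' c = \<sigma> ''cut_end'' c)"

lemma card_output_cut:
  "wfcut m \<sigma> c \<Longrightarrow> card (output_cut \<sigma> c) = \<sigma> ''cut_end'' c - \<sigma> ''cut_begin'' c"
  by (simp add: wfcut_def output_cut_def card_image)

lemma finite_output_cut [simp]: "finite (output_cut \<sigma> c)"
  by (simp add: output_cut_def)

lemma ext_refl: "ext \<sigma> \<sigma>"
  by (simp add: ext_def)

lemma ext_trans: "ext \<sigma> \<tau> \<Longrightarrow> ext \<tau> \<upsilon> \<Longrightarrow> ext \<sigma> \<upsilon>"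
  by (simp add: ext_def)

lemma ext_output_cut:
  assumes "ext \<sigma> \<tau>" "c < \<sigma> ''cf'' 0" "wfcut m \<sigma> c"
  shows "output_cut \<tau> c = output_cut \<sigma> c"
  using assms by (auto simp: ext_def wfcut_def output_cut_def image_iff)

lemma ext_wfcut:
  assumes "ext \<sigma> \<tau>" "c < \<sigma> ''cf'' 0" "wfcut m \<sigma> c"
  shows "wfcut m \<tau> c"
proof -
  have "inj_on (\<tau> ''cut_arcs'') {\<sigma> ''cut_begin'' c..<\<sigma> ''cut_end'' c} \<longleftrightarrow>
      inj_on (\<sigma> ''cut_arcs'') {\<sigma> ''cut_begin'' c..<\<sigma> ''cut_end'' c}"
    by (rule inj_on_cong) (use assms in \<open>auto simp: ext_def wfcut_def\<close>)
  then show ?thesis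
    using assms ext_output_cut[OF assms] by (auto simp: ext_def wfcut_def)
qed

lemma poolD: "pool m k \<sigma> \<Longrightarrow> c < \<sigma> ''cf'' 0 \<Longrightarrow> wfcut m \<sigma> c"
  by (simp add: pool_def)

lemma pool_card: "pool m k \<sigma> \<Longrightarrow> c < \<sigma> ''cf'' 0 \<Longrightarrow> card (output_cut \<sigma> c) \<le> Suc k"
  by (simp add: pool_def)

text \<open>N bounds attempts rather than successes: a union that is too large keeps no index, but
  the cells it was written to, at most 2 * k + 2, stay occupied.\<close>

definition adds :: "nat \<Rightarrow> nat \<Rightarrow> state \<Rightarrow> state \<Rightarrow> nat set set \<Rightarrow> nat \<Rightarrow> bool" where
  "adds m k \<sigma> \<tau> S N \<longleftrightarrow> ext \<sigma> \<tau> \<and> pool m k \<tau> \<and>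
     \<tau> ''cf'' 0 \<le> \<sigma> ''cf'' 0 + N \<and> \<tau> ''af'' 0 \<le> \<sigma> ''af'' 0 + N * (2 * k + 2) \<and>
     output_cut \<tau> ` {\<sigma> ''cf'' 0..<\<tau> ''cf'' 0} = S \<and>
     (\<forall>x\<in>{''n'', ''m'', ''k'', ''tail'', ''head'', ''pair_begin'', ''pair_end'', ''mark''}. \<tau> x = \<sigma> x)"

lemma adds_refl: "pool m k \<sigma> \<Longrightarrow> adds m k \<sigma> \<sigma> {} 0"
  by (simp add: adds_def ext_refl)

lemma adds_output_cut:
  "pool m k \<sigma> \<Longrightarrow> adds m k \<sigma> \<tau> S N \<Longrightarrow> c < \<sigma> ''cf'' 0 \<Longrightarrow> output_cut \<tau> c = output_cut \<sigma> c"
  using ext_output_cut[OF _ _ poolD] by (simp add: adds_def)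

lemma adds_trans:
  assumes "adds m k \<sigma> \<tau> S N" "adds m k \<tau> \<upsilon> S' N'"
  shows "adds m k \<sigma> \<upsilon> (S \<union> S') (N + N')"
proof -
  have e: "ext \<sigma> \<tau>" "ext \<tau> \<upsilon>" and p: "pool m k \<tau>" using assms by (auto simp: adds_def)
  have cf: "\<sigma> ''cf'' 0 \<le> \<tau> ''cf'' 0" "\<tau> ''cf'' 0 \<le> \<upsilon> ''cf'' 0" using e by (auto simp: ext_def)
  have "output_cut \<upsilon> ` {\<sigma> ''cf'' 0..<\<tau> ''cf'' 0} = output_cut \<tau> ` {\<sigma> ''cf'' 0..<\<tau> ''cf'' 0}"
    by (rule image_cong) (use ext_output_cut[OF e(2)] poolD[OF p] in auto)
  moreover have "{\<sigma> ''cf'' 0..<\<upsilon> ''cf'' 0} = {\<sigma> ''cf'' 0..<\<tau> ''cf'' 0} \<union> {\<tau> ''cf'' 0..<\<upsilon> ''cf'' 0}"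
    using cf by auto
  ultimately have "output_cut \<upsilon> ` {\<sigma> ''cf'' 0..<\<upsilon> ''cf'' 0} = S \<union> S'"
    using assms by (simp add: adds_def image_Un)
  then show ?thesis using assms ext_trans[OF e] by (simp add: adds_def add_mult_distrib)
qed

lemma adds_upd:
  assumes "x \<notin> {''n'', ''m'', ''k'', ''tail'', ''head'', ''pair_begin'', ''pair_end'', ''mark'',
    ''cf'', ''af'', ''cut_arcs'', ''cut_begin'', ''cut_end''}"
  shows "adds m k \<sigma> (\<tau>(x := v)) S N = adds m k \<sigma> \<tau> S N"
    and "adds m k (\<sigma>(x := v)) \<tau> S N = adds m k \<sigma> \<tau> S N"
    and "pool m k (\<sigma>(x := v)) = pool m k \<sigma>"
    and "output_cut (\<sigma>(x := v)) = output_cut \<sigma>"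
proof -
  have *: "(\<sigma>(x := v)) y = \<sigma> y" if "y \<in> {''n'', ''m'', ''k'', ''tail'', ''head'', ''pair_begin'', ''pair_end'', ''mark'',
    ''cf'', ''af'', ''cut_arcs'', ''cut_begin'', ''cut_end''}" for y \<sigma>
    using assms that by (metis fun_upd_other)
  show "adds m k \<sigma> (\<tau>(x := v)) S N = adds m k \<sigma> \<tau> S N"
    "adds m k (\<sigma>(x := v)) \<tau> S N = adds m k \<sigma> \<tau> S N"
    "pool m k (\<sigma>(x := v)) = pool m k \<sigma>"
    "output_cut (\<sigma>(x := v)) = output_cut \<sigma>"
    unfolding adds_def pool_def wfcut_def ext_def output_cut_def fun_eq_iff
    by (simp_all add: * del: fun_upd_apply)
qed

section \<open>Unions of two stored cuts\<close>

definition Copy_New :: "string \<Rightarrow> com" where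
  "Copy_New c = For ''x'' (CB c) (CE c)
     (If (Read ''mark'' (Read ''cut_arcs'' (V ''x''))) Skip
        (Assign ''cut_arcs'' (V ''af'') (Read ''cut_arcs'' (V ''x'')) ;;
         ''af'' ::= Plus (V ''af'') (Const 1)))"

lemma wp_Copy_New:
  assumes W: "1 < W" and c: "c \<notin> {''x'', ''af'', ''cut_arcs''}"
    and wf: "wfcut m \<sigma> (\<sigma> c 0)"
    and af: "\<sigma> ''af'' 0 + card (output_cut \<sigma> (\<sigma> c 0)) < W"
  shows "wp W (Copy_New c) (\<lambda>T \<tau>. T \<le> 40 * card (output_cut \<sigma> (\<sigma> c 0)) + 20 \<and>
    (\<exists>A f y. \<tau> = \<sigma>(''cut_arcs'' := A, ''af'' := (\<sigma> ''af'')(0 := f), ''x'' := (\<sigma> ''x'')(0 := y)) \<and>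
       \<sigma> ''af'' 0 \<le> f \<and> f \<le> \<sigma> ''af'' 0 + card (output_cut \<sigma> (\<sigma> c 0)) \<and>
       (\<forall>z < \<sigma> ''af'' 0. A z = \<sigma> ''cut_arcs'' z) \<and> inj_on A {\<sigma> ''af'' 0..<f} \<and>
       A ` {\<sigma> ''af'' 0..<f} = {a \<in> output_cut \<sigma> (\<sigma> c 0). \<sigma> ''mark'' a = 0})) \<sigma>"
proof -
  let ?b = "\<sigma> ''cut_begin'' (\<sigma> c 0)" and ?e = "\<sigma> ''cut_end'' (\<sigma> c 0)"
    and ?f = "\<sigma> ''af'' 0" and ?C = "\<sigma> ''cut_arcs''"
  note cd = card_output_cut[OF wf]
  have be: "?b \<le> ?e" "?e \<le> ?f" "inj_on ?C {?b..<?e}" using wf by (auto simp: wfcut_def)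
  define I where "I j \<tau> \<longleftrightarrow> (\<exists>A f. \<tau> = \<sigma>(''cut_arcs'' := A, ''af'' := (\<sigma> ''af'')(0 := f), ''x'' := (\<sigma> ''x'')(0 := j)) \<and>
       ?f \<le> f \<and> f \<le> ?f + (j - ?b) \<and> (\<forall>z < ?f. A z = ?C z) \<and> inj_on A {?f..<f} \<and>
       A ` {?f..<f} = {a \<in> ?C ` {?b..<j}. \<sigma> ''mark'' a = 0})" for j \<tau>
  show ?thesis
    unfolding Copy_New_def
  proof (rule wp_For[where I = I and B = 20, OF W])
    show "I ?b (\<sigma>(''x'' := (\<sigma> ''x'')(0 := ?b)))"
      unfolding I_def by (intro exI[of _ ?C] exI[of _ ?f]) simp
  next
    fix j \<tau> assume j: "?b \<le> j" "j < ?e" "I j \<tau>"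
    then obtain A f where t: "\<tau> = \<sigma>(''cut_arcs'' := A, ''af'' := (\<sigma> ''af'')(0 := f), ''x'' := (\<sigma> ''x'')(0 := j))"
      and f: "?f \<le> f" "f \<le> ?f + (j - ?b)" and A: "\<forall>z < ?f. A z = ?C z" "inj_on A {?f..<f}"
       "A ` {?f..<f} = {a \<in> ?C ` {?b..<j}. \<sigma> ''mark'' a = 0}"
      unfolding I_def by blast
    \<comment> \<open>The cut that is read lies below the old \<open>af\<close>, so appended arcs do
      not overwrite it.\<close>
    have Aj: "A j = ?C j" using A(1) j be by simp
    have fW: "Suc f < W" using f j af cd be W by simp
    have sj: "{?b..<Suc j} = insert j {?b..<j}" using j by auto
    show "wp W (If (Read ''mark'' (Read ''cut_arcs'' (V ''x''))) Skip
        (Assign ''cut_arcs'' (V ''af'') (Read ''cut_arcs'' (V ''x'')) ;;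
         ''af'' ::= Plus (V ''af'') (Const 1)))
      (\<lambda>T \<tau>'. T \<le> 20 \<and> \<tau>' ''x'' 0 = j \<and> I (Suc j) (\<tau>'(''x'' := (\<tau>' ''x'')(0 := Suc j)))) \<tau>"
    proof (rule wp_If)
      show "ok W \<tau> (Read ''mark'' (Read ''cut_arcs'' (V ''x'')))" using W by simp
    next
      assume "val \<tau> (Read ''mark'' (Read ''cut_arcs'' (V ''x''))) \<noteq> 0"
      then have "\<sigma> ''mark'' (?C j) \<noteq> 0" using t Aj by simp
      then have "I (Suc j) (\<tau>(''x'' := (\<tau> ''x'')(0 := Suc j)))"
        unfolding I_def t by (intro exI[of _ A] exI[of _ f]) (use f A j in \<open>auto simp: sj\<close>)
      then show "wp W Skip (\<lambda>T \<tau>'. 1 + cost (Read ''mark'' (Read ''cut_arcs'' (V ''x''))) + T \<le> 20 \<and> \<tau>' ''x'' 0 = j \<and>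
          I (Suc j) (\<tau>'(''x'' := (\<tau>' ''x'')(0 := Suc j)))) \<tau>"
        by (intro wp_Skip) (simp add: t)
    next
      assume "val \<tau> (Read ''mark'' (Read ''cut_arcs'' (V ''x''))) = 0"
      then have mk: "\<sigma> ''mark'' (?C j) = 0" using t Aj by simp
      let ?A = "A(f := ?C j)"
      have nj: "?C j \<notin> ?C ` {?b..<j}"
      proof
        assume "?C j \<in> ?C ` {?b..<j}"
        then obtain x where "x \<in> {?b..<j}" "?C j = ?C x" by blast
        then show False using inj_onD[OF be(3), of j x] j(1,2) by simp
      qed
      have im: "?A ` {?f..<f} = A ` {?f..<f}" by (rule image_cong) auto
      have inj: "inj_on ?A {?f..<f}" using A(2) by (auto simp: inj_on_def)
      have sf: "{?f..<Suc f} = insert f {?f..<f}" using f by auto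
      have "inj_on ?A {?f..<Suc f}"
        unfolding sf inj_on_insert using inj nj A(3) im by auto
      moreover have "?A ` {?f..<Suc f} = {a \<in> ?C ` {?b..<Suc j}. \<sigma> ''mark'' a = 0}"
        unfolding sf sj image_insert im using A(3) mk by auto
      ultimately have "I (Suc j) (\<sigma>(''cut_arcs'' := ?A, ''af'' := (\<sigma> ''af'')(0 := Suc f), ''x'' := (\<sigma> ''x'')(0 := Suc j)))"
        unfolding I_def by (intro exI[of _ ?A] exI[of _ "Suc f"]) (use f A(1) j in auto)
      then show "wp W (Assign ''cut_arcs'' (V ''af'') (Read ''cut_arcs'' (V ''x'')) ;;
          ''af'' ::= Plus (V ''af'') (Const 1)) (\<lambda>T \<tau>'. 1 + cost (Read ''mark'' (Read ''cut_arcs'' (V ''x''))) + T \<le> 20 \<and>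
          \<tau>' ''x'' 0 = j \<and> I (Suc j) (\<tau>'(''x'' := (\<tau>' ''x'')(0 := Suc j)))) \<tau>"
        by (intro wp_Seq wp_Assign) (use W fW in \<open>simp_all add: t Aj fun_upd_twist\<close>)
    qed
  next
    fix T \<tau> assume T: "T \<le> cost (CB c) + cost (CE c) + 6 + (?e - ?b) * (20 + cost (CE c) + 10)" and I: "I ?e \<tau>"
    from I obtain A f where "\<tau> = \<sigma>(''cut_arcs'' := A, ''af'' := (\<sigma> ''af'')(0 := f), ''x'' := (\<sigma> ''x'')(0 := ?e))"
      "?f \<le> f" "f \<le> ?f + (?e - ?b)" "\<forall>z < ?f. A z = ?C z" "inj_on A {?f..<f}"
       "A ` {?f..<f} = {a \<in> ?C ` {?b..<?e}. \<sigma> ''mark'' a = 0}"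
      unfolding I_def by blast
    moreover have "T \<le> 40 * (?e - ?b) + 20" using T by simp
    ultimately show "T \<le> 40 * card (output_cut \<sigma> (\<sigma> c 0)) + 20 \<and>
      (\<exists>A f y. \<tau> = \<sigma>(''cut_arcs'' := A, ''af'' := (\<sigma> ''af'')(0 := f), ''x'' := (\<sigma> ''x'')(0 := y)) \<and>
       ?f \<le> f \<and> f \<le> ?f + card (output_cut \<sigma> (\<sigma> c 0)) \<and>
       (\<forall>z < ?f. A z = ?C z) \<and> inj_on A {?f..<f} \<and>
       A ` {?f..<f} = {a \<in> output_cut \<sigma> (\<sigma> c 0). \<sigma> ''mark'' a = 0})"
      unfolding cd by (auto simp: output_cut_def)
  next
    fix j \<tau> assume "I j \<tau>"
    then obtain A f where t: "\<tau> = \<sigma>(''cut_arcs'' := A, ''af'' := (\<sigma> ''af'')(0 := f), ''x'' := (\<sigma> ''x'')(0 := j))"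
      unfolding I_def by blast
    show "ok W \<tau> (CE c) \<and> val \<tau> (CE c) = ?e" using W c by (simp add: t)
  qed (use W c be in auto)
qed

text \<open>The first \<open>Copy_New\<close> finds no marks and copies a whole cut; the second
  skips the arcs of the first. If the union has more than k arcs, \<open>cf\<close> is not advanced
  and the next attempt overwrites the entry.\<close>

definition Union :: com where
  "Union = Assign ''cut_begin'' (V ''cf'') (V ''af'') ;;
     Copy_New ''i'' ;; Mark ''i'' 1 ;; Copy_New ''j'' ;; Mark ''i'' 0 ;;
     Assign ''cut_end'' (V ''cf'') (V ''af'') ;;
     If (Minus (Plus (V ''k'') (Const 1)) (Minus (CE ''cf'') (CB ''cf'')))
        (''cf'' ::= Plus (V ''cf'') (Const 1)) Skip"

lemma assigned_Union:
  "assigned Union \<subseteq> {''cut_begin'', ''cut_end'', ''cut_arcs'', ''af'', ''cf'', ''mark'', ''x'', ''y''}"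
  by (auto simp: Union_def Copy_New_def Mark_def)

lemma wp_Union:
  assumes W: "1 < W" "Suc k < W" and pool: "pool m k \<sigma>" and k: "\<sigma> ''k'' 0 = k"
    and mark: "\<sigma> ''mark'' = (\<lambda>_. 0)"
    and ij: "\<sigma> ''i'' 0 < \<sigma> ''cf'' 0" "\<sigma> ''j'' 0 < \<sigma> ''cf'' 0"
    and af: "\<sigma> ''af'' 0 + (2 * k + 2) < W" and cf: "Suc (\<sigma> ''cf'' 0) < W"
  shows "wp W Union (\<lambda>T \<tau>. T \<le> 300 * (k + 2) \<and>
    adds m k \<sigma> \<tau> {M. M = output_cut \<sigma> (\<sigma> ''i'' 0) \<union> output_cut \<sigma> (\<sigma> ''j'' 0) \<and> card M \<le> k} 1) \<sigma>"
proof -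
  let ?i = "\<sigma> ''i'' 0" and ?j = "\<sigma> ''j'' 0" and ?cf = "\<sigma> ''cf'' 0" and ?af = "\<sigma> ''af'' 0"
  define Ci where "Ci = output_cut \<sigma> ?i"
  define Cj where "Cj = output_cut \<sigma> ?j"
  have wf: "wfcut m \<sigma> ?i" "wfcut m \<sigma> ?j" using poolD[OF pool] ij by auto
  have cd: "card Ci \<le> Suc k" "card Cj \<le> Suc k" using pool_card[OF pool] ij by (auto simp: Ci_def Cj_def)
  define \<sigma>1 where "\<sigma>1 = \<sigma>(''cut_begin'' := (\<sigma> ''cut_begin'')(?cf := ?af))"
  have oc1: "output_cut \<sigma>1 ?i = Ci" "output_cut \<sigma>1 ?j = Cj"
    using ij by (auto simp: \<sigma>1_def output_cut_def Ci_def Cj_def)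
  have wf1: "wfcut m \<sigma>1 ?i" "wfcut m \<sigma>1 ?j"
    using ij wf oc1 by (auto simp: \<sigma>1_def wfcut_def Ci_def Cj_def)
  show ?thesis
    unfolding Union_def
    apply (rule wp_Seq)
    apply (rule wp_Assign)
      apply (use W in simp_all)[2]
    apply (rule wp_SeqI)
     apply (rule wp_Copy_New[where m = m])
    subgoal using W by simp
    subgoal by simp
    subgoal using wf1 by (simp add: \<sigma>1_def)
    subgoal using oc1 af cd by (simp add: \<sigma>1_def)
    apply (elim exE conjE)
    subgoal premises prems' for T1 \<sigma>2 A1 f1 y1
    proof -
      have v1: "\<sigma>(''cut_begin'' := (\<sigma> ''cut_begin'')(val \<sigma> (V ''cf'') := val \<sigma> (V ''af''))) = \<sigma>1"
        by (simp add: \<sigma>1_def)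
      have i1: "\<sigma>1 ''i'' 0 = ?i" by (simp add: \<sigma>1_def)
      note prems = prems'[unfolded v1 i1 oc1]
      have s: "\<sigma>1 ''af'' 0 = ?af" "\<sigma>1 ''mark'' = (\<lambda>_. 0)" "\<sigma>1 ''i'' 0 = ?i" "\<sigma>1 ''j'' 0 = ?j"
         "\<sigma>1 ''cut_arcs'' = \<sigma> ''cut_arcs''"
        using mark by (simp_all add: \<sigma>1_def)
      have A1: "\<forall>z<?af. A1 z = \<sigma> ''cut_arcs'' z" "inj_on A1 {?af..<f1}" "A1 ` {?af..<f1} = Ci"
        "?af \<le> f1" "f1 \<le> ?af + card Ci" using prems s oc1 by simp_all
      have t: "\<sigma>2 = \<sigma>1(''cut_arcs'' := A1, ''af'' := (\<sigma>1 ''af'')(0 := f1), ''x'' := (\<sigma>1 ''x'')(0 := y1))"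
        by (fact prems)
      have e2: "output_cut \<sigma>2 ?i = Ci" "output_cut \<sigma>2 ?j = Cj" "wfcut m \<sigma>2 ?i" "wfcut m \<sigma>2 ?j"
      proof -
        have "output_cut \<sigma>2 c = output_cut \<sigma>1 c \<and> wfcut m \<sigma>2 c" if "wfcut m \<sigma>1 c" for c
        proof -
          have "\<sigma>1 ''cut_end'' c \<le> ?af" using that s by (simp add: wfcut_def)
          then have *: "\<And>z. z \<in> {\<sigma>1 ''cut_begin'' c..<\<sigma>1 ''cut_end'' c} \<Longrightarrow> A1 z = \<sigma>1 ''cut_arcs'' z"
            using A1(1) s by simp
          have "A1 ` {\<sigma>1 ''cut_begin'' c..<\<sigma>1 ''cut_end'' c} = \<sigma>1 ''cut_arcs'' ` {\<sigma>1 ''cut_begin'' c..<\<sigma>1 ''cut_end'' c}"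
            by (rule image_cong) (use * in auto)
          moreover have "inj_on A1 {\<sigma>1 ''cut_begin'' c..<\<sigma>1 ''cut_end'' c} \<longleftrightarrow> inj_on (\<sigma>1 ''cut_arcs'') {\<sigma>1 ''cut_begin'' c..<\<sigma>1 ''cut_end'' c}"
            by (rule inj_on_cong) (use * in auto)
          ultimately show ?thesis using that A1(4) s by (auto simp: t wfcut_def output_cut_def)
        qed
        then show "output_cut \<sigma>2 ?i = Ci" "output_cut \<sigma>2 ?j = Cj" "wfcut m \<sigma>2 ?i" "wfcut m \<sigma>2 ?j"
          using wf1 oc1 by auto
      qed
      have i2: "\<sigma>2 ''i'' 0 = ?i" "\<sigma>2 ''j'' 0 = ?j" "\<sigma>2 ''mark'' = (\<lambda>_. 0)" "\<sigma>2 ''af'' 0 = f1"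
        using s by (simp_all add: t)
      have len2: "\<sigma>2 ''cut_end'' ?i - \<sigma>2 ''cut_begin'' ?i = card Ci" "\<sigma>2 ''cut_begin'' ?i \<le> \<sigma>2 ''cut_end'' ?i"
        using card_output_cut[OF e2(3)] e2 by (simp_all add: wfcut_def)
      define \<sigma>3 where "\<sigma>3 = \<sigma>2(''mark'' := (\<lambda>a. if a \<in> Ci then 1 else 0),
          ''y'' := (\<sigma>2 ''y'')(0 := \<sigma>2 ''cut_end'' ?i))"
      have e3: "output_cut \<sigma>3 ?i = Ci" "output_cut \<sigma>3 ?j = Cj" "wfcut m \<sigma>3 ?i" "wfcut m \<sigma>3 ?j"
        "\<sigma>3 ''i'' 0 = ?i" "\<sigma>3 ''j'' 0 = ?j" "\<sigma>3 ''af'' 0 = f1" "\<sigma>3 ''mark'' = (\<lambda>a. if a \<in> Ci then 1 else 0)"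
        "\<sigma>3 ''cut_arcs'' = A1"
        using e2 i2 by (simp_all add: \<sigma>3_def wfcut_def output_cut_def t)
      show ?thesis
        apply (rule wp_SeqI)
         apply (rule wp_Mark)
        using W apply (simp_all add: i2 len2 e2)[5]
        apply (erule conjE)
        subgoal premises p3' for T3 \<tau>3
        proof -
          have p3: "T3 \<le> 20 * card Ci + 20" "\<tau>3 = \<sigma>3"
            using p3' by (simp_all add: i2 e2 len2 \<sigma>3_def cong: if_cong)
          show ?thesis
            unfolding p3(2)
          apply (rule wp_SeqI)
           apply (rule wp_Copy_New[where m = m])
          subgoal using W by simp
          subgoal by simp
          subgoal using e3 by simp
          subgoal using e3 af cd A1 by simp
          apply (simp only: e3)
          apply (elim exE conjE)
          subgoal premises p4 for T4 \<sigma>4 A2 f2 y2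
          proof -
            have A2: "\<forall>z<f1. A2 z = A1 z" "inj_on A2 {f1..<f2}" "A2 ` {f1..<f2} = Cj - Ci" "f1 \<le> f2" "f2 \<le> f1 + card Cj"
              using p4 by auto
            have t4: "\<sigma>4 = \<sigma>3(''cut_arcs'' := A2, ''af'' := (\<sigma>3 ''af'')(0 := f2), ''x'' := (\<sigma>3 ''x'')(0 := y2))"
              by (fact p4)
            \<comment> \<open>The second copy starts at f1 and leaves the block of the first
              intact.\<close>
            have AA: "A2 ` {?af..<f1} = Ci" "inj_on A2 {?af..<f1}"
            proof -
              have "A2 ` {?af..<f1} = A1 ` {?af..<f1}" by (rule image_cong) (use A2 in auto)
              then show "A2 ` {?af..<f1} = Ci" using A1 by simp
              have "inj_on A2 {?af..<f1} \<longleftrightarrow> inj_on A1 {?af..<f1}" by (rule inj_on_cong) (use A2 in auto)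
              then show "inj_on A2 {?af..<f1}" using A1 by simp
            qed
            have iv: "{?af..<f2} = {?af..<f1} \<union> {f1..<f2}" using A1 A2 by auto
            have F: "A2 ` {?af..<f2} = Ci \<union> Cj" "inj_on A2 {?af..<f2}"
              unfolding iv image_Un inj_on_Un AA A2 using AA A2 by auto
            have A2z: "\<forall>z<?af. A2 z = \<sigma> ''cut_arcs'' z" using A1 A2 by simp
            have oc4: "output_cut \<sigma>4 ?i = Ci"
            proof -
              have "\<sigma>3 ''cut_end'' ?i \<le> ?af" "\<sigma>3 ''cut_end'' ?i = \<sigma>1 ''cut_end'' ?i" using wf1 s by (simp_all add: \<sigma>3_def t wfcut_def)
              then have "A2 ` {\<sigma>3 ''cut_begin'' ?i..<\<sigma>3 ''cut_end'' ?i} = A1 ` {\<sigma>3 ''cut_begin'' ?i..<\<sigma>3 ''cut_end'' ?i}"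
                by (intro image_cong) (use A1 A2 in auto)
              then show ?thesis using e3 by (simp add: output_cut_def t4)
            qed
            have i4: "\<sigma>4 ''i'' 0 = ?i" "\<sigma>4 ''cut_end'' ?i - \<sigma>4 ''cut_begin'' ?i = card Ci"
               "\<sigma>4 ''cut_begin'' ?i \<le> \<sigma>4 ''cut_end'' ?i"
              using e3 len2 by (simp_all add: t4 \<sigma>3_def)
            define \<sigma>5 where "\<sigma>5 = \<sigma>4(''mark'' := (\<lambda>_. 0), ''y'' := (\<sigma>4 ''y'')(0 := \<sigma>4 ''cut_end'' ?i))"
            have m5: "(\<lambda>a. if a \<in> Ci then 0 else \<sigma>4 ''mark'' a) = (\<lambda>_. 0)"
              using e3 by (auto simp: t4)
            have s5: "\<sigma>5 ''cf'' = \<sigma> ''cf''" "\<sigma>5 ''af'' 0 = f2" "\<sigma>5 ''k'' = \<sigma> ''k''"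
               "\<sigma>5 ''cut_begin'' = (\<sigma> ''cut_begin'')(?cf := ?af)" "\<sigma>5 ''cut_end'' = \<sigma> ''cut_end''"
               "\<sigma>5 ''cut_arcs'' = A2" "\<sigma>5 ''mark'' = (\<lambda>_. 0)"
               "\<And>x. x \<in> {''n'', ''m'', ''k'', ''tail'', ''head'', ''pair_begin'', ''pair_end''} \<Longrightarrow> \<sigma>5 x = \<sigma> x"
              by (auto simp: \<sigma>5_def t4 \<sigma>3_def t \<sigma>1_def)
            define \<tau> where "\<tau> = \<sigma>5(''cut_end'' := (\<sigma> ''cut_end'')(?cf := f2))"
            have ext: "ext \<sigma> \<tau>" using s5 A2z A1 A2 by (simp add: ext_def \<tau>_def)
            have mk: "\<forall>x\<in>{''n'', ''m'', ''k'', ''tail'', ''head'', ''pair_begin'', ''pair_end'', ''mark''}. \<tau> x = \<sigma> x"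
              using s5 mark by (auto simp: \<tau>_def)
            have fle: "f2 \<le> ?af + (2 * k + 2)" using A1 A2 cd by simp
            have occf: "output_cut \<tau> ?cf = Ci \<union> Cj" using s5 F by (simp add: output_cut_def \<tau>_def)
            have wfcf: "wfcut m \<tau> ?cf" using s5 F wf A1 A2 occf
              by (auto simp: wfcut_def \<tau>_def Ci_def Cj_def)
            have lcf: "card (Ci \<union> Cj) = f2 - ?af" using card_output_cut[OF wfcf] occf s5 by (simp add: \<tau>_def)
            have pt: "wfcut m \<tau> c \<and> card (output_cut \<tau> c) \<le> Suc k" if "c < ?cf" for c
              using ext_wfcut[OF ext that] ext_output_cut[OF ext that] poolD[OF pool that] pool_card[OF pool that]
              by simp
            \<comment> \<open>A union that is too large: \<open>cf\<close> stays, so no cut is added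
              although \<open>af\<close> has moved.\<close>
            have res1: "adds m k \<sigma> \<tau> {M. M = Ci \<union> Cj \<and> card M \<le> k} 1" if "\<not> card (Ci \<union> Cj) \<le> k"
            proof -
              have "\<tau> ''cf'' 0 = ?cf" "\<tau> ''af'' 0 = f2" using s5 by (simp_all add: \<tau>_def)
              then show ?thesis using that ext mk fle pt by (auto simp: adds_def pool_def)
            qed
            have res2: "adds m k \<sigma> (\<tau>(''cf'' := (\<tau> ''cf'')(0 := Suc ?cf))) {M. M = Ci \<union> Cj \<and> card M \<le> k} 1"
              (is "adds m k \<sigma> ?\<tau> _ _") if "card (Ci \<union> Cj) \<le> k"
            proof -
              have eq: "output_cut ?\<tau> = output_cut \<tau>" "wfcut m ?\<tau> = wfcut m \<tau>"
                by (auto simp: output_cut_def wfcut_def fun_eq_iff)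
              have c1: "?\<tau> ''cf'' 0 = Suc ?cf" "?\<tau> ''af'' 0 = f2" using s5 by (simp_all add: \<tau>_def)
              have "ext \<sigma> ?\<tau>" using ext by (simp add: ext_def)
              moreover have "pool m k ?\<tau>"
                unfolding pool_def c1 eq less_Suc_eq using pt wfcf occf that by auto
              moreover have "output_cut ?\<tau> ` {?cf..<Suc ?cf} = {M. M = Ci \<union> Cj \<and> card M \<le> k}"
                using occf that by (auto simp: eq)
              moreover have "?\<tau> ''af'' 0 \<le> ?af + 1 * (2 * k + 2)" using fle c1 by simp
              moreover have "\<forall>x\<in>{''n'', ''m'', ''k'', ''tail'', ''head'', ''pair_begin'', ''pair_end'', ''mark''}. ?\<tau> x = \<sigma> x"
                using mk by simp
              ultimately show ?thesis unfolding adds_def c1 by simp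
            qed
            show ?thesis
              apply (rule wp_SeqI)
               apply (rule wp_Mark)
              using W apply (simp_all add: i4 oc4)[5]
              apply (erule conjE)
              subgoal premises p5' for T5 \<tau>5
              proof -
                have p5: "T5 \<le> 20 * card Ci + 20" "\<tau>5 = \<sigma>5"
                  using p5' by (simp_all add: i4 oc4 \<sigma>5_def m5)
                show ?thesis
                  unfolding p5(2)
                apply (rule wp_Seq)
                apply (rule wp_Assign)
                  apply (use W in simp_all)[2]
                apply (rule wp_If)
                subgoal using W k by (simp add: s5)
                 apply (rule wp_Assign)
                subgoal using W by simp
                subgoal using W cf by (simp add: s5)
                subgoal using res2 lcf k p5 p4 p3 prems cd 
                  by (simp add: s5 \<tau>_def Ci_def Cj_def)
                apply (rule wp_Skip)
                subgoal using res1 lcf k p5 p4 p3 prems cd 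
                  by (simp add: s5 \<tau>_def Ci_def Cj_def)
                done
              qed
              done
          qed
          done
        qed
        done
    qed
    done
qed

text \<open>Another level of loop nesting with at most R rounds costs another power of R, while the
  constants merely add up.\<close>

lemma loop_time:
  fixes x R b c d a :: nat
  assumes "x \<le> R" "b \<le> c * R ^ i" "1 \<le> R"
  shows "a + x * (b + d) \<le> (a + c + d) * R ^ Suc i"
proof -
  have p: "1 \<le> R ^ i" "1 \<le> R ^ Suc i" using assms(3) by (auto intro: one_le_power)
  have "x * (b + d) \<le> R * (c * R ^ i + d * R ^ i)"
    by (rule mult_le_mono[OF assms(1) add_le_mono[OF assms(2)]]) (use p(1) in simp)
  also have "\<dots> = (c + d) * R ^ Suc i" by (simp add: algebra_simps)
  finally have "a + x * (b + d) \<le> a * R ^ Suc i + (c + d) * R ^ Suc i"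
    by (rule add_le_mono[rotated]) (use p(2) in simp)
  then show ?thesis by (simp add: algebra_simps)
qed

section \<open>All pairwise unions of two families\<close>

abbreviation PB :: "string \<Rightarrow> exp" where "PB p \<equiv> Read ''pair_begin'' (V p)"
abbreviation PE :: "string \<Rightarrow> exp" where "PE p \<equiv> Read ''pair_end'' (V p)"

definition joins :: "nat \<Rightarrow> nat set \<Rightarrow> nat set set \<Rightarrow> nat set set" where
  "joins k P S = {M. \<exists>Q\<in>S. M = P \<union> Q \<and> card M \<le> k}"

definition Join :: com where
  "Join = For ''j'' (PB ''q'') (PE ''q'') Union"

text \<open>\<open>p\<close> and \<open>q\<close> are the pairs formed by the target with the tail
  and the head of the current arc. The singleton of this arc lies outside the interval of
  \<open>q\<close> and is joined separately.\<close>

definition Build :: com where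
  "Build = For ''i'' (PB ''p'') (PE ''p'') (Join ;; ''j'' ::= V ''sing'' ;; Union)"

abbreviation "U_vars \<equiv> {''cut_begin'', ''cut_end'', ''cut_arcs'', ''af'', ''cf'', ''mark'', ''x'', ''y''}"

lemma wp_Join:
  assumes W: "1 < W" "Suc k < W" and pool: "pool m k \<sigma>" and k: "\<sigma> ''k'' 0 = k"
    and mark: "\<sigma> ''mark'' = (\<lambda>_. 0)" and i: "\<sigma> ''i'' 0 < \<sigma> ''cf'' 0"
    and q: "\<sigma> ''pair_begin'' (\<sigma> ''q'' 0) = b" "\<sigma> ''pair_end'' (\<sigma> ''q'' 0) = e" "b \<le> e" "e \<le> \<sigma> ''cf'' 0"
    and af: "\<sigma> ''af'' 0 + (e - b) * (2 * k + 2) < W" and cf: "\<sigma> ''cf'' 0 + (e - b) < W"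
    and R: "k + 2 \<le> R" "e - b \<le> R"
  shows "wp W Join (\<lambda>T \<tau>. T \<le> 400 * R ^ 2 \<and>
    adds m k \<sigma> \<tau> (joins k (output_cut \<sigma> (\<sigma> ''i'' 0)) (output_cut \<sigma> ` {b..<e})) (e - b) \<and>
    (\<forall>x. x \<notin> insert ''j'' U_vars \<longrightarrow> \<tau> x = \<sigma> x)) \<sigma>"
proof -
  define I where "I j \<tau> \<longleftrightarrow>
    adds m k \<sigma> \<tau> (joins k (output_cut \<sigma> (\<sigma> ''i'' 0)) (output_cut \<sigma> ` {b..<j})) (j - b) \<and>
    (\<forall>x. x \<notin> insert ''j'' U_vars \<longrightarrow> \<tau> x = \<sigma> x)" for j \<tau>
  show ?thesis
    unfolding Join_def
  proof (rule wp_For[where I = I and B = "300 * (k + 2)" and l = b and h = e, OF W(1)])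
    show "I b (\<sigma>(''j'' := (\<sigma> ''j'')(0 := b)))"
      using adds_refl[OF pool] by (simp add: I_def adds_upd joins_def)
  next
    fix j \<tau> assume I: "I j \<tau>"
    have "\<tau> ''q'' = \<sigma> ''q''" "\<tau> ''pair_end'' = \<sigma> ''pair_end''" using I by (auto simp: I_def)
    then show "ok W \<tau> (PE ''q'') \<and> val \<tau> (PE ''q'') = e" using W q by simp
  next
    fix j \<tau> assume j: "b \<le> j" "j < e" and I: "I j \<tau>" and tj: "\<tau> ''j'' 0 = j"
    let ?S = "joins k (output_cut \<sigma> (\<sigma> ''i'' 0)) (output_cut \<sigma> ` {b..<j})"
    have ad: "adds m k \<sigma> \<tau> ?S (j - b)"
      and fr: "\<And>x. x \<notin> insert ''j'' U_vars \<Longrightarrow> \<tau> x = \<sigma> x" using I by (auto simp: I_def)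
    have ti: "\<tau> ''i'' 0 = \<sigma> ''i'' 0" using fr by simp
    have c: "\<sigma> ''cf'' 0 \<le> \<tau> ''cf'' 0" "\<tau> ''cf'' 0 \<le> \<sigma> ''cf'' 0 + (j - b)"
       "\<tau> ''af'' 0 \<le> \<sigma> ''af'' 0 + (j - b) * (2 * k + 2)" "pool m k \<tau>" "\<tau> ''mark'' = (\<lambda>_. 0)" "\<tau> ''k'' 0 = k"
      using ad mark k by (auto simp: adds_def ext_def)
    have "(j - b) * (2 * k + 2) + (2 * k + 2) = (Suc (j - b)) * (2 * k + 2)" by simp
    also have "\<dots> \<le> (e - b) * (2 * k + 2)" by (rule mult_le_mono1) (use j in simp)
    finally have afj: "\<tau> ''af'' 0 + (2 * k + 2) < W" using c af by linarith
    have oc: "output_cut \<tau> (\<sigma> ''i'' 0) = output_cut \<sigma> (\<sigma> ''i'' 0)" "output_cut \<tau> j = output_cut \<sigma> j"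
      using adds_output_cut[OF pool ad] i j q by auto
    have S: "?S \<union> {M. M = output_cut \<sigma> (\<sigma> ''i'' 0) \<union> output_cut \<sigma> j \<and> card M \<le> k}
       = joins k (output_cut \<sigma> (\<sigma> ''i'' 0)) (output_cut \<sigma> ` {b..<Suc j})"
      using j by (auto simp: joins_def less_Suc_eq)
    have U: "wp W Union (\<lambda>T \<tau>'. T \<le> 300 * (k + 2) \<and> adds m k \<tau> \<tau>'
         {M. M = output_cut \<sigma> (\<sigma> ''i'' 0) \<union> output_cut \<sigma> j \<and> card M \<le> k} 1) \<tau>"
    proof -
      have h: "\<sigma> ''i'' 0 < \<tau> ''cf'' 0" "j < \<tau> ''cf'' 0" "Suc (\<tau> ''cf'' 0) < W"
        using c(1,2) i j q(4) cf by linarith+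
      show ?thesis by (rule wp_Union[OF W c(4,6,5), unfolded ti tj oc, OF h(1,2) afj h(3)])
    qed
    show "wp W Union (\<lambda>T \<tau>'. T \<le> 300 * (k + 2) \<and> \<tau>' ''j'' 0 = j \<and> I (Suc j) (\<tau>'(''j'' := (\<tau>' ''j'')(0 := Suc j)))) \<tau>"
    proof (rule wp_frame[OF U], elim conjE, intro conjI)
      fix T \<tau>' assume T: "T \<le> 300 * (k + 2)" and ad': "adds m k \<tau> \<tau>'
         {M. M = output_cut \<sigma> (\<sigma> ''i'' 0) \<union> output_cut \<sigma> j \<and> card M \<le> k} 1"
        and fr': "\<And>x. x \<notin> assigned Union \<Longrightarrow> \<tau>' x = \<tau> x"
      show "T \<le> 300 * (k + 2)" by (fact T)
      have fr2: "\<tau>' x = \<tau> x" if "x \<notin> U_vars" for x by (rule fr'[OF contra_subsetD[OF assigned_Union that]])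
      show "\<tau>' ''j'' 0 = j" using fr2[of "''j''"] tj by simp
      have "adds m k \<sigma> \<tau>' (joins k (output_cut \<sigma> (\<sigma> ''i'' 0)) (output_cut \<sigma> ` {b..<Suc j})) (Suc j - b)"
        using adds_trans[OF ad ad'] j unfolding S by (simp add: Suc_diff_le)
      then show "I (Suc j) (\<tau>'(''j'' := (\<tau>' ''j'')(0 := Suc j)))"
        unfolding I_def using fr fr2 by (simp add: adds_upd)
    qed
  next
    fix T \<tau> assume T: "T \<le> cost (PB ''q'') + cost (PE ''q'') + 6 + (e - b) * (300 * (k + 2) + cost (PE ''q'') + 10)"
      and I: "I e \<tau>"
    have "12 + (e - b) * (300 * (k + 2) + 13) \<le> (12 + 300 + 13) * R ^ Suc 1"
      by (rule loop_time) (use R in auto)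
    then have "T \<le> 400 * R ^ 2" using T by (simp add: numeral_2_eq_2)
    then show "T \<le> 400 * R ^ 2 \<and>
      adds m k \<sigma> \<tau> (joins k (output_cut \<sigma> (\<sigma> ''i'' 0)) (output_cut \<sigma> ` {b..<e})) (e - b) \<and>
      (\<forall>x. x \<notin> insert ''j'' U_vars \<longrightarrow> \<tau> x = \<sigma> x)" using I by (simp add: I_def)
  qed (use W q in auto)
qed

lemma wp_Build:
  assumes W: "1 < W" "Suc k < W" and pool: "pool m k \<sigma>" and k: "\<sigma> ''k'' 0 = k"
    and mark: "\<sigma> ''mark'' = (\<lambda>_. 0)" and sing: "\<sigma> ''sing'' 0 < \<sigma> ''cf'' 0"
    and p: "\<sigma> ''pair_begin'' (\<sigma> ''p'' 0) = b" "\<sigma> ''pair_end'' (\<sigma> ''p'' 0) = e" "b \<le> e" "e \<le> \<sigma> ''cf'' 0"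
    and q: "\<sigma> ''pair_begin'' (\<sigma> ''q'' 0) = b'" "\<sigma> ''pair_end'' (\<sigma> ''q'' 0) = e'" "b' \<le> e'" "e' \<le> \<sigma> ''cf'' 0"
    and af: "\<sigma> ''af'' 0 + (e - b) * Suc (e' - b') * (2 * k + 2) < W"
    and cf: "\<sigma> ''cf'' 0 + (e - b) * Suc (e' - b') < W"
    and R: "k + 2 \<le> R" "e - b \<le> R" "e' - b' \<le> R"
  defines "\<F> \<equiv> \<lambda>j. \<Union>P\<in>output_cut \<sigma> ` {b..<j}. joins k P (insert (output_cut \<sigma> (\<sigma> ''sing'' 0)) (output_cut \<sigma> ` {b'..<e'}))"
  shows "wp W Build (\<lambda>T \<tau>. T \<le> 1000 * R ^ 3 \<and> adds m k \<sigma> \<tau> (\<F> e) ((e - b) * Suc (e' - b')) \<and>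
    (\<forall>x. x \<notin> insert ''i'' (insert ''j'' U_vars) \<longrightarrow> \<tau> x = \<sigma> x)) \<sigma>"
proof -
  let ?N = "Suc (e' - b')"
  define I where "I j \<tau> \<longleftrightarrow> adds m k \<sigma> \<tau> (\<F> j) ((j - b) * ?N) \<and>
    (\<forall>x. x \<notin> insert ''i'' (insert ''j'' U_vars) \<longrightarrow> \<tau> x = \<sigma> x)" for j \<tau>
  show ?thesis
    unfolding Build_def
  proof (rule wp_For[where I = I and B = "710 * R ^ 2" and l = b and h = e, OF W(1)])
    show "I b (\<sigma>(''i'' := (\<sigma> ''i'')(0 := b)))"
      using adds_refl[OF pool] by (simp add: I_def adds_upd \<F>_def)
  next
    fix j \<tau> assume I: "I j \<tau>"
    have "\<tau> ''p'' = \<sigma> ''p''" "\<tau> ''pair_end'' = \<sigma> ''pair_end''" using I by (auto simp: I_def)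
    then show "ok W \<tau> (PE ''p'') \<and> val \<tau> (PE ''p'') = e" using W p by simp
  next
    fix j \<tau> assume j: "b \<le> j" "j < e" and I: "I j \<tau>" and tj: "\<tau> ''i'' 0 = j"
    have ad: "adds m k \<sigma> \<tau> (\<F> j) ((j - b) * ?N)"
      and fr: "\<And>x. x \<notin> insert ''i'' (insert ''j'' U_vars) \<Longrightarrow> \<tau> x = \<sigma> x" using I by (auto simp: I_def)
    have c: "\<sigma> ''cf'' 0 \<le> \<tau> ''cf'' 0" "\<tau> ''cf'' 0 \<le> \<sigma> ''cf'' 0 + (j - b) * ?N"
       "\<tau> ''af'' 0 \<le> \<sigma> ''af'' 0 + (j - b) * ?N * (2 * k + 2)" "pool m k \<tau>" "\<tau> ''mark'' = (\<lambda>_. 0)" "\<tau> ''k'' 0 = k"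
      using ad mark k by (auto simp: adds_def ext_def)
    have q': "\<tau> ''pair_begin'' (\<tau> ''q'' 0) = b'" "\<tau> ''pair_end'' (\<tau> ''q'' 0) = e'" "\<tau> ''sing'' 0 = \<sigma> ''sing'' 0"
      using q fr by simp_all
    \<comment> \<open>Earlier rows used at most \<open>(j - b) * ?N\<close> attempts, so row j still
      has room for its \<open>?N\<close>.\<close>
    have N1: "(j - b) * ?N + ?N \<le> (e - b) * ?N"
    proof -
      have "Suc (j - b) \<le> e - b" using j by simp
      from mult_le_mono1[OF this, of ?N] show ?thesis by (simp only: mult_Suc add.commute)
    qed
    have N2: "(j - b) * ?N * (2 * k + 2) + ?N * (2 * k + 2) \<le> (e - b) * ?N * (2 * k + 2)"
      using mult_le_mono1[OF N1, of "2 * k + 2"] by (simp add: add_mult_distrib)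
    have N3: "(e' - b') * (2 * k + 2) + (2 * k + 2) = ?N * (2 * k + 2)" by simp
    have bnds: "\<tau> ''af'' 0 + ((e' - b') * (2 * k + 2) + (2 * k + 2)) < W" "\<tau> ''cf'' 0 + (e' - b') + 1 < W"
      unfolding N3 using c N1 N2 af cf by linarith+
    have oc: "output_cut \<tau> c = output_cut \<sigma> c" if "c < \<sigma> ''cf'' 0" for c
      using adds_output_cut[OF pool ad] that by auto
    have ocq: "output_cut \<tau> ` {b'..<e'} = output_cut \<sigma> ` {b'..<e'}"
      by (rule image_cong) (use oc q in auto)
    have J: "wp W Join (\<lambda>T \<tau>'. T \<le> 400 * R ^ 2 \<and>
      adds m k \<tau> \<tau>' (joins k (output_cut \<sigma> j) (output_cut \<sigma> ` {b'..<e'})) (e' - b') \<and>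
      (\<forall>x. x \<notin> insert ''j'' U_vars \<longrightarrow> \<tau>' x = \<tau> x)) \<tau>"
    proof -
      have h: "j < \<tau> ''cf'' 0" "e' \<le> \<tau> ''cf'' 0" "\<tau> ''cf'' 0 + (e' - b') < W"
        "\<tau> ''af'' 0 + (e' - b') * (2 * k + 2) < W"
        using c(1,2) j p(4) q(4) bnds by linarith+
      have oj: "output_cut \<tau> j = output_cut \<sigma> j" using oc j p(4) by simp
      show ?thesis
        by (rule wp_Join[OF W c(4,6,5), unfolded tj ocq oj, OF h(1) q'(1,2) q(3) h(2,4,3) R(1,3), unfolded ocq])
    qed
    show "wp W (Join ;; ''j'' ::= V ''sing'' ;; Union)
       (\<lambda>T \<tau>'. T \<le> 710 * R ^ 2 \<and> \<tau>' ''i'' 0 = j \<and> I (Suc j) (\<tau>'(''i'' := (\<tau>' ''i'')(0 := Suc j)))) \<tau>"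
      apply (rule wp_SeqI[OF J])
      apply (elim conjE)
      apply (rule wp_Seq)
      apply (rule wp_Assign)
        apply (use W in simp_all)[2]
      subgoal premises P for T1 \<tau>1
      proof -
        let ?t = "\<tau>1(''j'' := (\<tau>1 ''j'')(0 := \<sigma> ''sing'' 0))"
        have fr1: "\<tau>1 x = \<tau> x" if "x \<notin> insert ''j'' U_vars" for x using P(3)[rule_format, OF that] .
        have s1: "\<tau>1 ''sing'' 0 = \<sigma> ''sing'' 0" using fr1[of "''sing''"] q' by simp
        have i1: "?t ''i'' 0 = j" "?t ''j'' 0 = \<sigma> ''sing'' 0" using fr1[of "''i''"] tj by simp_all
        have ad1: "adds m k \<tau> ?t (joins k (output_cut \<sigma> j) (output_cut \<sigma> ` {b'..<e'})) (e' - b')"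
          using P by (simp add: adds_upd)
        have ad2: "adds m k \<sigma> ?t (\<F> j \<union> joins k (output_cut \<sigma> j) (output_cut \<sigma> ` {b'..<e'})) ((j - b) * ?N + (e' - b'))"
          using adds_trans[OF ad ad1] .
        have oc1: "output_cut ?t c = output_cut \<sigma> c" if "c < \<sigma> ''cf'' 0" for c
          using adds_output_cut[OF pool ad2 that] .
        have jc: "j < \<sigma> ''cf'' 0" using j p by simp
        have c1: "\<tau> ''cf'' 0 \<le> ?t ''cf'' 0" "?t ''cf'' 0 \<le> \<tau> ''cf'' 0 + (e' - b')"
           "?t ''af'' 0 \<le> \<tau> ''af'' 0 + (e' - b') * (2 * k + 2)" "pool m k ?t" "?t ''mark'' = (\<lambda>_. 0)" "?t ''k'' 0 = k"
          using ad1 c by (auto simp: adds_def ext_def)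
        have U: "wp W Union (\<lambda>T \<tau>'. T \<le> 300 * (k + 2) \<and> adds m k ?t \<tau>'
            {M. M = output_cut \<sigma> j \<union> output_cut \<sigma> (\<sigma> ''sing'' 0) \<and> card M \<le> k} 1) ?t"
        proof -
          have h: "j < ?t ''cf'' 0" "\<sigma> ''sing'' 0 < ?t ''cf'' 0" using c1(1,2) c(1,2) jc sing by linarith+
          have h2: "?t ''af'' 0 + (2 * k + 2) < W" "Suc (?t ''cf'' 0) < W" using c1(1-3) bnds by linarith+
          show ?thesis
            by (rule wp_Union[OF W c1(4,6,5), unfolded i1 oc1[OF jc] oc1[OF sing], OF h h2])
        qed
        have S: "\<F> j \<union> joins k (output_cut \<sigma> j) (output_cut \<sigma> ` {b'..<e'}) \<union>
           {M. M = output_cut \<sigma> j \<union> output_cut \<sigma> (\<sigma> ''sing'' 0) \<and> card M \<le> k} = \<F> (Suc j)"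
          using j by (auto simp: \<F>_def joins_def less_Suc_eq atLeastLessThanSuc)
        have "300 * (k + 2) \<le> 300 * R ^ 2" using R by (intro mult_le_mono2) (simp add: power2_eq_square le_trans[OF _ le_square])
        moreover have "1 \<le> R ^ 2" using R by simp
        ultimately have t: "T1 + (1 + cost (Const 0) + cost (V ''sing'') + T) \<le> 710 * R ^ 2" if "T \<le> 300 * (k + 2)" for T
          using P(1) that by simp
        show ?thesis
        proof (simp only: val.simps s1, rule wp_frame[OF U], elim conjE, intro conjI)
          fix T \<tau>' assume T: "T \<le> 300 * (k + 2)" and ad': "adds m k ?t \<tau>'
             {M. M = output_cut \<sigma> j \<union> output_cut \<sigma> (\<sigma> ''sing'' 0) \<and> card M \<le> k} 1"
            and fr': "\<And>x. x \<notin> assigned Union \<Longrightarrow> \<tau>' x = ?t x"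
          show "T1 + (1 + cost (Const 0) + cost (V ''sing'') + T) \<le> 710 * R\<^sup>2" by (rule t[OF T])
          have fr2: "\<tau>' x = ?t x" if "x \<notin> U_vars" for x by (rule fr'[OF contra_subsetD[OF assigned_Union that]])
          show "\<tau>' ''i'' 0 = j" using fr2[of "''i''"] i1 by simp
          have N: "(j - b) * ?N + (e' - b') + 1 = (Suc j - b) * ?N" using j by (simp add: Suc_diff_le)
          have "adds m k \<sigma> \<tau>' (\<F> (Suc j)) ((Suc j - b) * ?N)"
            using adds_trans[OF ad2 ad'] unfolding S N .
          then show "I (Suc j) (\<tau>'(''i'' := (\<tau>' ''i'')(0 := Suc j)))"
            unfolding I_def using fr fr1 fr2 by (simp add: adds_upd)
        qed
      qed
      done
  next
    fix T \<tau> assume T: "T \<le> cost (PB ''p'') + cost (PE ''p'') + 6 + (e - b) * (710 * R ^ 2 + cost (PE ''p'') + 10)"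
      and I: "I e \<tau>"
    have "12 + (e - b) * (710 * R ^ 2 + 13) \<le> (12 + 710 + 13) * R ^ Suc 2"
      by (rule loop_time) (use R in auto)
    moreover have "T \<le> 12 + (e - b) * (710 * R ^ 2 + 13)" using T by (simp add: add.commute)
    ultimately have "T \<le> (12 + 710 + 13) * R ^ Suc 2" by (rule order_trans[rotated])
    also have "\<dots> \<le> 1000 * R ^ 3" by (simp add: eval_nat_numeral)
    finally have "T \<le> 1000 * R ^ 3" .
    then show "T \<le> 1000 * R ^ 3 \<and> adds m k \<sigma> \<tau> (\<F> e) ((e - b) * Suc (e' - b')) \<and>
      (\<forall>x. x \<notin> insert ''i'' (insert ''j'' U_vars) \<longrightarrow> \<tau> x = \<sigma> x)" using I by (simp add: I_def)
  qed (use W p in auto)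
qed

section \<open>Removing dominated candidates\<close>

definition frame :: "string set \<Rightarrow> state \<Rightarrow> state \<Rightarrow> bool" where
  "frame S \<sigma> \<tau> \<longleftrightarrow> (\<forall>x. x \<notin> S \<longrightarrow> \<tau> x = \<sigma> x)"

lemma frameD: "frame S \<sigma> \<tau> \<Longrightarrow> x \<notin> S \<Longrightarrow> \<tau> x = \<sigma> x"
  by (simp add: frame_def)

lemma frame_refl: "frame S \<sigma> \<sigma>"
  by (simp add: frame_def)

lemma frame_trans: "frame S \<sigma> \<tau> \<Longrightarrow> frame S \<tau> \<upsilon> \<Longrightarrow> frame S \<sigma> \<upsilon>"
  by (simp add: frame_def)

lemma frame_mono: "frame S \<sigma> \<tau> \<Longrightarrow> S \<subseteq> S' \<Longrightarrow> frame S' \<sigma> \<tau>"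
  by (auto simp: frame_def)

lemma frame_upd: "x \<in> S \<Longrightarrow> frame S \<sigma> (\<tau>(x := v)) = frame S \<sigma> \<tau>"
  by (auto simp: frame_def)

lemma frame_output_cut:
  "frame S \<sigma> \<tau> \<Longrightarrow> ''cut_arcs'' \<notin> S \<Longrightarrow> ''cut_begin'' \<notin> S \<Longrightarrow> ''cut_end'' \<notin> S \<Longrightarrow>
    output_cut \<tau> = output_cut \<sigma>"
  by (simp add: fun_eq_iff output_cut_def frameD[of S \<sigma> \<tau>])

text \<open>Boolean operations as arithmetic on 0 and 1: the product in \<open>ok\<close> is a
  conjunction over the arcs of cut \<open>l\<close>, and the last assignment is the disjunction of
  \<open>fd\<close> and \<open>ok\<close>.\<close>

definition Covered :: com where
  "Covered = ''ok'' ::= Const 1 ;;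
     For ''y'' (CB ''l'') (CE ''l'')
       (''ok'' ::= Times (V ''ok'') (Read ''mark'' (Read ''cut_arcs'' (V ''y'')))) ;;
     ''fd'' ::= Minus (Const 1) (Times (Minus (Const 1) (V ''fd'')) (Minus (Const 1) (V ''ok'')))"

lemma wp_Covered:
  assumes W: "1 < W" and mark: "\<sigma> ''mark'' = (\<lambda>a. if a \<in> D then 1 else 0)"
    and be: "\<sigma> ''cut_begin'' (\<sigma> ''l'' 0) \<le> \<sigma> ''cut_end'' (\<sigma> ''l'' 0)"
    and len: "\<sigma> ''cut_end'' (\<sigma> ''l'' 0) - \<sigma> ''cut_begin'' (\<sigma> ''l'' 0) \<le> R" "1 \<le> R"
    and fd: "\<sigma> ''fd'' 0 = (if P then 1 else 0)"
  shows "wp W Covered (\<lambda>T \<tau>. T \<le> 60 * R \<and> frame {''ok'', ''y'', ''fd''} \<sigma> \<tau> \<and>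
     \<tau> ''fd'' 0 = (if P \<or> output_cut \<sigma> (\<sigma> ''l'' 0) \<subseteq> D then 1 else 0)) \<sigma>"
proof -
  let ?b = "\<sigma> ''cut_begin'' (\<sigma> ''l'' 0)" and ?e = "\<sigma> ''cut_end'' (\<sigma> ''l'' 0)"
  let ?F = "{''ok'', ''y'', ''fd''}"
  define I where "I j \<tau> \<longleftrightarrow> frame ?F \<sigma> \<tau> \<and> \<tau> ''fd'' = \<sigma> ''fd'' \<and>
     \<tau> ''ok'' 0 = (if \<sigma> ''cut_arcs'' ` {?b..<j} \<subseteq> D then 1 else 0)" for j \<tau>
  let ?\<sigma> = "\<sigma>(''ok'' := (\<sigma> ''ok'')(0 := 1))"
  have L: "wp W (For ''y'' (CB ''l'') (CE ''l'')
       (''ok'' ::= Times (V ''ok'') (Read ''mark'' (Read ''cut_arcs'' (V ''y'')))))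
     (\<lambda>T \<tau>. T \<le> 40 * R \<and> I ?e \<tau>) ?\<sigma>"
  proof (rule wp_For[where I = I and B = 10 and l = ?b and h = ?e, OF W])
    show "I ?b (?\<sigma>(''y'' := (?\<sigma> ''y'')(0 := ?b)))" by (simp add: I_def frame_upd frame_refl)
  next
    fix j \<tau> assume "I j \<tau>"
    then have f: "frame ?F \<sigma> \<tau>" by (simp add: I_def)
    show "ok W \<tau> (CE ''l'') \<and> val \<tau> (CE ''l'') = ?e" using W frameD[OF f] by simp
  next
    fix j \<tau> assume j: "?b \<le> j" "j < ?e" and I: "I j \<tau>" "\<tau> ''y'' 0 = j"
    have f: "frame ?F \<sigma> \<tau>" using I by (simp add: I_def)
    have v: "\<tau> ''mark'' (\<tau> ''cut_arcs'' j) = (if \<sigma> ''cut_arcs'' j \<in> D then 1 else 0)"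
      using frameD[OF f] mark by simp
    have s: "{?b..<Suc j} = insert j {?b..<j}" using j by auto
    show "wp W (''ok'' ::= Times (V ''ok'') (Read ''mark'' (Read ''cut_arcs'' (V ''y''))))
      (\<lambda>T \<tau>'. T \<le> 10 \<and> \<tau>' ''y'' 0 = j \<and> I (Suc j) (\<tau>'(''y'' := (\<tau>' ''y'')(0 := Suc j)))) \<tau>"
      apply (rule wp_Assign)
      subgoal using W by simp
      subgoal using W I v by (simp add: I_def)
      subgoal using I v by (simp add: I_def frame_upd s)
      done
  next
    fix T \<tau> assume T: "T \<le> cost (CB ''l'') + cost (CE ''l'') + 6 + (?e - ?b) * (10 + cost (CE ''l'') + 10)"
      and I: "I ?e \<tau>"
    have "12 + (?e - ?b) * (10 * R ^ 0 + 13) \<le> (12 + 10 + 13) * R ^ Suc 0"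
      by (rule loop_time) (use len in auto)
    then show "T \<le> 40 * R \<and> I ?e \<tau>" using T I len by simp
  qed (use W be in auto)
  show ?thesis
    unfolding Covered_def
    apply (rule wp_Seq)
    apply (rule wp_Assign)
      apply (use W in simp_all)[2]
    apply (rule wp_SeqI)
     apply (use L in simp)
    apply (erule conjE)
    apply (rule wp_Assign)
    subgoal using W by simp
    subgoal for T \<tau> using W fd by (simp add: I_def)
    subgoal for T \<tau> using fd len by (simp add: I_def frame_upd output_cut_def)
    done
qed

text \<open>The set whose size is compared in \<open>filter_latest\<close>, with the known cuts read from the arrays.\<close>

definition good :: "nat \<Rightarrow> state \<Rightarrow> nat set \<Rightarrow> nat set \<Rightarrow> nat set" where
  "good n \<sigma> C D = {b \<in> C. b \<in> D \<or> (\<exists>c \<in> {\<sigma> ''pair_begin'' (\<sigma> ''head'' b * n + \<sigma> ''t'' 0)..<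
     \<sigma> ''pair_end'' (\<sigma> ''head'' b * n + \<sigma> ''t'' 0)}. output_cut \<sigma> c \<subseteq> D)}"

text \<open>The marks are those of N, and the arc at \<open>x\<close> belongs to M.
  \<open>gd\<close> counts the arcs of M known to be cut off by N, \<open>inn\<close> those common
  to both, which later decides whether M \<subseteq> N.\<close>

definition Test_Arc :: com where
  "Test_Arc =
     ''inn'' ::= Plus (V ''inn'') (Read ''mark'' (Read ''cut_arcs'' (V ''x''))) ;;
     ''fd'' ::= Read ''mark'' (Read ''cut_arcs'' (V ''x'')) ;;
     ''q'' ::= Plus (Times (Read ''head'' (Read ''cut_arcs'' (V ''x''))) (V ''n'')) (V ''t'') ;;
     For ''l'' (PB ''q'') (PE ''q'') Covered ;;
     ''gd'' ::= Plus (V ''gd'') (V ''fd'')"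

definition Test :: com where
  "Test = ''inn'' ::= Const 0 ;; ''gd'' ::= Const 0 ;; For ''x'' (CB ''i'') (CE ''i'') Test_Arc"

text \<open>Standing assumptions of an update for the target in \<open>t\<close>: pair indices are
  words by \<open>n * n \<le> W\<close>, and R bounds the lengths of families and, through
  \<open>k + 2 \<le> R\<close>, the sizes of cuts.\<close>

definition env :: "nat \<Rightarrow> nat \<Rightarrow> nat \<Rightarrow> nat \<Rightarrow> nat \<Rightarrow> state \<Rightarrow> bool" where
  "env W n m k R \<sigma> \<longleftrightarrow> 1 < W \<and> n * n \<le> W \<and> k + 2 < W \<and> k + 2 \<le> R \<and> \<sigma> ''n'' 0 = n \<and> \<sigma> ''k'' 0 = k \<and>
     pool m k \<sigma> \<and> (\<forall>a<m. \<sigma> ''head'' a < n) \<and> \<sigma> ''t'' 0 < n \<and>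
     (\<forall>p<n * n. \<sigma> ''pair_begin'' p \<le> \<sigma> ''pair_end'' p \<and> \<sigma> ''pair_end'' p \<le> \<sigma> ''cf'' 0 \<and>
        \<sigma> ''pair_end'' p - \<sigma> ''pair_begin'' p \<le> R)"

lemma pair_index:
  fixes n s t :: nat assumes "s < n" "t < n" shows "s * n + t < n * n"
proof -
  have "s * n + t < s * n + n" using assms by simp
  also have "\<dots> = Suc s * n" by simp
  also have "\<dots> \<le> n * n" using assms by (intro mult_le_mono1) simp
  finally show ?thesis .
qed

abbreviation "Arc_vars \<equiv> {''inn'', ''fd'', ''q'', ''l'', ''ok'', ''y'', ''gd''}"

lemma wp_Test_Arc:
  assumes env: "env W n m k R \<sigma>" and mark: "\<sigma> ''mark'' = (\<lambda>a. if a \<in> D then 1 else 0)"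
    and b: "\<sigma> ''cut_arcs'' (\<sigma> ''x'' 0) = b" "b < m"
    and in_gd: "Suc (\<sigma> ''inn'' 0) < W" "Suc (\<sigma> ''gd'' 0) < W"
  shows "wp W Test_Arc (\<lambda>T \<tau>. T \<le> 200 * R ^ 2 \<and> frame Arc_vars \<sigma> \<tau> \<and>
     \<tau> ''inn'' 0 = \<sigma> ''inn'' 0 + card ({b} \<inter> D) \<and> \<tau> ''gd'' 0 = \<sigma> ''gd'' 0 + card (good n \<sigma> {b} D)) \<sigma>"
proof -
  let ?p = "\<sigma> ''head'' b * n + \<sigma> ''t'' 0"
  define l where "l = \<sigma> ''pair_begin'' ?p"
  define h where "h = \<sigma> ''pair_end'' ?p"
  have W: "1 < W" "1 \<le> R" using env by (auto simp: env_def)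
  have hb: "\<sigma> ''head'' b < n" "\<sigma> ''t'' 0 < n" using env b by (auto simp: env_def)
  have p: "?p < n * n" by (rule pair_index[OF hb])
  have pW: "?p < W" "\<sigma> ''head'' b * n < W" and n: "\<sigma> ''n'' 0 = n" using p env by (auto simp: env_def)
  have lh: "l \<le> h" "h \<le> \<sigma> ''cf'' 0" "h - l \<le> R" using p env by (auto simp: env_def l_def h_def)
  have pool: "pool m k \<sigma>" and kR: "Suc k \<le> R" using env by (auto simp: env_def)
  let ?F = Arc_vars
  define Cov where "Cov j \<longleftrightarrow> b \<in> D \<or> (\<exists>c \<in> {l..<j}. output_cut \<sigma> c \<subseteq> D)" for j
  define \<sigma>1 where "\<sigma>1 = \<sigma>(''inn'' := (\<sigma> ''inn'')(0 := \<sigma> ''inn'' 0 + (if b \<in> D then 1 else 0)),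
    ''fd'' := (\<sigma> ''fd'')(0 := if b \<in> D then 1 else 0), ''q'' := (\<sigma> ''q'')(0 := ?p))"
  define I where "I j \<tau> \<longleftrightarrow> frame ?F \<sigma> \<tau> \<and> \<tau> ''inn'' = \<sigma>1 ''inn'' \<and> \<tau> ''gd'' = \<sigma> ''gd'' \<and> \<tau> ''q'' = \<sigma>1 ''q'' \<and>
     \<tau> ''fd'' 0 = (if Cov j then 1 else 0)" for j \<tau>
  have L: "wp W (For ''l'' (PB ''q'') (PE ''q'') Covered)
     (\<lambda>T \<tau>. T \<le> 100 * R ^ 2 \<and> I h \<tau>) \<sigma>1"
  proof (rule wp_For[where I = I and B = "60 * R" and l = l and h = h, OF W(1)])
    show "I l (\<sigma>1(''l'' := (\<sigma>1 ''l'')(0 := l)))" by (simp add: I_def frame_upd frame_refl \<sigma>1_def Cov_def)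
  next
    fix j \<tau> assume I: "I j \<tau>"
    then have f: "frame ?F \<sigma> \<tau>" by (simp add: I_def)
    have "\<tau> ''pair_end'' = \<sigma> ''pair_end''" by (rule frameD[OF f]) simp
    then show "ok W \<tau> (PE ''q'') \<and> val \<tau> (PE ''q'') = h" using W I by (simp add: I_def \<sigma>1_def h_def)
  next
    fix j \<tau> assume j: "l \<le> j" "j < h" and I: "I j \<tau>" "\<tau> ''l'' 0 = j"
    have f: "frame ?F \<sigma> \<tau>" using I by (simp add: I_def)
    have oc: "output_cut \<tau> = output_cut \<sigma>" by (rule frame_output_cut[OF f]) auto
    have fe: "\<tau> ''cut_begin'' = \<sigma> ''cut_begin''" "\<tau> ''cut_end'' = \<sigma> ''cut_end''" "\<tau> ''mark'' = \<sigma> ''mark''"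
      by (rule frameD[OF f]; simp)+
    have wf: "wfcut m \<sigma> j" "card (output_cut \<sigma> j) \<le> Suc k"
      using poolD[OF pool] pool_card[OF pool] j lh by auto
    have len: "\<tau> ''cut_begin'' (\<tau> ''l'' 0) \<le> \<tau> ''cut_end'' (\<tau> ''l'' 0)"
      "\<tau> ''cut_end'' (\<tau> ''l'' 0) - \<tau> ''cut_begin'' (\<tau> ''l'' 0) \<le> R"
      using wf card_output_cut[OF wf(1)] kR unfolding fe I by (auto simp: wfcut_def)
    have fd: "\<tau> ''fd'' 0 = (if Cov j then 1 else 0)" using I by (simp add: I_def)
    have cv: "Cov j \<or> output_cut \<sigma> j \<subseteq> D \<longleftrightarrow> Cov (Suc j)" using j by (auto simp: Cov_def less_Suc_eq)
    show "wp W Covered (\<lambda>T \<tau>'. T \<le> 60 * R \<and> \<tau>' ''l'' 0 = j \<and> I (Suc j) (\<tau>'(''l'' := (\<tau>' ''l'')(0 := Suc j)))) \<tau>"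
    proof (rule wp_mono[OF wp_Covered[OF W(1) _ len W(2) fd, unfolded fe oc, OF mark]], elim conjE, intro conjI)
      fix T \<tau>' assume T: "T \<le> 60 * R" and f': "frame {''ok'', ''y'', ''fd''} \<tau> \<tau>'"
        and fd': "\<tau>' ''fd'' 0 = (if Cov j \<or> output_cut \<sigma> (\<tau> ''l'' 0) \<subseteq> D then 1 else 0)"
      show "T \<le> 60 * R" by fact
      show "\<tau>' ''l'' 0 = j" using frameD[OF f', of "''l''"] I by simp
      have "frame ?F \<sigma> \<tau>'" by (rule frame_trans[OF f frame_mono[OF f']]) auto
      then show "I (Suc j) (\<tau>'(''l'' := (\<tau>' ''l'')(0 := Suc j)))"
        using fd' I frameD[OF f'] by (simp add: I_def frame_upd cv)
    qed
  next
    fix T \<tau> assume T: "T \<le> cost (PB ''q'') + cost (PE ''q'') + 6 + (h - l) * (60 * R + cost (PE ''q'') + 10)"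
      and I: "I h \<tau>"
    have "12 + (h - l) * (60 * R ^ 1 + 13) \<le> (12 + 60 + 13) * R ^ Suc 1"
      by (rule loop_time) (use lh W in auto)
    moreover have "T \<le> 12 + (h - l) * (60 * R ^ 1 + 13)" using T by (simp add: add.commute)
    ultimately have "T \<le> (12 + 60 + 13) * R ^ Suc 1" by (rule order_trans[rotated])
    also have "\<dots> \<le> 100 * R ^ 2" by (simp add: eval_nat_numeral)
    finally show "T \<le> 100 * R ^ 2 \<and> I h \<tau>" using I by blast
  qed (use W lh in \<open>auto simp: \<sigma>1_def l_def\<close>)
  have cg: "card (good n \<sigma> {b} D) = (if Cov h then 1 else 0)"
  proof -
    have "good n \<sigma> {b} D = (if Cov h then {b} else {})" by (auto simp: good_def Cov_def l_def h_def)
    then show ?thesis by simp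
  qed
  have ci: "card ({b} \<inter> D) = (if b \<in> D then 1 else 0)" by simp
  have R2: "1 \<le> R ^ 2" using W by simp
  show ?thesis
    unfolding Test_Arc_def
    apply (rule wp_Seq)
    apply (rule wp_Assign)
    subgoal using W by simp
    subgoal using W in_gd b mark by simp
    apply (rule wp_Seq)
    apply (rule wp_Assign)
      apply (use W in simp_all)[2]
    apply (rule wp_Seq)
    apply (rule wp_Assign)
    subgoal using W by simp
    subgoal using W b n pW by simp
    apply (rule wp_SeqI[where Q' = "\<lambda>T \<tau>. T \<le> 100 * R ^ 2 \<and> I h \<tau>"])
    subgoal using L b mark n by (simp add: \<sigma>1_def fun_upd_twist)
    apply (erule conjE)
    apply (rule wp_Assign)
    subgoal using W by simp
    subgoal using W in_gd by (simp add: I_def)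
    subgoal using R2 unfolding ci cg by (auto simp: I_def frame_upd \<sigma>1_def)
    done
qed

abbreviation "Test_vars \<equiv> {''inn'', ''fd'', ''q'', ''l'', ''ok'', ''y'', ''gd'', ''x''}"

lemma good_subset: "good n \<sigma> C D \<subseteq> C"
  by (auto simp: good_def)

lemma wp_Test:
  assumes env: "env W n m k R \<sigma>" and mark: "\<sigma> ''mark'' = (\<lambda>a. if a \<in> D then 1 else 0)"
    and i: "\<sigma> ''i'' 0 < \<sigma> ''cf'' 0"
  shows "wp W Test (\<lambda>T \<tau>. T \<le> 300 * R ^ 3 \<and> frame Test_vars \<sigma> \<tau> \<and>
     \<tau> ''inn'' 0 = card (output_cut \<sigma> (\<sigma> ''i'' 0) \<inter> D) \<and>
     \<tau> ''gd'' 0 = card (good n \<sigma> (output_cut \<sigma> (\<sigma> ''i'' 0)) D)) \<sigma>"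
proof -
  let ?b = "\<sigma> ''cut_begin'' (\<sigma> ''i'' 0)" and ?e = "\<sigma> ''cut_end'' (\<sigma> ''i'' 0)"
  have W: "1 < W" "1 \<le> R" "k + 2 < W" using env by (auto simp: env_def)
  have pool: "pool m k \<sigma>" and kR: "Suc k \<le> R" using env by (auto simp: env_def)
  have wf: "wfcut m \<sigma> (\<sigma> ''i'' 0)" "card (output_cut \<sigma> (\<sigma> ''i'' 0)) \<le> Suc k"
    using poolD[OF pool] pool_card[OF pool] i by auto
  have be: "?b \<le> ?e" "?e - ?b \<le> Suc k" using wf card_output_cut[OF wf(1)] by (auto simp: wfcut_def)
  define C where "C j = \<sigma> ''cut_arcs'' ` {?b..<j}" for j
  have C: "card (C j) \<le> j - ?b" for j using card_image_le[of "{?b..<j}"] by (simp add: C_def)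
  have finC: "finite (C j)" for j by (simp add: C_def)
  let ?\<sigma> = "\<sigma>(''inn'' := (\<sigma> ''inn'')(0 := 0), ''gd'' := (\<sigma> ''gd'')(0 := 0))"
  define I where "I j \<tau> \<longleftrightarrow> frame Test_vars \<sigma> \<tau> \<and> \<tau> ''inn'' 0 = card (C j \<inter> D) \<and> \<tau> ''gd'' 0 = card (good n \<sigma> (C j) D)" for j \<tau>
  have L: "wp W (For ''x'' (CB ''i'') (CE ''i'') Test_Arc)
     (\<lambda>T \<tau>. T \<le> 250 * R ^ 3 \<and> I ?e \<tau>) ?\<sigma>"
  proof (rule wp_For[where I = I and B = "200 * R ^ 2" and l = ?b and h = ?e, OF W(1)])
    show "I ?b (?\<sigma>(''x'' := (?\<sigma> ''x'')(0 := ?b)))" by (simp add: I_def frame_upd frame_refl C_def good_def)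
  next
    fix j \<tau> assume I: "I j \<tau>"
    then have f: "frame Test_vars \<sigma> \<tau>" by (simp add: I_def)
    have fe: "\<tau> ''i'' = \<sigma> ''i''" "\<tau> ''cut_end'' = \<sigma> ''cut_end''" by (rule frameD[OF f]; simp)+
    show "ok W \<tau> (CE ''i'') \<and> val \<tau> (CE ''i'') = ?e" using W fe by simp
  next
    fix j \<tau> assume j: "?b \<le> j" "j < ?e" and I: "I j \<tau>" "\<tau> ''x'' 0 = j"
    let ?a = "\<sigma> ''cut_arcs'' j"
    have f: "frame Test_vars \<sigma> \<tau>" using I by (simp add: I_def)
    have oc: "output_cut \<tau> = output_cut \<sigma>" by (rule frame_output_cut[OF f]) auto
    have fe: "\<tau> ''cut_begin'' = \<sigma> ''cut_begin''" "\<tau> ''cut_end'' = \<sigma> ''cut_end''" "\<tau> ''mark'' = \<sigma> ''mark''"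
      "\<tau> ''n'' = \<sigma> ''n''" "\<tau> ''k'' = \<sigma> ''k''" "\<tau> ''head'' = \<sigma> ''head''" "\<tau> ''t'' = \<sigma> ''t''" "\<tau> ''af'' = \<sigma> ''af''"
      "\<tau> ''pair_begin'' = \<sigma> ''pair_begin''" "\<tau> ''pair_end'' = \<sigma> ''pair_end''" "\<tau> ''cf'' = \<sigma> ''cf''"
      "\<tau> ''cut_arcs'' = \<sigma> ''cut_arcs''"
      by (rule frameD[OF f]; simp)+
    have env': "env W n m k R \<tau>" using env unfolding env_def pool_def wfcut_def oc fe .
    have gd: "good n \<tau> = good n \<sigma>" unfolding good_def fe oc fun_eq_iff by simp
    have ja: "\<tau> ''cut_arcs'' (\<tau> ''x'' 0) = ?a" using fe I by simp
    have "?a \<in> output_cut \<sigma> (\<sigma> ''i'' 0)" using j by (auto simp: output_cut_def)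
    then have am: "?a < m" using wf(1) by (auto simp: wfcut_def)
    have Cs: "C (Suc j) = insert ?a (C j)" using j by (auto simp: C_def less_Suc_eq)
    have an: "?a \<notin> C j"
    proof
      assume "?a \<in> C j"
      then obtain z where "z \<in> {?b..<j}" "?a = \<sigma> ''cut_arcs'' z" by (auto simp: C_def)
      then show False using wf(1) j inj_onD[of "\<sigma> ''cut_arcs''" "{?b..<?e}" j z] by (auto simp: wfcut_def)
    qed
    have c1: "card (C (Suc j) \<inter> D) = card (C j \<inter> D) + card ({?a} \<inter> D)"
      unfolding Cs using an finC by (simp add: Int_insert_left)
    have "good n \<sigma> (C (Suc j)) D = good n \<sigma> (C j) D \<union> good n \<sigma> {?a} D" unfolding Cs by (auto simp: good_def)
    moreover have "good n \<sigma> (C j) D \<inter> good n \<sigma> {?a} D = {}" using an good_subset by blast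
    moreover have "finite (good n \<sigma> (C j) D)" "finite (good n \<sigma> {?a} D)"
      by (rule finite_subset[OF good_subset]; simp add: finC)+
    ultimately have c2: "card (good n \<sigma> (C (Suc j)) D) = card (good n \<sigma> (C j) D) + card (good n \<sigma> {?a} D)"
      by (simp add: card_Un_disjoint)
    have "card (C j \<inter> D) \<le> card (C j)" "card (good n \<sigma> (C j) D) \<le> card (C j)"
      by (rule card_mono; use finC good_subset in auto)+
    then have b1: "Suc (\<tau> ''inn'' 0) < W" "Suc (\<tau> ''gd'' 0) < W"
      using I C[of j] be j W by (auto simp: I_def)
    show "wp W Test_Arc (\<lambda>T \<tau>'. T \<le> 200 * R ^ 2 \<and> \<tau>' ''x'' 0 = j \<and> I (Suc j) (\<tau>'(''x'' := (\<tau>' ''x'')(0 := Suc j)))) \<tau>"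
    proof (rule wp_mono[OF wp_Test_Arc[OF env' _ ja am b1, unfolded fe, OF mark]], elim conjE, intro conjI)
      fix T \<tau>' assume T: "T \<le> 200 * R ^ 2" and f': "frame Arc_vars \<tau> \<tau>'"
        and v: "\<tau>' ''inn'' 0 = \<tau> ''inn'' 0 + card ({?a} \<inter> D)" "\<tau>' ''gd'' 0 = \<tau> ''gd'' 0 + card (good n \<tau> {?a} D)"
      show "T \<le> 200 * R ^ 2" by fact
      have "\<tau>' ''x'' = \<tau> ''x''" by (rule frameD[OF f']) simp
      then show "\<tau>' ''x'' 0 = j" using I by simp
      have "frame Test_vars \<sigma> \<tau>'" by (rule frame_trans[OF f frame_mono[OF f']]) auto
      then show "I (Suc j) (\<tau>'(''x'' := (\<tau>' ''x'')(0 := Suc j)))"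
        using v I c1 c2 by (simp add: I_def frame_upd gd)
    qed
  next
    fix T \<tau> assume T: "T \<le> cost (CB ''i'') + cost (CE ''i'') + 6 + (?e - ?b) * (200 * R ^ 2 + cost (CE ''i'') + 10)"
      and I: "I ?e \<tau>"
    have "12 + (?e - ?b) * (200 * R ^ 2 + 13) \<le> (12 + 200 + 13) * R ^ Suc 2"
      by (rule loop_time) (use be kR W in auto)
    moreover have "T \<le> 12 + (?e - ?b) * (200 * R ^ 2 + 13)" using T by (simp add: add.commute)
    ultimately have "T \<le> (12 + 200 + 13) * R ^ Suc 2" by (rule order_trans[rotated])
    also have "\<dots> \<le> 250 * R ^ 3" by (simp add: eval_nat_numeral)
    finally show "T \<le> 250 * R ^ 3 \<and> I ?e \<tau>" using I by blast
  qed (use W be in auto)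
  have R3: "1 \<le> R ^ 3" using W by simp
  have Ce: "C ?e = output_cut \<sigma> (\<sigma> ''i'' 0)" by (simp add: C_def output_cut_def)
  show ?thesis
    unfolding Test_def
    apply (rule wp_Seq)
    apply (rule wp_Assign)
      apply (use W in simp_all)[2]
    apply (rule wp_Seq)
    apply (rule wp_Assign)
      apply (use W in simp_all)[2]
    apply (rule wp_mono)
     apply (use L in simp)
    apply (use R3 in \<open>auto simp: I_def Ce\<close>)
    done
qed

section \<open>Comparing two candidates and selecting the survivors\<close>

abbreviation "env_vars \<equiv> {''n'', ''k'', ''head'', ''t'', ''pair_begin'', ''pair_end'', ''cf'', ''af'',
  ''cut_arcs'', ''cut_begin'', ''cut_end''}"

lemma frame_env:
  assumes f: "frame S \<sigma> \<tau>" and S: "S \<inter> env_vars = {}"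
  shows "env W n m k R \<tau> = env W n m k R \<sigma>" "good n \<tau> = good n \<sigma>" "output_cut \<tau> = output_cut \<sigma>"
    "\<And>x. x \<in> env_vars \<Longrightarrow> \<tau> x = \<sigma> x"
proof -
  show fe: "\<tau> x = \<sigma> x" if "x \<in> env_vars" for x
  proof (rule frameD[OF f], rule notI)
    assume "x \<in> S"
    then have "x \<in> S \<inter> env_vars" using that by (rule IntI)
    then show False unfolding S by (rule emptyE)
  qed
  show oc: "output_cut \<tau> = output_cut \<sigma>"
    by (simp add: fun_eq_iff output_cut_def fe)
  show "env W n m k R \<tau> = env W n m k R \<sigma>"
    unfolding env_def pool_def wfcut_def oc by (simp add: fe)
  show "good n \<tau> = good n \<sigma>"
    unfolding good_def oc by (simp add: fe)
qed

text \<open>By the first inequality the cut at j is no larger than the cut at i, so containment of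
  the latter in the former would mean equality. The strict inequality thus tests that the cuts
  differ, and \<open>j < i\<close> removes repetitions.\<close>

definition dominated :: "nat \<Rightarrow> state \<Rightarrow> nat \<Rightarrow> nat \<Rightarrow> bool" where
  "dominated n \<sigma> i j \<longleftrightarrow>
     card (output_cut \<sigma> j) \<le> card (good n \<sigma> (output_cut \<sigma> i) (output_cut \<sigma> j)) \<and>
     (card (output_cut \<sigma> i \<inter> output_cut \<sigma> j) < card (output_cut \<sigma> i) \<or> j < i)"

text \<open>Truncated subtraction tests inequalities: \<open>gd\<close> + 1 - card N is nonzero iff
  card N \<le> \<open>gd\<close>, and a sum of two differences is nonzero iff one of them
  is.\<close>

definition Compare :: com where
  "Compare = Mark ''j'' 1 ;; Test ;; Mark ''j'' 0 ;;
     If (Minus (Plus (V ''gd'') (Const 1)) (Minus (CE ''j'') (CB ''j'')))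
       (If (Plus (Minus (Minus (CE ''i'') (CB ''i'')) (V ''inn'')) (Minus (V ''i'') (V ''j'')))
          (''keep'' ::= Const 0) Skip)
       Skip"

abbreviation "Compare_vars \<equiv> {''inn'', ''fd'', ''q'', ''l'', ''ok'', ''y'', ''gd'', ''x'', ''mark'', ''keep''}"

lemma wp_Compare:
  assumes env: "env W n m k R \<sigma>" and mark: "\<sigma> ''mark'' = (\<lambda>_. 0)"
    and ij: "\<sigma> ''i'' 0 < \<sigma> ''cf'' 0" "\<sigma> ''j'' 0 < \<sigma> ''cf'' 0" and cf: "\<sigma> ''cf'' 0 + k + 2 < W"
  shows "wp W Compare (\<lambda>T \<tau>. T \<le> 500 * R ^ 3 \<and> frame Compare_vars \<sigma> \<tau> \<and> \<tau> ''mark'' = (\<lambda>_. 0) \<and>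
     \<tau> ''keep'' 0 = (if dominated n \<sigma> (\<sigma> ''i'' 0) (\<sigma> ''j'' 0) then 0 else \<sigma> ''keep'' 0)) \<sigma>"
proof -
  let ?i = "\<sigma> ''i'' 0" and ?j = "\<sigma> ''j'' 0"
  define Ci where "Ci = output_cut \<sigma> ?i"
  define Cj where "Cj = output_cut \<sigma> ?j"
  have W: "1 < W" "1 \<le> R" "k + 2 < W" using env by (auto simp: env_def)
  have pool: "pool m k \<sigma>" and kR: "Suc k \<le> R" using env by (auto simp: env_def)
  have wf: "wfcut m \<sigma> ?i" "card Ci \<le> Suc k" "wfcut m \<sigma> ?j" "card Cj \<le> Suc k"
    using poolD[OF pool] pool_card[OF pool] ij by (auto simp: Ci_def Cj_def)
  have li: "\<sigma> ''cut_end'' ?i - \<sigma> ''cut_begin'' ?i = card Ci" and lj: "\<sigma> ''cut_end'' ?j - \<sigma> ''cut_begin'' ?j = card Cj"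
    "\<sigma> ''cut_begin'' ?j \<le> \<sigma> ''cut_end'' ?j"
    using card_output_cut[OF wf(1)] card_output_cut[OF wf(3)] wf(3) by (auto simp: Ci_def Cj_def wfcut_def)
  define \<sigma>1 where "\<sigma>1 = \<sigma>(''mark'' := (\<lambda>a. if a \<in> Cj then 1 else 0), ''y'' := (\<sigma> ''y'')(0 := \<sigma> ''cut_end'' ?j))"
  have f1: "frame Compare_vars \<sigma> \<sigma>1" by (simp add: \<sigma>1_def frame_def)
  have "Compare_vars \<inter> env_vars = {}" by simp
  note e1 = frame_env[OF f1 this]
  have m1: "\<sigma>1 ''mark'' = (\<lambda>a. if a \<in> Cj then 1 else 0)" by (simp add: \<sigma>1_def)
  have i1: "\<sigma>1 ''i'' 0 = ?i" by (simp add: \<sigma>1_def)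
  have i1': "\<sigma>1 ''i'' 0 < \<sigma>1 ''cf'' 0" using ij by (simp add: \<sigma>1_def)
  have M1: "wp W (Mark ''j'' 1) (\<lambda>T \<tau>. T \<le> 20 * card Cj + 20 \<and> \<tau> = \<sigma>1) \<sigma>"
  proof (rule wp_mono[OF wp_Mark])
    show "T \<le> 20 * card Cj + 20 \<and> \<tau> = \<sigma>1"
      if "T \<le> 20 * (\<sigma> ''cut_end'' ?j - \<sigma> ''cut_begin'' ?j) + 20 \<and>
        \<tau> = \<sigma>(''mark'' := (\<lambda>a. if a \<in> output_cut \<sigma> ?j then 1 else \<sigma> ''mark'' a),
          ''y'' := (\<sigma> ''y'')(0 := \<sigma> ''cut_end'' ?j))" for T \<tau>
      using that mark lj by (simp add: \<sigma>1_def Cj_def cong: if_cong)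
  qed (use W lj in auto)
  have "1 \<le> R ^ 3" "R \<le> R ^ 3" using W by (simp_all add: eval_nat_numeral)
  then have kR3: "1 \<le> R ^ 3" "card Cj \<le> R ^ 3" using wf kR by linarith+
  show ?thesis
    unfolding Compare_def
    apply (rule wp_SeqI[OF M1])
    apply (erule conjE, hypsubst)
    apply (rule wp_SeqI)
     apply (rule wp_Test[OF e1(1)[THEN iffD2, OF env] m1 i1'])
    apply (elim conjE)
    subgoal premises P for T1 _ T2 \<sigma>2
    proof -
      have f12: "frame Test_vars \<sigma>1 \<sigma>2" by (rule P)
      have f2: "frame Compare_vars \<sigma> \<sigma>2" by (rule frame_trans[OF f1 frame_mono[OF f12]]) auto
      have "Compare_vars \<inter> env_vars = {}" by simp
      note e2 = frame_env[OF f2 this]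
      have x2: "\<sigma>2 ''i'' = \<sigma> ''i''" "\<sigma>2 ''j'' = \<sigma> ''j''" by (rule frameD[OF f2]; simp)+
      have m2: "\<sigma>2 ''mark'' = \<sigma>1 ''mark''" "\<sigma>2 ''keep'' = \<sigma>1 ''keep''" by (rule frameD[OF f12]; simp)+
      have v: "\<sigma>2 ''inn'' 0 = card (Ci \<inter> Cj)" "\<sigma>2 ''gd'' 0 = card (good n \<sigma> Ci Cj)"
        using P unfolding e1 i1 by (auto simp: Ci_def)
      have cb2: "\<sigma>2 ''cut_begin'' = \<sigma> ''cut_begin''" "\<sigma>2 ''cut_end'' = \<sigma> ''cut_end''" using e2(4) by auto
      define \<sigma>3 where "\<sigma>3 = \<sigma>2(''mark'' := (\<lambda>_. 0), ''y'' := (\<sigma>2 ''y'')(0 := \<sigma> ''cut_end'' ?j))"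
      have M3: "wp W (Mark ''j'' 0) (\<lambda>T \<tau>. T \<le> 20 * card Cj + 20 \<and> \<tau> = \<sigma>3) \<sigma>2"
      proof (rule wp_mono[OF wp_Mark])
        have "(\<lambda>a. if a \<in> Cj then 0 else \<sigma>2 ''mark'' a) = (\<lambda>_. 0)" using m2 m1 by auto
        then show "T \<le> 20 * card Cj + 20 \<and> \<tau> = \<sigma>3"
          if "T \<le> 20 * (\<sigma>2 ''cut_end'' (\<sigma>2 ''j'' 0) - \<sigma>2 ''cut_begin'' (\<sigma>2 ''j'' 0)) + 20 \<and>
            \<tau> = \<sigma>2(''mark'' := (\<lambda>a. if a \<in> output_cut \<sigma>2 (\<sigma>2 ''j'' 0) then 0 else \<sigma>2 ''mark'' a),
              ''y'' := (\<sigma>2 ''y'')(0 := \<sigma>2 ''cut_end'' (\<sigma>2 ''j'' 0)))" for T \<tau>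
          using that lj unfolding e2(3) x2 cb2 by (simp add: \<sigma>3_def flip: Cj_def)
      qed (use W lj cb2 x2 in auto)
      have f3: "frame Compare_vars \<sigma> \<sigma>3" using f2 by (simp add: \<sigma>3_def frame_upd)
      have "finite Ci" by (simp add: Ci_def)
      then have "card (good n \<sigma> Ci Cj) \<le> card Ci" by (rule card_mono[OF _ good_subset])
      then have g: "Suc (card (good n \<sigma> Ci Cj)) < W" using wf W by linarith
      have s3: "\<sigma>3 ''gd'' 0 = card (good n \<sigma> Ci Cj)" "\<sigma>3 ''inn'' 0 = card (Ci \<inter> Cj)" "\<sigma>3 ''i'' = \<sigma> ''i''"
        "\<sigma>3 ''j'' = \<sigma> ''j''" "\<sigma>3 ''cut_begin'' = \<sigma> ''cut_begin''" "\<sigma>3 ''cut_end'' = \<sigma> ''cut_end''"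
        "\<sigma>3 ''mark'' = (\<lambda>_. 0)" "\<sigma>3 ''keep'' = \<sigma> ''keep''"
        using v x2 cb2 m2 by (simp_all add: \<sigma>3_def \<sigma>1_def)
      have T2: "T1 + T2 \<le> 340 * R ^ 3" using P kR3 by linarith
      have T3: "T1 + (T2 + (T + 100)) \<le> 500 * R ^ 3" if "T \<le> 20 * card Cj + 20" for T
        using T2 that kR3 by linarith
      have d: "dominated n \<sigma> ?i ?j \<longleftrightarrow> card Cj \<le> card (good n \<sigma> Ci Cj) \<and> (card (Ci \<inter> Cj) < card Ci \<or> ?j < ?i)"
        by (simp add: dominated_def Ci_def Cj_def)
      show ?thesis
        apply (rule wp_SeqI[OF M3])
        apply (erule conjE, hypsubst)
        apply (rule wp_If)
        subgoal using W g by (simp add: s3)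
        subgoal premises c
          apply (rule wp_If)
          subgoal using W wf ij cf by (simp add: s3 li)
          subgoal premises c2
            apply (rule wp_Assign)
              apply (use W in simp_all)[2]
            using c c2 T3[OF c(1)] f3 by (auto simp add: s3 d li lj frame_upd)
          subgoal premises c2
            apply (rule wp_Skip)
            using c c2 T3[OF c(1)] f3 by (simp add: s3 d li lj)
          done
        subgoal premises c
          apply (rule wp_Skip)
          using c T3[OF c(1)] f3 by (simp add: s3 d li lj)
        done
    qed
    done
qed

text \<open>Adding candidates does not disturb the test, which only reads families whose indices lie
  below the old \<open>cf\<close>.\<close>

lemma adds_env:
  assumes env: "env W n m k R \<sigma>" and ad: "adds m k \<sigma> \<tau> S N" and t: "\<tau> ''t'' = \<sigma> ''t''"
  shows "env W n m k R \<tau>" "C \<subseteq> {..<m} \<Longrightarrow> good n \<tau> C D = good n \<sigma> C D"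
proof -
  have eq: "\<tau> ''n'' = \<sigma> ''n''" "\<tau> ''k'' = \<sigma> ''k''" "\<tau> ''head'' = \<sigma> ''head''" "\<tau> ''pair_begin'' = \<sigma> ''pair_begin''"
    "\<tau> ''pair_end'' = \<sigma> ''pair_end''" and cf: "\<sigma> ''cf'' 0 \<le> \<tau> ''cf'' 0" and pt: "pool m k \<tau>"
    using ad by (auto simp: adds_def ext_def)
  have pool: "pool m k \<sigma>" using env by (simp add: env_def)
  show "env W n m k R \<tau>" using env pt cf unfolding env_def eq t by (meson order_trans)
  assume C: "C \<subseteq> {..<m}"
  have "(\<exists>c \<in> {\<sigma> ''pair_begin'' (\<sigma> ''head'' b * n + \<sigma> ''t'' 0)..<\<sigma> ''pair_end'' (\<sigma> ''head'' b * n + \<sigma> ''t'' 0)}. output_cut \<tau> c \<subseteq> D)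
     \<longleftrightarrow> (\<exists>c \<in> {\<sigma> ''pair_begin'' (\<sigma> ''head'' b * n + \<sigma> ''t'' 0)..<\<sigma> ''pair_end'' (\<sigma> ''head'' b * n + \<sigma> ''t'' 0)}. output_cut \<sigma> c \<subseteq> D)"
    if "b \<in> C" for b
  proof (rule bex_cong[OF refl])
    fix c assume c: "c \<in> {\<sigma> ''pair_begin'' (\<sigma> ''head'' b * n + \<sigma> ''t'' 0)..<\<sigma> ''pair_end'' (\<sigma> ''head'' b * n + \<sigma> ''t'' 0)}"
    have "\<sigma> ''head'' b < n" "\<sigma> ''t'' 0 < n" using that C env by (auto simp: env_def)
    then have "\<sigma> ''pair_end'' (\<sigma> ''head'' b * n + \<sigma> ''t'' 0) \<le> \<sigma> ''cf'' 0"
      using pair_index env by (simp add: env_def)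
    then have "c < \<sigma> ''cf'' 0" using c by simp
    then show "(output_cut \<tau> c \<subseteq> D) = (output_cut \<sigma> c \<subseteq> D)" using adds_output_cut[OF pool ad] by simp
  qed
  then show "good n \<tau> C D = good n \<sigma> C D" unfolding good_def eq t by blast
qed

text \<open>A survivor gets a fresh index for the same interval of arcs. So the survivors occupy
  consecutive indices, as a family must, and no arcs are copied.\<close>

definition Keep :: com where
  "Keep = ''keep'' ::= Const 1 ;; For ''j'' (V ''kb'') (V ''ke'') Compare ;;
     If (V ''keep'')
       (Assign ''cut_begin'' (V ''cf'') (CB ''i'') ;;
        Assign ''cut_end'' (V ''cf'') (CE ''i'') ;;
        ''cf'' ::= Plus (V ''cf'') (Const 1))
       Skip"

definition Select :: com where
  "Select = For ''i'' (V ''kb'') (V ''ke'') Keep"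

abbreviation "Keep_vars \<equiv> {''inn'', ''fd'', ''q'', ''l'', ''ok'', ''y'', ''gd'', ''x'', ''mark'', ''keep'', ''j'',
  ''cut_begin'', ''cut_end'', ''cf''}"

abbreviation "Loop_vars \<equiv> {''inn'', ''fd'', ''q'', ''l'', ''ok'', ''y'', ''gd'', ''x'', ''mark'', ''keep'', ''j''}"

lemma wp_Keep:
  assumes env: "env W n m k R \<sigma>" and mark: "\<sigma> ''mark'' = (\<lambda>_. 0)"
    and b: "\<sigma> ''kb'' 0 = b" "\<sigma> ''ke'' 0 = e" "b \<le> e" "e \<le> \<sigma> ''cf'' 0" "e - b \<le> R"
    and i: "b \<le> \<sigma> ''i'' 0" "\<sigma> ''i'' 0 < e" and cf: "\<sigma> ''cf'' 0 + k + 2 < W"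
  shows "wp W Keep (\<lambda>T \<tau>. T \<le> 600 * R ^ 4 \<and> frame Keep_vars \<sigma> \<tau> \<and>
     (if \<exists>j\<in>{b..<e}. dominated n \<sigma> (\<sigma> ''i'' 0) j
      then \<tau> ''cf'' 0 = \<sigma> ''cf'' 0 \<and> adds m k \<sigma> \<tau> {} 1
      else \<tau> ''cf'' 0 = Suc (\<sigma> ''cf'' 0) \<and> adds m k \<sigma> \<tau> {output_cut \<sigma> (\<sigma> ''i'' 0)} 1)) \<sigma>"
proof -
  let ?i = "\<sigma> ''i'' 0" and ?cf = "\<sigma> ''cf'' 0"
  have W: "1 < W" "1 \<le> R" "k + 2 < W" using env by (auto simp: env_def)
  have pool: "pool m k \<sigma>" using env by (auto simp: env_def)
  let ?\<sigma> = "\<sigma>(''keep'' := (\<sigma> ''keep'')(0 := 1))"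
  define I where "I j \<tau> \<longleftrightarrow> frame Loop_vars \<sigma> \<tau> \<and> \<tau> ''mark'' = (\<lambda>_. 0) \<and>
    \<tau> ''keep'' 0 = (if \<exists>j'\<in>{b..<j}. dominated n \<sigma> ?i j' then 0 else 1)" for j \<tau>
  have L: "wp W (For ''j'' (V ''kb'') (V ''ke'') Compare) (\<lambda>T \<tau>. T \<le> 550 * R ^ 4 \<and> I e \<tau>) ?\<sigma>"
  proof (rule wp_For[where I = I and B = "500 * R ^ 3" and l = b and h = e, OF W(1)])
    show "I b (?\<sigma>(''j'' := (?\<sigma> ''j'')(0 := b)))" using mark by (simp add: I_def frame_upd frame_refl)
  next
    fix j \<tau> assume I: "I j \<tau>"
    then have f: "frame Loop_vars \<sigma> \<tau>" by (simp add: I_def)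
    have "\<tau> ''ke'' = \<sigma> ''ke''" by (rule frameD[OF f]) simp
    then show "ok W \<tau> (V ''ke'') \<and> val \<tau> (V ''ke'') = e" using W b by simp
  next
    fix j \<tau> assume j: "b \<le> j" "j < e" and I: "I j \<tau>" "\<tau> ''j'' 0 = j"
    have f: "frame Loop_vars \<sigma> \<tau>" and mk: "\<tau> ''mark'' = (\<lambda>_. 0)" using I by (simp_all add: I_def)
    have d: "Loop_vars \<inter> env_vars = {}" by simp
    note e1 = frame_env[OF f d]
    have x: "\<tau> ''i'' = \<sigma> ''i''" by (rule frameD[OF f]) simp
    have cf': "\<tau> ''cf'' = \<sigma> ''cf''" by (rule frameD[OF f]) simp
    have h: "\<tau> ''i'' 0 < \<tau> ''cf'' 0" "\<tau> ''j'' 0 < \<tau> ''cf'' 0" "\<tau> ''cf'' 0 + k + 2 < W"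
      unfolding x cf' I(2) using i j b cf by linarith+
    have dm: "dominated n \<tau> = dominated n \<sigma>" unfolding dominated_def e1 fun_eq_iff by simp
    show "wp W Compare (\<lambda>T \<tau>'. T \<le> 500 * R ^ 3 \<and> \<tau>' ''j'' 0 = j \<and> I (Suc j) (\<tau>'(''j'' := (\<tau>' ''j'')(0 := Suc j)))) \<tau>"
    proof (rule wp_mono[OF wp_Compare[OF e1(1)[THEN iffD2, OF env] mk h]], elim conjE, intro conjI)
      fix T \<tau>' assume T: "T \<le> 500 * R ^ 3" and f': "frame Compare_vars \<tau> \<tau>'" and mk': "\<tau>' ''mark'' = (\<lambda>_. 0)"
        and kp: "\<tau>' ''keep'' 0 = (if dominated n \<tau> (\<tau> ''i'' 0) (\<tau> ''j'' 0) then 0 else \<tau> ''keep'' 0)"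
      show "T \<le> 500 * R ^ 3" by fact
      have "\<tau>' ''j'' = \<tau> ''j''" by (rule frameD[OF f']) simp
      then show "\<tau>' ''j'' 0 = j" using I by simp
      have ff: "frame Loop_vars \<sigma> \<tau>'" by (rule frame_trans[OF f frame_mono[OF f']]) auto
      have "{b..<Suc j} = insert j {b..<j}" using j by auto
      then show "I (Suc j) (\<tau>'(''j'' := (\<tau>' ''j'')(0 := Suc j)))"
        using kp mk' ff I unfolding dm x by (simp add: I_def frame_upd)
    qed
  next
    fix T \<tau> assume T: "T \<le> cost (V ''kb'') + cost (V ''ke'') + 6 + (e - b) * (500 * R ^ 3 + cost (V ''ke'') + 10)"
      and I: "I e \<tau>"
    have "10 + (e - b) * (500 * R ^ 3 + 12) \<le> (10 + 500 + 12) * R ^ Suc 3"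
      by (rule loop_time) (use b W in auto)
    moreover have "T \<le> 10 + (e - b) * (500 * R ^ 3 + 12)" using T by (simp add: add.commute)
    ultimately have "T \<le> (10 + 500 + 12) * R ^ Suc 3" by (rule order_trans[rotated])
    also have "\<dots> \<le> 550 * R ^ 4" by (simp add: eval_nat_numeral)
    finally show "T \<le> 550 * R ^ 4 \<and> I e \<tau>" using I by blast
  qed (use W b in auto)
  have R4: "1 \<le> R ^ 4" using W by simp
  have iw: "wfcut m \<sigma> ?i" "card (output_cut \<sigma> ?i) \<le> Suc k"
    using poolD[OF pool] pool_card[OF pool] i b by simp_all
  show ?thesis
    unfolding Keep_def
    apply (rule wp_Seq)
    apply (rule wp_Assign)
      apply (use W in simp_all)[2]
    apply (rule wp_SeqI[where Q' = "\<lambda>T \<tau>. T \<le> 550 * R ^ 4 \<and> I e \<tau>"])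
     apply (use L in simp)
    apply (erule conjE)
    subgoal premises P for T \<tau>
    proof -
      have f: "frame Loop_vars \<sigma> \<tau>" and mk: "\<tau> ''mark'' = (\<lambda>_. 0)"
        and kp: "\<tau> ''keep'' 0 = (if \<exists>j'\<in>{b..<e}. dominated n \<sigma> ?i j' then 0 else 1)"
        using P by (simp_all add: I_def)
      have d: "Loop_vars \<inter> env_vars = {}" by simp
      note e1 = frame_env[OF f d]
      have x: "\<tau> ''i'' = \<sigma> ''i''" by (rule frameD[OF f]) simp
      have fK: "frame Keep_vars \<sigma> \<tau>" by (rule frame_mono[OF f]) auto
      have eq: "\<And>x. x \<in> {''n'', ''m'', ''k'', ''tail'', ''head'', ''pair_begin'', ''pair_end'',
           ''cf'', ''af'', ''cut_arcs'', ''cut_begin'', ''cut_end''} \<Longrightarrow> \<tau> x = \<sigma> x"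
        by (rule frameD[OF f]) auto
      have ad0: "adds m k \<sigma> \<tau> {} 1"
        using pool mark mk unfolding adds_def ext_def pool_def wfcut_def e1(3) by (simp add: eq)
      define \<tau>1 where "\<tau>1 = \<tau>(''cut_begin'' := (\<sigma> ''cut_begin'')(?cf := \<sigma> ''cut_begin'' ?i),
         ''cut_end'' := (\<sigma> ''cut_end'')(?cf := \<sigma> ''cut_end'' ?i), ''cf'' := (\<sigma> ''cf'')(0 := Suc ?cf))"
      have e: "ext \<sigma> \<tau>1" by (simp add: ext_def \<tau>1_def eq)
      have c1: "output_cut \<tau>1 ?cf = output_cut \<sigma> ?i" by (simp add: output_cut_def \<tau>1_def eq)
      have w1: "wfcut m \<tau>1 ?cf" using iw(1) c1 by (simp add: wfcut_def \<tau>1_def eq)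
      have pt: "wfcut m \<tau>1 c \<and> card (output_cut \<tau>1 c) \<le> Suc k" if "c < Suc ?cf" for c
      proof (cases "c < ?cf")
        case True
        then show ?thesis
          using ext_wfcut[OF e True poolD[OF pool True]] ext_output_cut[OF e True poolD[OF pool True]]
            pool_card[OF pool True] by simp
      next
        case False
        then show ?thesis using that w1 c1 iw less_Suc_eq by simp
      qed
      have cf1: "\<tau>1 ''cf'' 0 = Suc ?cf" "\<tau>1 ''af'' 0 = \<sigma> ''af'' 0" by (simp_all add: \<tau>1_def eq)
      have ad1: "adds m k \<sigma> \<tau>1 {output_cut \<sigma> ?i} 1"
        using e pt mark mk unfolding adds_def pool_def cf1 by (simp add: c1) (simp add: \<tau>1_def eq)
      have f1: "frame Keep_vars \<sigma> \<tau>1" using fK by (simp add: \<tau>1_def frame_upd)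
      show ?thesis
        apply (rule wp_If)
        subgoal using W by simp
        subgoal premises c
        proof -
          have nd: "\<not> (\<exists>j'\<in>{b..<e}. dominated n \<sigma> ?i j')" using c kp by (auto split: if_splits)
          show ?thesis
            apply (rule wp_Seq)
            apply (rule wp_Assign)
              apply (use W in simp_all)[2]
            apply (rule wp_Seq)
            apply (rule wp_Assign)
              apply (use W in simp_all)[2]
            apply (rule wp_Assign)
            subgoal using W by simp
            subgoal using W cf by (simp add: eq)
            subgoal using nd P(1) R4 ad1 f1 cf1 by (simp add: x eq \<tau>1_def)
            done
        qed
        subgoal premises c
        proof -
          have nd: "\<exists>j'\<in>{b..<e}. dominated n \<sigma> ?i j'" using c kp by (auto split: if_splits)
          show ?thesis
            apply (rule wp_Skip)
            using nd P(1) R4 ad0 fK by (simp add: eq)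
        qed
        done
    qed
    done
qed

abbreviation "Select_vars \<equiv> {''inn'', ''fd'', ''q'', ''l'', ''ok'', ''y'', ''gd'', ''x'', ''mark'', ''keep'', ''j'',
  ''cut_begin'', ''cut_end'', ''cf'', ''i''}"

text \<open>Injectivity on the new block makes the length of a family the number of its cuts. Only
  then does the bound 4^k on this number limit the work of later updates, however often a cut arose
  as a union.\<close>

lemma wp_Select:
  assumes env: "env W n m k R \<sigma>" and mark: "\<sigma> ''mark'' = (\<lambda>_. 0)"
    and b: "\<sigma> ''kb'' 0 = b" "\<sigma> ''ke'' 0 = e" "b \<le> e" "e \<le> \<sigma> ''cf'' 0" "e - b \<le> R"
    and cf: "\<sigma> ''cf'' 0 + (e - b) + k + 2 < W"
  shows "wp W Select (\<lambda>T \<tau>. T \<le> 700 * R ^ 5 \<and> frame Select_vars \<sigma> \<tau> \<and>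
     adds m k \<sigma> \<tau> (output_cut \<sigma> ` {i \<in> {b..<e}. \<forall>j\<in>{b..<e}. \<not> dominated n \<sigma> i j}) (e - b) \<and>
     inj_on (output_cut \<tau>) {\<sigma> ''cf'' 0..<\<tau> ''cf'' 0}) \<sigma>"
proof -
  let ?cf = "\<sigma> ''cf'' 0"
  have W: "1 < W" "1 \<le> R" "k + 2 < W" using env by (auto simp: env_def)
  have pool: "pool m k \<sigma>" using env by (auto simp: env_def)
  define \<K> where "\<K> h = {i \<in> {b..<h}. \<forall>j\<in>{b..<e}. \<not> dominated n \<sigma> i j}" for h
  define I where "I h \<tau> \<longleftrightarrow> frame Select_vars \<sigma> \<tau> \<and> adds m k \<sigma> \<tau> (output_cut \<sigma> ` \<K> h) (h - b) \<and>
     inj_on (output_cut \<tau>) {?cf..<\<tau> ''cf'' 0}" for h \<tau>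
  \<comment> \<open>A cut passes the size test against an equal one, so the later of two equal cuts
    is dominated by the earlier.\<close>
  have nodup: "output_cut \<sigma> i \<noteq> output_cut \<sigma> j" if "j < i" "\<not> dominated n \<sigma> i j" for i j
  proof
    assume eq: "output_cut \<sigma> i = output_cut \<sigma> j"
    then have "good n \<sigma> (output_cut \<sigma> i) (output_cut \<sigma> j) = output_cut \<sigma> i" by (auto simp: good_def)
    then show False using that eq by (simp add: dominated_def)
  qed
  show ?thesis
    unfolding Select_def
  proof (rule wp_For[where I = I and B = "600 * R ^ 4" and l = b and h = e, OF W(1)])
    show "I b (\<sigma>(''i'' := (\<sigma> ''i'')(0 := b)))"
      using adds_refl[OF pool] by (simp add: I_def frame_upd frame_refl adds_upd \<K>_def)
  next
    fix h \<tau> assume I: "I h \<tau>"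
    then have f: "frame Select_vars \<sigma> \<tau>" by (simp add: I_def)
    have "\<tau> ''ke'' = \<sigma> ''ke''" by (rule frameD[OF f]) simp
    then show "ok W \<tau> (V ''ke'') \<and> val \<tau> (V ''ke'') = e" using W b by simp
  next
    fix h \<tau> assume h: "b \<le> h" "h < e" and I: "I h \<tau>" "\<tau> ''i'' 0 = h"
    have f: "frame Select_vars \<sigma> \<tau>" and ad: "adds m k \<sigma> \<tau> (output_cut \<sigma> ` \<K> h) (h - b)"
      and inj: "inj_on (output_cut \<tau>) {?cf..<\<tau> ''cf'' 0}" using I by (simp_all add: I_def)
    have x: "\<tau> ''t'' = \<sigma> ''t''" "\<tau> ''kb'' = \<sigma> ''kb''" "\<tau> ''ke'' = \<sigma> ''ke''" by (rule frameD[OF f]; simp)+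
    note env' = adds_env[OF env ad x(1)]
    have c: "?cf \<le> \<tau> ''cf'' 0" "\<tau> ''cf'' 0 \<le> ?cf + (h - b)" "\<tau> ''mark'' = (\<lambda>_. 0)"
      using ad mark by (auto simp: adds_def ext_def)
    have oc: "output_cut \<tau> i = output_cut \<sigma> i" if "i < e" for i
      using adds_output_cut[OF pool ad, of i] that b by simp
    have dm: "dominated n \<tau> i j = dominated n \<sigma> i j" if "i < e" "j < e" for i j
    proof -
      have "output_cut \<sigma> i \<subseteq> {..<m}" using poolD[OF pool, of i] that b by (simp add: wfcut_def)
      from env'(2)[OF this] show ?thesis unfolding dominated_def oc[OF that(1)] oc[OF that(2)] by simp
    qed
    have pre: "\<tau> ''kb'' 0 = b" "\<tau> ''ke'' 0 = e" "e \<le> \<tau> ''cf'' 0" "b \<le> \<tau> ''i'' 0" "\<tau> ''i'' 0 < e"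
      "\<tau> ''cf'' 0 + k + 2 < W"
      using b c h I cf unfolding x by simp_all
    have bex: "(\<exists>j\<in>{b..<e}. dominated n \<tau> (\<tau> ''i'' 0) j) \<longleftrightarrow> (\<exists>j\<in>{b..<e}. dominated n \<sigma> h j)"
      using dm h I(2) by (intro bex_cong refl) simp
    have Ksuc: "\<K> (Suc h) = (if \<exists>j\<in>{b..<e}. dominated n \<sigma> h j then \<K> h else insert h (\<K> h))"
      using h by (auto simp: \<K>_def less_Suc_eq)
    show "wp W Keep (\<lambda>T \<tau>'. T \<le> 600 * R ^ 4 \<and> \<tau>' ''i'' 0 = h \<and> I (Suc h) (\<tau>'(''i'' := (\<tau>' ''i'')(0 := Suc h)))) \<tau>"
    proof (rule wp_mono[OF wp_Keep[OF env'(1) c(3) pre(1,2) b(3) pre(3) b(5) pre(4,5,6)]], elim conjE, intro conjI)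
      fix T \<tau>' assume T: "T \<le> 600 * R ^ 4" and f': "frame Keep_vars \<tau> \<tau>'"
        and r: "if \<exists>j\<in>{b..<e}. dominated n \<tau> (\<tau> ''i'' 0) j
           then \<tau>' ''cf'' 0 = \<tau> ''cf'' 0 \<and> adds m k \<tau> \<tau>' {} 1
           else \<tau>' ''cf'' 0 = Suc (\<tau> ''cf'' 0) \<and> adds m k \<tau> \<tau>' {output_cut \<tau> (\<tau> ''i'' 0)} 1"
      show "T \<le> 600 * R ^ 4" by fact
      have "\<tau>' ''i'' = \<tau> ''i''" by (rule frameD[OF f']) simp
      then show "\<tau>' ''i'' 0 = h" using I by simp
      have ff: "frame Select_vars \<sigma> \<tau>'" by (rule frame_trans[OF f frame_mono[OF f']]) auto
      have sh: "h - b + 1 = Suc h - b" using h by simp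
      have pool': "pool m k \<tau>" using ad by (simp add: adds_def)
      obtain S where S: "adds m k \<tau> \<tau>' S 1" using r by (auto split: if_splits)
      have oc': "output_cut \<tau>' i = output_cut \<tau> i" if "i < \<tau> ''cf'' 0" for i
        using adds_output_cut[OF pool' S that] .
      have inj': "inj_on (output_cut \<tau>') {?cf..<\<tau> ''cf'' 0}"
      proof -
        have "inj_on (output_cut \<tau>') {?cf..<\<tau> ''cf'' 0} = inj_on (output_cut \<tau>) {?cf..<\<tau> ''cf'' 0}"
          by (rule inj_on_cong) (use oc' in simp)
        then show ?thesis using inj by blast
      qed
      have res: "adds m k \<sigma> \<tau>' (output_cut \<sigma> ` \<K> (Suc h)) (Suc h - b) \<and> inj_on (output_cut \<tau>') {?cf..<\<tau>' ''cf'' 0}"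
      proof (cases "\<exists>j\<in>{b..<e}. dominated n \<sigma> h j")
        case True
        then have r': "\<tau>' ''cf'' 0 = \<tau> ''cf'' 0" "adds m k \<tau> \<tau>' {} 1" using r unfolding bex by auto
        have "adds m k \<sigma> \<tau>' (output_cut \<sigma> ` \<K> (Suc h)) (Suc h - b)"
          using adds_trans[OF ad r'(2)] True unfolding sh Ksuc by simp
        then show ?thesis using inj' r'(1) by simp
      next
        case False
        then have r': "\<tau>' ''cf'' 0 = Suc (\<tau> ''cf'' 0)" "adds m k \<tau> \<tau>' {output_cut \<sigma> h} 1"
          using r oc[OF h(2)] I(2) unfolding bex by auto
        have a: "adds m k \<sigma> \<tau>' (output_cut \<sigma> ` \<K> (Suc h)) (Suc h - b)"
          using adds_trans[OF ad r'(2)] False unfolding sh Ksuc by simp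
        have new: "output_cut \<tau>' (\<tau> ''cf'' 0) = output_cut \<sigma> h"
        proof -
          have "output_cut \<tau>' ` {\<tau> ''cf'' 0..<\<tau>' ''cf'' 0} = {output_cut \<sigma> h}" using r'(2) by (simp add: adds_def)
          then show ?thesis using r'(1) by simp
        qed
        have old: "output_cut \<tau>' ` {?cf..<\<tau> ''cf'' 0} = output_cut \<sigma> ` \<K> h"
        proof -
          have "output_cut \<tau>' ` {?cf..<\<tau> ''cf'' 0} = output_cut \<tau> ` {?cf..<\<tau> ''cf'' 0}"
            by (rule image_cong) (use oc' in auto)
          then show ?thesis using ad by (simp add: adds_def)
        qed
        have "output_cut \<sigma> h \<notin> output_cut \<sigma> ` \<K> h"
        proof
          assume "output_cut \<sigma> h \<in> output_cut \<sigma> ` \<K> h"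
          then obtain j where "output_cut \<sigma> h = output_cut \<sigma> j" "b \<le> j" "j < h" by (auto simp: \<K>_def)
          moreover from this have "\<not> dominated n \<sigma> h j" using False h by auto
          ultimately show False using nodup by blast
        qed
        then have "inj_on (output_cut \<tau>') (insert (\<tau> ''cf'' 0) {?cf..<\<tau> ''cf'' 0})"
          using inj' old new by (simp add: inj_on_insert)
        moreover have "insert (\<tau> ''cf'' 0) {?cf..<\<tau> ''cf'' 0} = {?cf..<\<tau>' ''cf'' 0}" using c r'(1) by auto
        ultimately show ?thesis using a by simp
      qed
      then show "I (Suc h) (\<tau>'(''i'' := (\<tau>' ''i'')(0 := Suc h)))"
        using ff by (simp add: I_def frame_upd adds_upd)
    qed
  next
    fix T \<tau> assume T: "T \<le> cost (V ''kb'') + cost (V ''ke'') + 6 + (e - b) * (600 * R ^ 4 + cost (V ''ke'') + 10)"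
      and I: "I e \<tau>"
    have "10 + (e - b) * (600 * R ^ 4 + 12) \<le> (10 + 600 + 12) * R ^ Suc 4"
      by (rule loop_time) (use b W in auto)
    moreover have "T \<le> 10 + (e - b) * (600 * R ^ 4 + 12)" using T by (simp add: add.commute)
    ultimately have "T \<le> (10 + 600 + 12) * R ^ Suc 4" by (rule order_trans[rotated])
    also have "\<dots> \<le> 700 * R ^ 5" by (simp add: eval_nat_numeral)
    finally show "T \<le> 700 * R ^ 5 \<and> frame Select_vars \<sigma> \<tau> \<and>
     adds m k \<sigma> \<tau> (output_cut \<sigma> ` {i \<in> {b..<e}. \<forall>j\<in>{b..<e}. \<not> dominated n \<sigma> i j}) (e - b) \<and>
     inj_on (output_cut \<tau>) {?cf..<\<tau> ''cf'' 0}" using I by (simp add: I_def \<K>_def)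
  qed (use W b in auto)
qed

text \<open>Ties are broken by position, so that of equal candidates the first one survives.\<close>

lemma undominated_image:
  fixes C :: "nat \<Rightarrow> nat set"
  assumes fin: "\<And>i. finite (C i)" and g: "\<And>i j. g (C i) (C j) \<subseteq> C i"
  shows "C ` {i \<in> {b..<e}. \<forall>j\<in>{b..<e}. \<not> (card (C j) \<le> card (g (C i) (C j)) \<and> (card (C i \<inter> C j) < card (C i) \<or> j < i))}
    = {M \<in> C ` {b..<e}. \<forall>N\<in>C ` {b..<e}. card N \<le> card (g M N) \<longrightarrow> N = M}"
proof (intro equalityI subsetI)
  fix M assume "M \<in> C ` {i \<in> {b..<e}. \<forall>j\<in>{b..<e}. \<not> (card (C j) \<le> card (g (C i) (C j)) \<and> (card (C i \<inter> C j) < card (C i) \<or> j < i))}"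
  then obtain i where i: "M = C i" "i \<in> {b..<e}" "\<And>j. j \<in> {b..<e} \<Longrightarrow> card (C j) \<le> card (g (C i) (C j)) \<Longrightarrow> card (C i) \<le> card (C i \<inter> C j)"
    by fastforce
  have "C j = C i" if "j \<in> {b..<e}" "card (C j) \<le> card (g (C i) (C j))" for j
  proof -
    have "C i \<inter> C j = C i" using i(3)[OF that] fin by (intro card_seteq) auto
    then have "C i \<subseteq> C j" by blast
    moreover have "card (g (C i) (C j)) \<le> card (C i)" by (rule card_mono[OF fin g])
    ultimately show ?thesis using card_seteq[OF fin, of "C i" j] that(2) by simp
  qed
  then show "M \<in> {M \<in> C ` {b..<e}. \<forall>N\<in>C ` {b..<e}. card N \<le> card (g M N) \<longrightarrow> N = M}" using i by auto
next
  fix M assume M: "M \<in> {M \<in> C ` {b..<e}. \<forall>N\<in>C ` {b..<e}. card N \<le> card (g M N) \<longrightarrow> N = M}"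
  then have ex: "\<exists>i. i \<in> {b..<e} \<and> C i = M" by blast
  define i where "i = (LEAST i. i \<in> {b..<e} \<and> C i = M)"
  have i: "i \<in> {b..<e}" "C i = M" using LeastI_ex[OF ex] by (simp_all add: i_def)
  have "i \<le> j" if "j \<in> {b..<e}" "C j = M" for j unfolding i_def by (rule Least_le) (use that in simp)
  then have "\<not> (card (C j) \<le> card (g (C i) (C j)) \<and> (card (C i \<inter> C j) < card (C i) \<or> j < i))" if "j \<in> {b..<e}" for j
    using M i that by fastforce
  then show "M \<in> C ` {i \<in> {b..<e}. \<forall>j\<in>{b..<e}. \<not> (card (C j) \<le> card (g (C i) (C j)) \<and> (card (C i \<inter> C j) < card (C i) \<or> j < i))}"
    using i by blast
qed

section \<open>One update, for an arc and a target\<close>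

definition Setup :: com where
  "Setup =
     ''p'' ::= Plus (Times (Read ''tail'' (V ''a'')) (V ''n'')) (V ''t'') ;;
     ''q'' ::= Plus (Times (Read ''head'' (V ''a'')) (V ''n'')) (V ''t'') ;;
     ''sing'' ::= V ''cf'' ;;
     Assign ''cut_begin'' (V ''cf'') (V ''af'') ;;
     Assign ''cut_arcs'' (V ''af'') (V ''a'') ;;
     ''af'' ::= Plus (V ''af'') (Const 1) ;;
     Assign ''cut_end'' (V ''cf'') (V ''af'') ;;
     ''cf'' ::= Plus (V ''cf'') (Const 1) ;;
     ''kb'' ::= V ''cf''"

text \<open>Candidates lie between \<open>kb\<close> and \<open>ke\<close>, survivors between
  \<open>ke\<close> and \<open>cf\<close>. Redirecting the interval of \<open>p\<close> to the
  survivors completes the update; the superseded family and the candidates stay in memory as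
  garbage.\<close>

definition Step :: com where
  "Step = Setup ;; Build ;; ''ke'' ::= V ''cf'' ;; Select ;;
     Assign ''pair_begin'' (V ''p'') (V ''ke'') ;;
     Assign ''pair_end'' (V ''p'') (V ''cf'')"

lemma wp_Assign_to:
  assumes "ok W \<sigma> i" "ok W \<sigma> e" "(\<sigma> x)(val \<sigma> i := val \<sigma> e) = f"
    and "Q (1 + cost i + cost e) (\<sigma>(x := f))"
  shows "wp W (Assign x i e) Q \<sigma>"
  using wp_Assign[of W \<sigma> i e Q x] assms by simp

definition fam :: "state \<Rightarrow> nat \<Rightarrow> nat set set" where
  "fam \<sigma> p = output_cut \<sigma> ` {\<sigma> ''pair_begin'' p..<\<sigma> ''pair_end'' p}"

abbreviation "Step_vars \<equiv> {''inn'', ''fd'', ''q'', ''l'', ''ok'', ''y'', ''gd'', ''x'', ''mark'', ''keep'', ''j'',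
  ''cut_begin'', ''cut_end'', ''cf'', ''i'', ''p'', ''sing'', ''cut_arcs'', ''af'', ''kb'', ''ke'', ''pair_begin'', ''pair_end''}"

definition candidates :: "nat \<Rightarrow> state \<Rightarrow> nat \<Rightarrow> nat \<Rightarrow> nat \<Rightarrow> nat set set" where
  "candidates k \<sigma> p q a = (\<Union>P\<in>fam \<sigma> p. joins k P (insert {a} (fam \<sigma> q)))"

lemma adds_fam:
  assumes "adds m k \<sigma> \<tau> S N" "pool m k \<sigma>" "\<sigma> ''pair_end'' p \<le> \<sigma> ''cf'' 0"
  shows "fam \<tau> p = fam \<sigma> p"
proof -
  have "\<tau> ''pair_begin'' = \<sigma> ''pair_begin''" "\<tau> ''pair_end'' = \<sigma> ''pair_end''" using assms by (auto simp: adds_def)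
  moreover have "output_cut \<tau> ` {\<sigma> ''pair_begin'' p..<\<sigma> ''pair_end'' p} = output_cut \<sigma> ` {\<sigma> ''pair_begin'' p..<\<sigma> ''pair_end'' p}"
    by (rule image_cong) (use adds_output_cut[OF assms(2,1)] assms(3) in auto)
  ultimately show ?thesis by (simp add: fam_def)
qed

text \<open>L bounds both families, so L * Suc L bounds the candidates. The room 6 * R^2 covers the
  singleton, the candidates and the survivors, at most 3 * R entries with at most 2 * R cells
  each.\<close>

lemma wp_Step:
  assumes env: "env W n m k R \<sigma>" and mark: "\<sigma> ''mark'' = (\<lambda>_. 0)"
    and a: "\<sigma> ''a'' 0 = a" "a < m" "\<sigma> ''tail'' a < n" and t: "\<sigma> ''t'' 0 = t"
    and p: "p = \<sigma> ''tail'' a * n + t" and q: "q = \<sigma> ''head'' a * n + t"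
    and L: "\<sigma> ''pair_end'' p - \<sigma> ''pair_begin'' p \<le> L" "\<sigma> ''pair_end'' q - \<sigma> ''pair_begin'' q \<le> L" "L * Suc L \<le> R"
    and S: "\<sigma> ''cf'' 0 + 6 * R ^ 2 < W" "\<sigma> ''af'' 0 + 6 * R ^ 2 < W"
  defines "K \<equiv> candidates k \<sigma> p q a"
  shows "wp W Step (\<lambda>T \<tau>. T \<le> 2000 * R ^ 5 \<and> frame Step_vars \<sigma> \<tau> \<and> \<tau> ''mark'' = (\<lambda>_. 0) \<and>
     pool m k \<tau> \<and> \<tau> ''cf'' 0 \<le> \<sigma> ''cf'' 0 + 6 * R ^ 2 \<and> \<tau> ''af'' 0 \<le> \<sigma> ''af'' 0 + 6 * R ^ 2 \<and> \<sigma> ''cf'' 0 \<le> \<tau> ''cf'' 0 \<and>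
     (\<forall>p'. p' \<noteq> p \<longrightarrow> \<tau> ''pair_begin'' p' = \<sigma> ''pair_begin'' p' \<and> \<tau> ''pair_end'' p' = \<sigma> ''pair_end'' p') \<and>
     (\<forall>p'<n * n. p' \<noteq> p \<longrightarrow> fam \<tau> p' = fam \<sigma> p') \<and>
     \<tau> ''pair_begin'' p \<le> \<tau> ''pair_end'' p \<and> \<tau> ''pair_end'' p \<le> \<tau> ''cf'' 0 \<and>
     \<tau> ''pair_end'' p - \<tau> ''pair_begin'' p = card (fam \<tau> p) \<and>
     fam \<tau> p = {M \<in> K. \<forall>N\<in>K. card N \<le> card {b \<in> M. b \<in> N \<or> (\<exists>P\<in>fam \<sigma> (\<sigma> ''head'' b * n + t). P \<subseteq> N)} \<longrightarrow> N = M}) \<sigma>"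
proof -
  let ?cf = "\<sigma> ''cf'' 0" and ?af = "\<sigma> ''af'' 0"
  define lp where "lp = \<sigma> ''pair_end'' p - \<sigma> ''pair_begin'' p"
  define lq where "lq = \<sigma> ''pair_end'' q - \<sigma> ''pair_begin'' q"
  define N where "N = lp * Suc lq"
  have W: "1 < W" "1 \<le> R" "k + 2 < W" "Suc k < W" "k + 2 \<le> R" and nv: "\<sigma> ''n'' 0 = n" "\<sigma> ''k'' 0 = k" using env by (auto simp: env_def)
  have pool: "pool m k \<sigma>" using env by (auto simp: env_def)
  have tn: "t < n" "\<sigma> ''head'' a < n" using env t a by (auto simp: env_def)
  have pq: "p < n * n" "q < n * n" unfolding p q by (rule pair_index; use tn a in simp)+
  have nW: "n * n \<le> W" using env by (simp add: env_def)
  have pqW: "p < W" "q < W" "\<sigma> ''tail'' a * n < W" "\<sigma> ''head'' a * n < W"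
    using pq nW unfolding p q by linarith+
  have pp: "\<sigma> ''pair_begin'' p' \<le> \<sigma> ''pair_end'' p'" "\<sigma> ''pair_end'' p' \<le> ?cf" if "p' < n * n" for p'
    using env that by (auto simp: env_def)
  have NR: "N \<le> R"
  proof -
    have "N \<le> L * Suc L" unfolding N_def by (rule mult_le_mono) (use L in \<open>auto simp: lp_def lq_def\<close>)
    then show ?thesis using L by simp
  qed
  have lR: "lp \<le> R" "lq \<le> R"
  proof -
    have "L \<le> R" using L(3) by simp
    then show "lp \<le> R" "lq \<le> R" unfolding lp_def lq_def using L(1,2) by linarith+
  qed
  have RR: "R \<le> R ^ 2" "1 \<le> R ^ 2" using W by (simp_all add: power2_eq_square)
  have N2: "N * (2 * k + 2) \<le> 2 * R ^ 2"
  proof -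
    have "N * (2 * k + 2) \<le> R * (2 * R)" by (rule mult_le_mono[OF NR]) (use W in simp)
    then show ?thesis by (simp add: power2_eq_square)
  qed
  define \<sigma>1 where "\<sigma>1 = \<sigma>(''p'' := (\<sigma> ''p'')(0 := p), ''q'' := (\<sigma> ''q'')(0 := q), ''sing'' := (\<sigma> ''sing'')(0 := ?cf),
     ''cut_begin'' := (\<sigma> ''cut_begin'')(?cf := ?af), ''cut_arcs'' := (\<sigma> ''cut_arcs'')(?af := a), ''af'' := (\<sigma> ''af'')(0 := Suc ?af),
     ''cut_end'' := (\<sigma> ''cut_end'')(?cf := Suc ?af), ''cf'' := (\<sigma> ''cf'')(0 := Suc ?cf), ''kb'' := (\<sigma> ''kb'')(0 := Suc ?cf))"
  have eq1: "\<sigma>1 ''n'' = \<sigma> ''n''" "\<sigma>1 ''k'' = \<sigma> ''k''" "\<sigma>1 ''mark'' = (\<lambda>_. 0)" "\<sigma>1 ''pair_begin'' = \<sigma> ''pair_begin''"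
    "\<sigma>1 ''pair_end'' = \<sigma> ''pair_end''" "\<sigma>1 ''p'' 0 = p" "\<sigma>1 ''q'' 0 = q" "\<sigma>1 ''sing'' 0 = ?cf" "\<sigma>1 ''kb'' 0 = Suc ?cf"
    "\<sigma>1 ''cf'' 0 = Suc ?cf" "\<sigma>1 ''af'' 0 = Suc ?af" "\<sigma>1 ''head'' = \<sigma> ''head''" "\<sigma>1 ''t'' = \<sigma> ''t''"
    "\<sigma>1 ''m'' = \<sigma> ''m''" "\<sigma>1 ''tail'' = \<sigma> ''tail''"
    using mark by (simp_all add: \<sigma>1_def)
  have f1: "frame Step_vars \<sigma> \<sigma>1" by (simp add: \<sigma>1_def frame_upd frame_refl)
  have e1: "ext \<sigma> \<sigma>1" by (simp add: ext_def \<sigma>1_def)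
  have sing: "output_cut \<sigma>1 ?cf = {a}" by (simp add: output_cut_def \<sigma>1_def)
  have ws: "wfcut m \<sigma>1 ?cf" using a by (simp add: wfcut_def sing) (simp add: \<sigma>1_def)
  have pool1: "pool m k \<sigma>1"
    unfolding pool_def eq1 less_Suc_eq
    using ws sing ext_wfcut[OF e1 _ poolD[OF pool]] ext_output_cut[OF e1 _ poolD[OF pool]] pool_card[OF pool] by auto
  have ad1: "adds m k \<sigma> \<sigma>1 {{a}} 1"
    using e1 pool1 sing eq1 mark by (simp add: adds_def)
  note env1 = adds_env[OF env ad1 eq1(13)]
  have fam1: "fam \<sigma>1 p' = fam \<sigma> p'" if "p' < n * n" for p' by (rule adds_fam[OF ad1 pool]) (use pp that in simp)
  have oc1: "output_cut \<sigma>1 c = output_cut \<sigma> c" if "c < ?cf" for c by (rule adds_output_cut[OF pool ad1 that])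
  have B: "wp W Build (\<lambda>T \<tau>. T \<le> 1000 * R ^ 3 \<and> adds m k \<sigma>1 \<tau> K N \<and> frame (insert ''i'' (insert ''j'' U_vars)) \<sigma>1 \<tau>) \<sigma>1"
  proof -
    have h: "\<sigma>1 ''sing'' 0 < \<sigma>1 ''cf'' 0" "\<sigma>1 ''k'' 0 = k"
      "\<sigma> ''pair_begin'' p \<le> \<sigma> ''pair_end'' p" "\<sigma> ''pair_end'' p \<le> \<sigma>1 ''cf'' 0"
      "\<sigma> ''pair_begin'' q \<le> \<sigma> ''pair_end'' q" "\<sigma> ''pair_end'' q \<le> \<sigma>1 ''cf'' 0"
      "\<sigma>1 ''af'' 0 + N * (2 * k + 2) < W" "\<sigma>1 ''cf'' 0 + N < W"
      using pp(1)[OF pq(1)] pp(2)[OF pq(1)] pp(1)[OF pq(2)] pp(2)[OF pq(2)] nv S N2 NR RR unfolding eq1 by linarith+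
    have x: "\<sigma>1 ''pair_begin'' (\<sigma>1 ''p'' 0) = \<sigma> ''pair_begin'' p" "\<sigma>1 ''pair_end'' (\<sigma>1 ''p'' 0) = \<sigma> ''pair_end'' p"
      "\<sigma>1 ''pair_begin'' (\<sigma>1 ''q'' 0) = \<sigma> ''pair_begin'' q" "\<sigma>1 ''pair_end'' (\<sigma>1 ''q'' 0) = \<sigma> ''pair_end'' q"
      by (simp_all add: eq1)
    have K: "(\<Union>P\<in>output_cut \<sigma>1 ` {\<sigma> ''pair_begin'' p..<\<sigma> ''pair_end'' p}.
        joins k P (insert (output_cut \<sigma>1 (\<sigma>1 ''sing'' 0)) (output_cut \<sigma>1 ` {\<sigma> ''pair_begin'' q..<\<sigma> ''pair_end'' q}))) = K"
      unfolding K_def candidates_def eq1 sing using fam1[OF pq(1)] fam1[OF pq(2)] by (simp add: fam_def eq1)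
    show ?thesis
      using wp_Build[OF W(1,4) pool1 h(2) eq1(3) h(1) x(1,2) h(3,4) x(3,4) h(5,6)
         h(7)[unfolded N_def lp_def lq_def] h(8)[unfolded N_def lp_def lq_def] W(5) lR[unfolded lp_def lq_def]]
      unfolding K N_def lp_def lq_def frame_def .
  qed
  have Set: "wp W Setup (\<lambda>T \<tau>. T \<le> 100 \<and> \<tau> = \<sigma>1) \<sigma>"
    unfolding Setup_def
    apply (rule wp_Seq, rule wp_Assign_to[where f = "(\<sigma> ''p'')(0 := p)"])
    subgoal using W by simp
    subgoal using W pqW a nv t p by simp
    subgoal using a nv t p by simp
    apply (rule wp_Seq, rule wp_Assign_to[where f = "(\<sigma> ''q'')(0 := q)"])
    subgoal using W by simp
    subgoal using W pqW a nv t q by simp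
    subgoal using a nv t q by simp
    apply (rule wp_Seq, rule wp_Assign_to[where f = "(\<sigma> ''sing'')(0 := ?cf)"])
    subgoal using W by simp
    subgoal using W by simp
    subgoal by simp
    apply (rule wp_Seq, rule wp_Assign_to[where f = "(\<sigma> ''cut_begin'')(?cf := ?af)"])
    subgoal using W by simp
    subgoal using W by simp
    subgoal by simp
    apply (rule wp_Seq, rule wp_Assign_to[where f = "(\<sigma> ''cut_arcs'')(?af := a)"])
    subgoal using W by simp
    subgoal using W by simp
    subgoal using a by simp
    apply (rule wp_Seq, rule wp_Assign_to[where f = "(\<sigma> ''af'')(0 := Suc ?af)"])
    subgoal using W by simp
    subgoal using W S RR by simp
    subgoal by simp
    apply (rule wp_Seq, rule wp_Assign_to[where f = "(\<sigma> ''cut_end'')(?cf := Suc ?af)"])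
    subgoal using W by simp
    subgoal using W by simp
    subgoal by simp
    apply (rule wp_Seq, rule wp_Assign_to[where f = "(\<sigma> ''cf'')(0 := Suc ?cf)"])
    subgoal using W by simp
    subgoal using W S RR by simp
    subgoal by simp
    apply (rule wp_Assign_to[where f = "(\<sigma> ''kb'')(0 := Suc ?cf)"])
    subgoal using W by simp
    subgoal using W by simp
    subgoal by simp
    subgoal by (simp add: \<sigma>1_def)
    done
  have R5: "R ^ 3 \<le> R ^ 5" "1 \<le> R ^ 5" using W by (simp_all add: power_increasing)
  show ?thesis
    unfolding Step_def
    apply (rule wp_SeqI[OF Set])
    apply (erule conjE, hypsubst)
    apply (rule wp_SeqI[OF B])
    apply (elim conjE)
    apply (rule wp_Seq, rule wp_Assign)
      apply (use W in simp_all)[2]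
    subgoal premises P for T0 _ T1 \<sigma>2
    proof -
      have ad2: "adds m k \<sigma>1 \<sigma>2 K N" and f2: "frame (insert ''i'' (insert ''j'' U_vars)) \<sigma>1 \<sigma>2" by (fact P)+
      let ?b = "Suc ?cf" and ?e = "\<sigma>2 ''cf'' 0"
      define \<sigma>3 where "\<sigma>3 = \<sigma>2(''ke'' := (\<sigma>2 ''ke'')(0 := ?e))"
      have ad3: "adds m k \<sigma>1 \<sigma>3 K N" using ad2 by (simp add: \<sigma>3_def adds_upd)
      have x2: "\<sigma>2 ''t'' = \<sigma>1 ''t''" "\<sigma>2 ''kb'' = \<sigma>1 ''kb''" "\<sigma>2 ''p'' = \<sigma>1 ''p''"  by (rule frameD[OF f2]; simp)+
      have x3: "\<sigma>3 ''t'' = \<sigma>1 ''t''" "\<sigma>3 ''kb'' 0 = ?b" "\<sigma>3 ''p'' 0 = p" "\<sigma>3 ''ke'' 0 = ?e" "\<sigma>3 ''cf'' 0 = ?e"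
        using x2 eq1 by (simp_all add: \<sigma>3_def)
      have mk3: "\<sigma>3 ''mark'' = (\<lambda>_. 0)" and cf3: "?b \<le> ?e" "?e \<le> ?b + N" "\<sigma>3 ''af'' 0 \<le> Suc ?af + N * (2 * k + 2)" and pool3: "pool m k \<sigma>3"
        using ad3 eq1 x3 by (auto simp: adds_def ext_def)
      note env3 = adds_env[OF env1(1) ad3 x3(1)]
      have h: "?e \<le> \<sigma>3 ''cf'' 0" "?e - ?b \<le> R" "\<sigma>3 ''cf'' 0 + (?e - ?b) + k + 2 < W"
        unfolding x3 using cf3 NR S RR W(5) by linarith+
      have f3: "frame Step_vars \<sigma> \<sigma>3"
      proof -
        have "frame Step_vars \<sigma>1 \<sigma>2" by (rule frame_mono[OF f2]) auto
        then show ?thesis using frame_trans[OF f1] by (simp add: \<sigma>3_def frame_upd)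
      qed
      have imK: "output_cut \<sigma>3 ` {?b..<?e} = K" using ad3 x3 eq1 by (simp add: adds_def)
      define \<K> where "\<K> = output_cut \<sigma>3 ` {i \<in> {?b..<?e}. \<forall>j\<in>{?b..<?e}. \<not> dominated n \<sigma>3 i j}"
      have g: "good n \<sigma>3 C D = {b \<in> C. b \<in> D \<or> (\<exists>P\<in>fam \<sigma> (\<sigma> ''head'' b * n + t). P \<subseteq> D)}" if C: "C \<subseteq> {..<m}" for C D
      proof -
        have "good n \<sigma>3 C D = good n \<sigma> C D" using env3(2)[OF C] env1(2)[OF C] by simp
        then show ?thesis by (auto simp: good_def fam_def t)
      qed
      have dk: "\<K> = {M \<in> K. \<forall>N\<in>K. card N \<le> card (good n \<sigma>3 M N) \<longrightarrow> N = M}"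
        unfolding \<K>_def dominated_def
        using undominated_image[of "output_cut \<sigma>3" "good n \<sigma>3" ?b ?e] good_subset imK by simp
      have Km: "M \<subseteq> {..<m}" if MK: "M \<in> K" for M
      proof -
        obtain i where "i \<in> {?b..<?e}" "M = output_cut \<sigma>3 i" using MK[folded imK] by blast
        then show ?thesis using poolD[OF pool3, of i] x3 by (simp add: wfcut_def)
      qed
      have fin: "\<K> = {M \<in> K. \<forall>N\<in>K. card N \<le> card {b \<in> M. b \<in> N \<or> (\<exists>P\<in>fam \<sigma> (\<sigma> ''head'' b * n + t). P \<subseteq> N)} \<longrightarrow> N = M}"
        unfolding dk using g[OF Km] by (intro Collect_cong conj_cong refl) simp
      have pre: "val \<sigma>2 (Const 0) = 0" "val \<sigma>2 (V ''cf'') = ?e" by simp_all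
      have Sel: "wp W Select (\<lambda>T \<tau>. T \<le> 700 * R ^ 5 \<and> frame Select_vars \<sigma>3 \<tau> \<and>
         adds m k \<sigma>3 \<tau> \<K> (?e - ?b) \<and> inj_on (output_cut \<tau>) {?e..<\<tau> ''cf'' 0}) \<sigma>3"
        using wp_Select[OF env3(1) mk3 x3(2,4) cf3(1) h(1,2,3)] unfolding x3 \<K>_def .
      show ?thesis
        unfolding pre \<sigma>3_def[symmetric]
        apply (rule wp_SeqI[OF Sel])
        apply (elim conjE)
        subgoal premises Q for T3 \<sigma>4
        proof -
          have f4: "frame Select_vars \<sigma>3 \<sigma>4" and ad4: "adds m k \<sigma>3 \<sigma>4 \<K> (?e - ?b)"
            and inj: "inj_on (output_cut \<sigma>4) {?e..<\<sigma>4 ''cf'' 0}" by (fact Q)+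
          have x4: "\<sigma>4 ''p'' = \<sigma>3 ''p''" "\<sigma>4 ''ke'' = \<sigma>3 ''ke''" by (rule frameD[OF f4]; simp)+
          have v4: "\<sigma>4 ''p'' 0 = p" "\<sigma>4 ''ke'' 0 = ?e" using x4 x3 by simp_all
          have ad: "adds m k \<sigma> \<sigma>4 ({{a}} \<union> K \<union> \<K>) (1 + N + (?e - ?b))"
            by (rule adds_trans[OF adds_trans[OF ad1 ad3] ad4])
          have pe: "\<sigma>4 ''pair_begin'' = \<sigma> ''pair_begin''" "\<sigma>4 ''pair_end'' = \<sigma> ''pair_end''"
            using ad by (auto simp: adds_def)
          have c4: "?cf \<le> \<sigma>4 ''cf'' 0" "\<sigma>4 ''cf'' 0 \<le> ?cf + (1 + N + (?e - ?b))" "?e \<le> \<sigma>4 ''cf'' 0"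
            "\<sigma>4 ''af'' 0 \<le> ?af + (1 + N + (?e - ?b)) * (2 * k + 2)" "pool m k \<sigma>4" "\<sigma>4 ''mark'' = (\<lambda>_. 0)"
            using ad ad4 mark x3 by (auto simp: adds_def ext_def)
          have im4: "output_cut \<sigma>4 ` {?e..<\<sigma>4 ''cf'' 0} = \<K>" using ad4 x3 by (simp add: adds_def)
          define \<tau> where "\<tau> = \<sigma>4(''pair_begin'' := (\<sigma> ''pair_begin'')(p := ?e), ''pair_end'' := (\<sigma> ''pair_end'')(p := \<sigma>4 ''cf'' 0))"
          have oct: "output_cut \<tau> = output_cut \<sigma>4" by (simp add: fun_eq_iff output_cut_def \<tau>_def)
          have "frame Step_vars \<sigma>3 \<sigma>4" by (rule frame_mono[OF f4]) auto
          then have ft: "frame Step_vars \<sigma> \<tau>" using frame_trans[OF f3] by (simp add: \<tau>_def frame_upd)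
          have famp: "fam \<tau> p = \<K>" unfolding fam_def oct by (simp add: \<tau>_def im4)
          have cardp: "\<sigma>4 ''cf'' 0 - ?e = card \<K>" using card_image[OF inj] im4 by simp
          have famo: "fam \<tau> p' = fam \<sigma> p'" if "p' < n * n" "p' \<noteq> p" for p'
            using adds_fam[OF ad pool pp(2)[OF that(1)]] that(2) unfolding fam_def oct by (simp add: \<tau>_def pe)
          have poolt: "pool m k \<tau>" using c4(5) unfolding pool_def wfcut_def oct by (simp add: \<tau>_def)
          have cft: "\<tau> ''cf'' 0 \<le> ?cf + 6 * R ^ 2" "\<tau> ''af'' 0 \<le> ?af + 6 * R ^ 2"
          proof -
            have "\<sigma>4 ''cf'' 0 \<le> ?cf + (1 + N + N)" using c4 cf3 by linarith
            then show "\<tau> ''cf'' 0 \<le> ?cf + 6 * R ^ 2" using NR RR by (simp add: \<tau>_def)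
            have "(1 + N + (?e - ?b)) * (2 * k + 2) \<le> (3 * R) * (2 * R)"
              by (rule mult_le_mono) (use NR cf3 W in linarith)+
            also have "\<dots> = 6 * R ^ 2" by (simp add: power2_eq_square)
            finally show "\<tau> ''af'' 0 \<le> ?af + 6 * R ^ 2" using c4(4) by (simp add: \<tau>_def)
          qed
          show ?thesis
            apply (rule wp_Seq, rule wp_Assign)
              apply (use W in simp_all)[2]
            apply (rule wp_Assign)
              apply (use W in simp_all)[2]
            apply (simp add: v4 pe flip: \<tau>_def)
            using P(1,2) Q(1) R5 ft c4 poolt cft famo famp fin cardp
            by (simp add: \<tau>_def[THEN fun_cong]) 
        qed
        done
    qed
    done
qed

section \<open>The algorithm\<close>

context exit_digraph
begin

text \<open>The start of the computation: while no out-arc has been treated, the empty cut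
  suffices.\<close>

lemma latest_upto_empty:
  assumes "finite A" shows "latest_upto k A {} = {{}}"
proof -
  have "M = {}" if "best A {} M" for M using best_minimal[OF assms that, of "{}"] by simp
  moreover have "best A {} {}" using assms by (auto simp: best_def dest: finite_subset)
  ultimately show ?thesis by (auto simp: latest_upto_def)
qed

text \<open>P holds the treated arcs and is closed under successors, so for arcs in
  \<open>insert a P\<close> the families of their heads are final. By \<open>best_reach\<close> all
  candidates consist of such arcs, so the comparison consults final families only.\<close>

lemma latest_upto_step:
  assumes fin: "finite A" and P: "P \<subseteq> A" "a \<in> A" "X \<subseteq> P"
    and closed: "\<And>e f. e \<in> insert a P \<Longrightarrow> f \<in> A \<Longrightarrow> sc e f \<Longrightarrow> f \<in> P"
    and L: "\<And>b. b \<in> insert a P \<Longrightarrow> L b = (if ex b then {} else latest_upto k A (succs A b))"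
  defines "K \<equiv> {P \<union> Q |P Q. P \<in> latest_upto k A X \<and> Q \<in> insert {a} (L a) \<and> card (P \<union> Q) \<le> k}"
  shows "{M \<in> K. \<forall>N\<in>K. card N \<le> card {b \<in> M. b \<in> N \<or> (\<exists>P\<in>L b. P \<subseteq> N)} \<longrightarrow> N = M} = latest_upto k A (insert a X)"
proof (rule filter_latest[OF fin])
  note La = L[OF insertI1]
  show "latest_upto k A (insert a X) \<subseteq> K"
    unfolding K_def by (rule latest_upto_insert(1)[where L = L, OF fin P(2) La])
  show "M \<subseteq> A \<and> insert a X \<subseteq> cl A M \<and> card M \<le> k" if "M \<in> K" for M
    by (rule latest_upto_insert(2)[where L = L, OF fin P(2) La]) (use that K_def in simp)
  have sub: "Y \<subseteq> insert a P" if "Y \<in> latest_upto k A E" "E \<subseteq> P" for Y E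
    by (rule best_reach[OF fin, of E]) (use that closed in \<open>auto simp: latest_upto_def\<close>)
  have sa: "succs A a \<subseteq> P" using closed by (auto simp: succs_def)
  fix M b assume "M \<in> K" "b \<in> M"
  then obtain Y Z where "b \<in> Y \<union> Z" "Y \<in> latest_upto k A X" "Z \<in> insert {a} (L a)" unfolding K_def by blast
  moreover have "Z \<subseteq> insert a P" if "Z \<in> insert {a} (L a)" for Z
    using that sub[OF _ sa] L[of a] by (auto split: if_splits)
  ultimately have "b \<in> insert a P" using sub[OF _ P(3)] by blast
  then show "L b = (if ex b then {} else latest_upto k A (succs A b))" by (rule L)
qed

end

text \<open>The counterpart of \<open>loop_time\<close> for the outer loops over vertices and
  arcs.\<close>

lemma loop_time2:
  fixes M n b c d a x :: nat
  assumes "x \<le> M" "b \<le> c * n" "1 \<le> M" "1 \<le> n"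
  shows "a + x * (b + d) \<le> (a + c + d) * (M * n)"
proof -
  have Mn: "1 \<le> M * n" using assms by simp
  have "x * (b + d) \<le> M * (c * n + d * n)"
    by (rule mult_le_mono[OF assms(1) add_le_mono[OF assms(2)]]) (use assms(4) in simp)
  also have "\<dots> = (c + d) * (M * n)" by (simp add: algebra_simps)
  finally have "a + x * (b + d) \<le> a * (M * n) + (c + d) * (M * n)"
    by (rule add_le_mono[rotated]) (use Mn in simp)
  then show ?thesis by (simp add: algebra_simps)
qed

lemma pair_index_eq:
  fixes n s t :: nat assumes "t < n" "t' < n"
  shows "s * n + t = s' * n + t' \<longleftrightarrow> s = s' \<and> t = t'"
proof
  assume eq: "s * n + t = s' * n + t'"
  have "(s * n + t) div n = s" "(s * n + t) mod n = t" "(s' * n + t') div n = s'" "(s' * n + t') mod n = t'"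
    using assms by auto
  then show "s = s' \<and> t = t'" using eq by metis
qed simp

section \<open>Initial families\<close>

definition Init_Pair :: com where
  "Init_Pair = If (Plus (Minus (V ''s'') (V ''t'')) (Minus (V ''t'') (V ''s'')))
     (Assign ''pair_end'' (Plus (Times (V ''s'') (V ''n'')) (V ''t'')) (Const 1)) Skip"

text \<open>Memory starts at zero, so index 0 already denotes the empty cut, and the interval from 0
  to 1 is the family of the empty set of sources. For s = t the interval stays empty: no cut
  separates a vertex from itself.\<close>

definition Init :: com where
  "Init = For ''s'' (Const 0) (V ''n'') (For ''t'' (Const 0) (V ''n'') Init_Pair) ;; ''cf'' ::= Const 1"

lemma wp_Init:
  assumes W: "1 < W" "n * n \<le> W" "n < W" and n: "\<sigma> ''n'' 0 = n" "1 \<le> n" and z: "\<sigma> ''pair_end'' = (\<lambda>_. 0)"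
  shows "wp W Init (\<lambda>T \<tau>. T \<le> 200 * (n * n) \<and> frame {''s'', ''t'', ''pair_end'', ''cf''} \<sigma> \<tau> \<and> \<tau> ''cf'' 0 = 1 \<and>
     (\<forall>s<n. \<forall>t<n. \<tau> ''pair_end'' (s * n + t) = (if s = t then 0 else 1))) \<sigma>"
proof -
  let ?F = "{''s'', ''t'', ''pair_end'', ''cf''}"
  define I where "I s \<tau> \<longleftrightarrow> frame ?F \<sigma> \<tau> \<and> (\<forall>s'<n. \<forall>t'<n. \<tau> ''pair_end'' (s' * n + t') = (if s' < s \<and> s' \<noteq> t' then 1 else 0))" for s \<tau>
  define J where "J s t \<tau> \<longleftrightarrow> frame ?F \<sigma> \<tau> \<and> \<tau> ''s'' 0 = s \<and>
    (\<forall>s'<n. \<forall>t'<n. \<tau> ''pair_end'' (s' * n + t') = (if (s' < s \<or> s' = s \<and> t' < t) \<and> s' \<noteq> t' then 1 else 0))" for s t \<tau>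
  have fn: "\<tau> ''n'' = \<sigma> ''n''" if "frame ?F \<sigma> \<tau>" for \<tau> by (rule frameD[OF that]) simp
  have inner: "wp W (For ''t'' (Const 0) (V ''n'') Init_Pair) (\<lambda>T \<tau>'. T \<le> 60 * n \<and> J s n \<tau>') \<tau>"
    if s: "s < n" and I: "I s \<tau>" "\<tau> ''s'' 0 = s" for s \<tau>
  proof (rule wp_For[where I = "J s" and B = 30 and l = 0 and h = n, OF W(1)])
    show "J s 0 (\<tau>(''t'' := (\<tau> ''t'')(0 := 0)))" using I by (simp add: I_def J_def frame_upd)
  next
    fix t \<upsilon> assume "J s t \<upsilon>"
    then show "ok W \<upsilon> (V ''n'') \<and> val \<upsilon> (V ''n'') = n" using W n fn by (simp add: J_def)
  next
    fix t \<upsilon> assume t: "t < n" and J: "J s t \<upsilon>" "\<upsilon> ''t'' 0 = t"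
    have nv: "\<upsilon> ''n'' 0 = n" "\<upsilon> ''s'' 0 = s" using J fn n by (auto simp: J_def)
    have "s * n + t < n * n" by (rule pair_index[OF s t])
    then have idx: "s * n + t < W" "s * n < W" using W by linarith+
    show "wp W Init_Pair (\<lambda>T \<tau>'. T \<le> 30 \<and> \<tau>' ''t'' 0 = t \<and> J s (Suc t) (\<tau>'(''t'' := (\<tau>' ''t'')(0 := Suc t)))) \<upsilon>"
      unfolding Init_Pair_def
    proof (rule wp_If)
      show "ok W \<upsilon> (Plus (Minus (V ''s'') (V ''t'')) (Minus (V ''t'') (V ''s'')))"
        using W s t by (simp add: nv J(2))
    next
      assume "val \<upsilon> (Plus (Minus (V ''s'') (V ''t'')) (Minus (V ''t'') (V ''s''))) \<noteq> 0"
      then have st: "s \<noteq> t" by (auto simp: nv J(2))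
      show "wp W (Assign ''pair_end'' (Plus (Times (V ''s'') (V ''n'')) (V ''t'')) (Const 1))
         (\<lambda>T \<tau>'. 1 + cost (Plus (Minus (V ''s'') (V ''t'')) (Minus (V ''t'') (V ''s''))) + T \<le> 30 \<and> \<tau>' ''t'' 0 = t \<and>
           J s (Suc t) (\<tau>'(''t'' := (\<tau>' ''t'')(0 := Suc t)))) \<upsilon>"
        apply (rule wp_Assign_to[where f = "(\<upsilon> ''pair_end'')(s * n + t := 1)"])
        subgoal using W idx by (simp add: nv J(2))
        subgoal using W by simp
        subgoal by (simp add: nv J(2))
        subgoal using J st t by (auto simp: J_def frame_upd pair_index_eq less_Suc_eq)
        done
    next
      assume "val \<upsilon> (Plus (Minus (V ''s'') (V ''t'')) (Minus (V ''t'') (V ''s''))) = 0"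
      then have st: "s = t" by (auto simp: nv J(2))
      show "wp W Skip (\<lambda>T \<tau>'. 1 + cost (Plus (Minus (V ''s'') (V ''t'')) (Minus (V ''t'') (V ''s''))) + T \<le> 30 \<and> \<tau>' ''t'' 0 = t \<and>
           J s (Suc t) (\<tau>'(''t'' := (\<tau>' ''t'')(0 := Suc t)))) \<upsilon>"
        by (rule wp_Skip) (use J st t in \<open>auto simp: J_def frame_upd less_Suc_eq\<close>)
    qed
  next
    fix T \<upsilon> assume T: "T \<le> cost (Const 0) + cost (V ''n'') + 6 + (n - 0) * (30 + cost (V ''n'') + 10)" and J: "J s n \<upsilon>"
    then show "T \<le> 60 * n \<and> J s n \<upsilon>" using n by simp
  qed (use W in auto)
  show ?thesis
    unfolding Init_def
    apply (rule wp_SeqI[where Q' = "\<lambda>T \<tau>. T \<le> 100 * (n * n) \<and> I n \<tau>"])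
    subgoal
    proof (rule wp_For[where I = I and B = "60 * n" and l = 0 and h = n, OF W(1)])
      show "I 0 (\<sigma>(''s'' := (\<sigma> ''s'')(0 := 0)))" using z by (simp add: I_def frame_upd frame_refl)
    next
      fix s \<tau> assume "I s \<tau>"
      then show "ok W \<tau> (V ''n'') \<and> val \<tau> (V ''n'') = n" using W n fn by (simp add: I_def)
    next
      fix s \<tau> assume s: "s < n" and I: "I s \<tau>" "\<tau> ''s'' 0 = s"
      show "wp W (For ''t'' (Const 0) (V ''n'') Init_Pair)
        (\<lambda>T \<tau>'. T \<le> 60 * n \<and> \<tau>' ''s'' 0 = s \<and> I (Suc s) (\<tau>'(''s'' := (\<tau>' ''s'')(0 := Suc s)))) \<tau>"
        by (rule wp_mono[OF inner[OF s I]]) (auto simp: I_def J_def frame_upd less_Suc_eq)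
    next
      fix T \<tau> assume T: "T \<le> cost (Const 0) + cost (V ''n'') + 6 + (n - 0) * (60 * n + cost (V ''n'') + 10)" and I: "I n \<tau>"
      have "9 + n * (60 * n + 12) \<le> (9 + 60 + 12) * (n * n)" by (rule loop_time2) (use n in auto)
      moreover have "T \<le> 9 + n * (60 * n + 12)" using T n by (simp add: add.commute)
      ultimately have "T \<le> (9 + 60 + 12) * (n * n)" by (rule order_trans[rotated])
      also have "\<dots> \<le> 100 * (n * n)" by (rule mult_le_mono1) simp
      finally show "T \<le> 100 * (n * n) \<and> I n \<tau>" using I by simp
    qed (use W in auto)
    apply (erule conjE)
    apply (rule wp_Assign)
    subgoal using W by simp
    subgoal using W by simp
    subgoal for T \<tau>
    proof -
      assume T: "T \<le> 100 * (n * n)" and I: "I n \<tau>"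
      have "1 \<le> n * n" using n by simp
      then have "3 + T \<le> 200 * (n * n)" using T by linarith
      then show ?thesis using I by (simp add: I_def frame_upd)
    qed
    done
qed

section \<open>Reverse topological order of the arcs\<close>

definition Block :: com where
  "Block = If (Read ''done'' (V ''a'')) Skip
     (Assign ''blk'' (Read ''tail'' (V ''a'')) (Plus (V ''r'') (Const 1)))"

definition Emit :: com where
  "Emit = If (Read ''done'' (V ''a'')) Skip
     (If (Minus (Plus (V ''r'') (Const 1)) (Read ''blk'' (Read ''head'' (V ''a''))))
       (Assign ''ord'' (V ''cnt'') (V ''a'') ;;
        ''cnt'' ::= Plus (V ''cnt'') (Const 1) ;;
        Assign ''done'' (V ''a'') (Const 1))
       Skip)"

text \<open>A vertex is blocked in round r if an arc leaving it was pending when the round began;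
  arcs whose heads are not blocked are emitted. Stamping \<open>blk\<close> with r + 1 saves
  clearing it, and n rounds over all arcs fit the time bound without adjacency lists.\<close>

definition Order :: com where
  "Order = For ''r'' (Const 0) (V ''n'')
     (For ''a'' (Const 0) (V ''m'') Block ;; For ''a'' (Const 0) (V ''m'') Emit)"

definition emitted :: "nat \<Rightarrow> state \<Rightarrow> nat set" where
  "emitted m \<sigma> = {a. a < m \<and> \<sigma> ''done'' a \<noteq> 0}"

text \<open>A reverse topological enumeration of D. Since b ranges over all arcs below m, the set D
  is closed under successors.\<close>

definition listing :: "nat \<Rightarrow> (nat \<Rightarrow> nat) \<Rightarrow> (nat \<Rightarrow> nat) \<Rightarrow> nat set \<Rightarrow> nat \<Rightarrow> (nat \<Rightarrow> nat) \<Rightarrow> bool" where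
  "listing m src dst D c f \<longleftrightarrow> inj_on f {..<c} \<and> f ` {..<c} = D \<and>
     (\<forall>i<c. \<forall>b<m. src b = dst (f i) \<longrightarrow> (\<exists>i'<i. f i' = b))"

lemma listing_card: "listing m src dst D c f \<Longrightarrow> card D = c"
  by (auto simp: listing_def card_image)

lemma listing_snoc:
  assumes l: "listing m src dst D c f" and a: "a \<notin> D" and b: "\<And>b. b < m \<Longrightarrow> src b = dst a \<Longrightarrow> b \<in> D"
  shows "listing m src dst (insert a D) (Suc c) (f(c := a))"
proof -
  have im: "f(c := a) ` {..<c} = D" using l by (auto simp: listing_def)
  have inj: "inj_on (f(c := a)) {..<c}" using l by (auto simp: listing_def inj_on_def)
  have "inj_on (f(c := a)) {..<Suc c}" using inj im a by (simp add: lessThan_Suc)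
  moreover have "f(c := a) ` {..<Suc c} = insert a D" unfolding lessThan_Suc image_insert im by simp
  moreover have "\<exists>i'<i. (f(c := a)) i' = b'" if h: "i < Suc c" "b' < m" "src b' = dst ((f(c := a)) i)" for i b'
  proof (cases "i = c")
    case True
    then have "b' \<in> D" using h b by simp
    then have "b' \<in> f ` {..<c}" using l by (simp add: listing_def)
    then show ?thesis using True by auto
  next
    case False
    then have "i < c" "src b' = dst (f i)" using h by auto
    then obtain i' where "i' < i" "f i' = b'" using l h by (auto simp: listing_def)
    then show ?thesis using \<open>i < c\<close> by (intro exI[of _ i']) auto
  qed
  ultimately show ?thesis by (auto simp: listing_def)
qed

text \<open>By the hypothesis on sinks, the form in which acyclicity enters, some tail of a pending
  arc has no arc to another such tail. All its pending arcs are emitted in the round, so the set of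
  these tails loses a vertex each time and is empty after n rounds.\<close>

lemma wp_Order:
  assumes W: "1 < W" "m < W" "n < W" and nm: "\<sigma> ''n'' 0 = n" "\<sigma> ''m'' 0 = m" "1 \<le> n"
    and th: "\<And>a. a < m \<Longrightarrow> \<sigma> ''tail'' a = src a \<and> \<sigma> ''head'' a = dst a \<and> src a < n \<and> dst a < n"
    and z: "\<sigma> ''done'' = (\<lambda>_. 0)" "\<sigma> ''blk'' = (\<lambda>_. 0)" "\<sigma> ''cnt'' 0 = 0"
    and sink: "\<And>U. U \<subseteq> {..<n} \<Longrightarrow> U \<noteq> {} \<Longrightarrow> \<exists>v\<in>U. \<forall>a<m. src a = v \<longrightarrow> dst a \<notin> U"
    and M: "M = max m n"
  shows "wp W Order (\<lambda>T \<tau>. T \<le> 300 * (M * n) \<and> frame {''r'', ''a'', ''blk'', ''ord'', ''cnt'', ''done''} \<sigma> \<tau> \<and>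
     listing m src dst {..<m} m (\<tau> ''ord'')) \<sigma>"
proof -
  let ?F = "{''r'', ''a'', ''blk'', ''ord'', ''cnt'', ''done''}"
  have eq: "\<tau> ''n'' = \<sigma> ''n''" "\<tau> ''m'' = \<sigma> ''m''" "\<tau> ''tail'' = \<sigma> ''tail''" "\<tau> ''head'' = \<sigma> ''head''"
    if "frame ?F \<sigma> \<tau>" for \<tau> by (rule frameD[OF that]; simp)+
  define U where "U D = {src a |a. a < m \<and> a \<notin> D}" for D
  have Un: "U D \<subseteq> {..<n}" for D using th by (auto simp: U_def)
  have Uf: "finite (U D)" for D using Un finite_lessThan by (rule finite_subset)
  define S where "S \<tau> \<longleftrightarrow> frame ?F \<sigma> \<tau> \<and> listing m src dst (emitted m \<tau>) (\<tau> ''cnt'' 0) (\<tau> ''ord'')" for \<tau>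
  define I where "I r \<tau> \<longleftrightarrow> S \<tau> \<and> (\<forall>v. \<tau> ''blk'' v \<le> r) \<and> card (U (emitted m \<tau>)) \<le> n - r" for r \<tau>
  define J where "J r D j \<tau> \<longleftrightarrow> S \<tau> \<and> \<tau> ''r'' 0 = r \<and> emitted m \<tau> = D \<and> (\<forall>v. \<tau> ''blk'' v \<le> Suc r) \<and>
     (\<forall>v. \<tau> ''blk'' v = Suc r \<longleftrightarrow> v \<in> {src a |a. a < j \<and> a \<notin> D})" for r D j \<tau>
  \<comment> \<open>D is frozen at the start of the round: arcs emitted meanwhile do not unblock
    their tails.\<close>
  define K where "K r D j \<tau> \<longleftrightarrow> S \<tau> \<and> \<tau> ''r'' 0 = r \<and> D \<subseteq> emitted m \<tau> \<and> (\<forall>v. \<tau> ''blk'' v \<le> Suc r) \<and>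
     (\<forall>v. \<tau> ''blk'' v = Suc r \<longleftrightarrow> v \<in> U D) \<and> (\<forall>a<j. dst a \<notin> U D \<longrightarrow> a \<in> emitted m \<tau>)" for r D j \<tau>
  have M1: "m \<le> M" "n \<le> M" "1 \<le> M" using M nm by auto
  have em: "emitted m (\<tau>(x := f)) = emitted m \<tau>" if "x \<noteq> ''done''" for \<tau> x f
    using that by (simp add: emitted_def)
  have block: "wp W (For ''a'' (Const 0) (V ''m'') Block) (\<lambda>T \<tau>'. T \<le> 60 * M \<and> J r D m \<tau>') \<tau>"
    if r: "r < n" and I: "I r \<tau>" "\<tau> ''r'' 0 = r" "D = emitted m \<tau>" for r \<tau> D
  proof (rule wp_For[where I = "J r D" and B = 30 and l = 0 and h = m, OF W(1)])
    \<comment> \<open>Stamps of earlier rounds are at most r, so no vertex counts as blocked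
      yet.\<close>
    have "\<tau> ''blk'' v \<noteq> Suc r" "\<tau> ''blk'' v \<le> Suc r" for v using I(1) unfolding I_def by (metis Suc_n_not_le_n le_SucI)+
    then show "J r D 0 (\<tau>(''a'' := (\<tau> ''a'')(0 := 0)))" using I by (simp add: I_def J_def S_def frame_upd em)
  next
    fix a \<upsilon> assume "J r D a \<upsilon>"
    then show "ok W \<upsilon> (V ''m'') \<and> val \<upsilon> (V ''m'') = m" using W nm eq by (simp add: J_def S_def)
  next
    fix a \<upsilon> assume a: "a < m" and J: "J r D a \<upsilon>" "\<upsilon> ''a'' 0 = a"
    have f: "frame ?F \<sigma> \<upsilon>" and D: "emitted m \<upsilon> = D" and rv: "\<upsilon> ''r'' 0 = r" using J by (simp_all add: J_def S_def)
    have li: "listing m src dst D (\<upsilon> ''cnt'' 0) (\<upsilon> ''ord'')" using J by (auto simp: J_def S_def)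
    have da: "\<upsilon> ''done'' a = 0 \<longleftrightarrow> a \<notin> D" using D a by (auto simp: emitted_def)
    have ta: "\<upsilon> ''tail'' a = src a" using eq[OF f] th[OF a] by simp
    show "wp W Block (\<lambda>T \<tau>'. T \<le> 30 \<and> \<tau>' ''a'' 0 = a \<and> J r D (Suc a) (\<tau>'(''a'' := (\<tau>' ''a'')(0 := Suc a)))) \<upsilon>"
      unfolding Block_def
    proof (rule wp_If)
      show "ok W \<upsilon> (Read ''done'' (V ''a''))" using W by simp
    next
      assume "val \<upsilon> (Read ''done'' (V ''a'')) \<noteq> 0"
      then have "a \<in> D" using da J(2) by simp
      then have "{src a' |a'. a' < Suc a \<and> a' \<notin> D} = {src a' |a'. a' < a \<and> a' \<notin> D}" using less_Suc_eq by auto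
      then show "wp W Skip (\<lambda>T \<tau>'. 1 + cost (Read ''done'' (V ''a'')) + T \<le> 30 \<and> \<tau>' ''a'' 0 = a \<and>
          J r D (Suc a) (\<tau>'(''a'' := (\<tau>' ''a'')(0 := Suc a)))) \<upsilon>"
        using J li by (intro wp_Skip) (simp add: J_def S_def frame_upd em)
    next
      assume "val \<upsilon> (Read ''done'' (V ''a'')) = 0"
      then have "a \<notin> D" using da J(2) by simp
      then have "{src a' |a'. a' < Suc a \<and> a' \<notin> D} = insert (src a) {src a' |a'. a' < a \<and> a' \<notin> D}" using less_Suc_eq by auto
      then show "wp W (Assign ''blk'' (Read ''tail'' (V ''a'')) (Plus (V ''r'') (Const 1)))
          (\<lambda>T \<tau>'. 1 + cost (Read ''done'' (V ''a'')) + T \<le> 30 \<and> \<tau>' ''a'' 0 = a \<and>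
          J r D (Suc a) (\<tau>'(''a'' := (\<tau>' ''a'')(0 := Suc a)))) \<upsilon>"
        using J li W r by (intro wp_Assign_to[where f = "(\<upsilon> ''blk'')(src a := Suc r)"])
          (simp_all add: J_def S_def frame_upd em ta)
    qed
  next
    fix T \<upsilon> assume T: "T \<le> cost (Const 0) + cost (V ''m'') + 6 + (m - 0) * (30 + cost (V ''m'') + 10)" and J: "J r D m \<upsilon>"
    then show "T \<le> 60 * M \<and> J r D m \<upsilon>" using M1 by simp
  qed (use W in auto)
  have emit: "wp W (For ''a'' (Const 0) (V ''m'') Emit) (\<lambda>T \<tau>'. T \<le> 90 * M \<and> K r D m \<tau>') \<tau>"
    if r: "r < n" and J: "J r D m \<tau>" for r \<tau> D
  proof (rule wp_For[where I = "K r D" and B = 60 and l = 0 and h = m, OF W(1)])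
    have li: "listing m src dst D (\<tau> ''cnt'' 0) (\<tau> ''ord'')" using J by (auto simp: J_def S_def)
    show "K r D 0 (\<tau>(''a'' := (\<tau> ''a'')(0 := 0)))" using J li by (simp add: J_def K_def S_def U_def frame_upd em)
  next
    fix a \<upsilon> assume "K r D a \<upsilon>"
    then show "ok W \<upsilon> (V ''m'') \<and> val \<upsilon> (V ''m'') = m" using W nm eq by (simp add: K_def S_def)
  next
    fix a \<upsilon> assume a: "a < m" and K: "K r D a \<upsilon>" "\<upsilon> ''a'' 0 = a"
    have f: "frame ?F \<sigma> \<upsilon>" and D: "D \<subseteq> emitted m \<upsilon>" and rv: "\<upsilon> ''r'' 0 = r"
      and li: "listing m src dst (emitted m \<upsilon>) (\<upsilon> ''cnt'' 0) (\<upsilon> ''ord'')"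
      and bl: "\<upsilon> ''blk'' v \<le> Suc r" "\<upsilon> ''blk'' v = Suc r \<longleftrightarrow> v \<in> U D" for v using K by (simp_all add: K_def S_def)
    have da: "\<upsilon> ''done'' a = 0 \<longleftrightarrow> a \<notin> emitted m \<upsilon>" using a by (auto simp: emitted_def)
    have ha: "\<upsilon> ''head'' a = dst a" using eq[OF f] th[OF a] by simp
    have skip: "wp W Skip (\<lambda>T \<tau>'. c + T \<le> 60 \<and> \<tau>' ''a'' 0 = a \<and> K r D (Suc a) (\<tau>'(''a'' := (\<tau>' ''a'')(0 := Suc a)))) \<upsilon>"
      if "c \<le> 59" "dst a \<notin> U D \<Longrightarrow> a \<in> emitted m \<upsilon>" for c
      using K that by (intro wp_Skip) (auto simp: K_def S_def frame_upd em less_Suc_eq)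
    show "wp W Emit (\<lambda>T \<tau>'. T \<le> 60 \<and> \<tau>' ''a'' 0 = a \<and> K r D (Suc a) (\<tau>'(''a'' := (\<tau>' ''a'')(0 := Suc a)))) \<upsilon>"
      unfolding Emit_def
    proof (rule wp_If)
      show "ok W \<upsilon> (Read ''done'' (V ''a''))" using W by simp
    next
      assume "val \<upsilon> (Read ''done'' (V ''a'')) \<noteq> 0"
      then have "a \<in> emitted m \<upsilon>" using da K(2) by simp
      then show "wp W Skip (\<lambda>T \<tau>'. 1 + cost (Read ''done'' (V ''a'')) + T \<le> 60 \<and> \<tau>' ''a'' 0 = a \<and>
          K r D (Suc a) (\<tau>'(''a'' := (\<tau>' ''a'')(0 := Suc a)))) \<upsilon>"
        by (intro skip) simp_all
    next
      assume "val \<upsilon> (Read ''done'' (V ''a'')) = 0"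
      then have na: "a \<notin> emitted m \<upsilon>" using da K(2) by simp
      show "wp W (If (Minus (Plus (V ''r'') (Const 1)) (Read ''blk'' (Read ''head'' (V ''a''))))
       (Assign ''ord'' (V ''cnt'') (V ''a'') ;;
        ''cnt'' ::= Plus (V ''cnt'') (Const 1) ;;
        Assign ''done'' (V ''a'') (Const 1))
       Skip) (\<lambda>T \<tau>'. 1 + cost (Read ''done'' (V ''a'')) + T \<le> 60 \<and> \<tau>' ''a'' 0 = a \<and>
          K r D (Suc a) (\<tau>'(''a'' := (\<tau>' ''a'')(0 := Suc a)))) \<upsilon>"
      proof (rule wp_If)
        show "ok W \<upsilon> (Minus (Plus (V ''r'') (Const 1)) (Read ''blk'' (Read ''head'' (V ''a''))))"
          using W r by (simp add: rv)
      next
        assume "val \<upsilon> (Minus (Plus (V ''r'') (Const 1)) (Read ''blk'' (Read ''head'' (V ''a'')))) = 0"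
        then have "dst a \<in> U D" using bl[of "dst a"] by (simp add: rv K(2) ha)
        then show "wp W Skip (\<lambda>T \<tau>'. 1 + cost (Read ''done'' (V ''a'')) +
           (1 + cost (Minus (Plus (V ''r'') (Const 1)) (Read ''blk'' (Read ''head'' (V ''a'')))) + T) \<le> 60 \<and> \<tau>' ''a'' 0 = a \<and>
          K r D (Suc a) (\<tau>'(''a'' := (\<tau>' ''a'')(0 := Suc a)))) \<upsilon>"
          using skip[of 20] na by (auto elim!: wp_mono)
      next
        assume "val \<upsilon> (Minus (Plus (V ''r'') (Const 1)) (Read ''blk'' (Read ''head'' (V ''a'')))) \<noteq> 0"
        then have hU: "dst a \<notin> U D" using bl[of "dst a"] by (auto simp: rv K(2) ha)
        have "b \<in> emitted m \<upsilon>" if "b < m" "src b = dst a" for b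
          using hU that D by (auto simp: U_def)
        then have li': "listing m src dst (insert a (emitted m \<upsilon>)) (Suc (\<upsilon> ''cnt'' 0)) ((\<upsilon> ''ord'')(\<upsilon> ''cnt'' 0 := a))"
          by (rule listing_snoc[OF li na])
        have "insert a (emitted m \<upsilon>) \<subseteq> {..<m}" using a by (auto simp: emitted_def)
        then have "card (insert a (emitted m \<upsilon>)) \<le> m" using card_mono[of "{..<m}"] by fastforce
        then have cW: "Suc (\<upsilon> ''cnt'' 0) < W" using listing_card[OF li'] W by simp
        define \<tau>1 where "\<tau>1 = \<upsilon>(''ord'' := (\<upsilon> ''ord'')(\<upsilon> ''cnt'' 0 := a), ''cnt'' := (\<upsilon> ''cnt'')(0 := Suc (\<upsilon> ''cnt'' 0)),
            ''done'' := (\<upsilon> ''done'')(a := 1))"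
        have e1: "emitted m \<tau>1 = insert a (emitted m \<upsilon>)" using a by (auto simp: emitted_def \<tau>1_def)
        have "S \<tau>1" unfolding S_def e1 using f li' by (simp add: \<tau>1_def frame_upd)
        then have K1: "K r D (Suc a) (\<tau>1(''a'' := (\<tau>1 ''a'')(0 := Suc a)))"
          using K D unfolding K_def S_def by (auto simp: em e1 frame_upd less_Suc_eq) (auto simp: \<tau>1_def)
        show "wp W (Assign ''ord'' (V ''cnt'') (V ''a'') ;;
            ''cnt'' ::= Plus (V ''cnt'') (Const 1) ;;
            Assign ''done'' (V ''a'') (Const 1)) (\<lambda>T \<tau>'. 1 + cost (Read ''done'' (V ''a'')) +
           (1 + cost (Minus (Plus (V ''r'') (Const 1)) (Read ''blk'' (Read ''head'' (V ''a'')))) + T) \<le> 60 \<and> \<tau>' ''a'' 0 = a \<and>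
          K r D (Suc a) (\<tau>'(''a'' := (\<tau>' ''a'')(0 := Suc a)))) \<upsilon>"
          apply (rule wp_Seq, rule wp_Assign_to[where f = "(\<upsilon> ''ord'')(\<upsilon> ''cnt'' 0 := a)"])
          subgoal using W by simp
          subgoal using W by simp
          subgoal using K by simp
          apply (rule wp_Seq, rule wp_Assign_to[where f = "(\<upsilon> ''cnt'')(0 := Suc (\<upsilon> ''cnt'' 0))"])
          subgoal using W by simp
          subgoal using W cW by simp
          subgoal by simp
          apply (rule wp_Assign_to[where f = "(\<upsilon> ''done'')(a := 1)"])
          subgoal using W by simp
          subgoal using W by simp
          subgoal using K by simp
          subgoal using K1 K(2) unfolding \<tau>1_def[symmetric] by (simp add: \<tau>1_def)
          done
      qed
    qed
  next
    fix T \<upsilon> assume T: "T \<le> cost (Const 0) + cost (V ''m'') + 6 + (m - 0) * (60 + cost (V ''m'') + 10)" and K: "K r D m \<upsilon>"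
    then show "T \<le> 90 * M \<and> K r D m \<upsilon>" using M1 by simp
  qed (use W in auto)
  show ?thesis
    unfolding Order_def
  proof (rule wp_For[where I = I and B = "150 * M" and l = 0 and h = n, OF W(1)])
    have "card (U (emitted m \<sigma>)) \<le> card {..<n}" by (rule card_mono[OF finite_lessThan Un])
    then show "I 0 (\<sigma>(''r'' := (\<sigma> ''r'')(0 := 0)))"
      using z by (simp add: I_def S_def frame_upd frame_refl em listing_def) (simp add: emitted_def)
  next
    fix r \<tau> assume "I r \<tau>"
    then show "ok W \<tau> (V ''n'') \<and> val \<tau> (V ''n'') = n" using W nm eq by (simp add: I_def S_def)
  next
    fix r \<tau> assume r: "r < n" and I: "I r \<tau>" "\<tau> ''r'' 0 = r"
    let ?D = "emitted m \<tau>"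
    show "wp W (For ''a'' (Const 0) (V ''m'') Block ;; For ''a'' (Const 0) (V ''m'') Emit)
      (\<lambda>T \<tau>'. T \<le> 150 * M \<and> \<tau>' ''r'' 0 = r \<and> I (Suc r) (\<tau>'(''r'' := (\<tau>' ''r'')(0 := Suc r)))) \<tau>"
      apply (rule wp_SeqI[OF block[OF r I refl]])
      apply (erule conjE)
      apply (rule wp_mono[OF emit[OF r]])
       apply assumption
      apply (elim conjE)
      subgoal premises P for T \<tau>1 T' \<tau>2
      proof -
        have K: "K r ?D m \<tau>2" by (fact P)
        have DE: "?D \<subseteq> emitted m \<tau>2" using K by (simp add: K_def)
        have sub: "U (emitted m \<tau>2) \<subseteq> U ?D" using DE by (auto simp: U_def)
        have "card (U (emitted m \<tau>2)) \<le> n - Suc r"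
        proof (cases "U ?D = {}")
          case True
          then show ?thesis using sub by simp
        next
          case False
          then obtain v where v: "v \<in> U ?D" "\<forall>a<m. src a = v \<longrightarrow> dst a \<notin> U ?D" using sink[OF Un] by blast
          have "v \<notin> U (emitted m \<tau>2)" using v(2) K by (auto simp: U_def[of "emitted m \<tau>2"] K_def)
          then have "U (emitted m \<tau>2) \<subset> U ?D" using sub v(1) by blast
          then have "card (U (emitted m \<tau>2)) < card (U ?D)" by (rule psubset_card_mono[OF Uf])
          moreover have "card (U ?D) \<le> n - r" using I(1) by (simp add: I_def)
          ultimately show ?thesis by linarith
        qed
        then have "I (Suc r) (\<tau>2(''r'' := (\<tau>2 ''r'')(0 := Suc r)))"
          using K by (simp add: I_def K_def S_def frame_upd em)
        then show ?thesis using P(1,3) K by (simp add: K_def)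
      qed
      done
  next
    fix T \<tau> assume T: "T \<le> cost (Const 0) + cost (V ''n'') + 6 + (n - 0) * (150 * M + cost (V ''n'') + 10)" and I: "I n \<tau>"
    have "9 + n * (150 * M + 12) \<le> (9 + 150 + 12) * (n * M)" by (rule loop_time2) (use nm M1 in auto)
    moreover have "T \<le> 9 + n * (150 * M + 12)" using T nm by (simp add: add.commute)
    ultimately have "T \<le> (9 + 150 + 12) * (n * M)" by (rule order_trans[rotated])
    also have "\<dots> \<le> 300 * (M * n)" by (simp add: mult.commute[of n M])
    finally have T': "T \<le> 300 * (M * n)" .
    have "card (U (emitted m \<tau>)) = 0" using I by (simp add: I_def)
    then have "U (emitted m \<tau>) = {}" using Uf by simp
    then have E: "emitted m \<tau> = {..<m}" by (auto simp: U_def emitted_def)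
    have li: "listing m src dst {..<m} (\<tau> ''cnt'' 0) (\<tau> ''ord'')" using I unfolding I_def S_def E by simp
    then have "\<tau> ''cnt'' 0 = m" using listing_card[OF li] by simp
    then show "T \<le> 300 * (M * n) \<and> frame ?F \<sigma> \<tau> \<and> listing m src dst {..<m} m (\<tau> ''ord'')"
      using T' li I by (simp add: I_def S_def)
  qed (use W in auto)
qed

section \<open>The main loop and its invariant\<close>

definition List_Cuts :: com where
  "List_Cuts = For ''idx'' (Const 0) (V ''m'')
     (''a'' ::= Read ''ord'' (V ''idx'') ;; For ''t'' (Const 0) (V ''n'') Step)"

definition All_Cuts :: com where
  "All_Cuts = Init ;; Order ;; List_Cuts"

locale dag_input =
  fixes G :: "(nat, nat) pre_digraph" and n m :: nat
  assumes wf: "wf_digraph G" and verts: "verts G = {..<n}" and arcs: "arcs G = {..<m}"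
    and pos: "0 < n" and acyc: "acyclic (arcs_ends G)"
begin

lemma cut_digraph: "t < n \<Longrightarrow> cut_digraph G t"
  by (rule cut_digraph.intro) (simp_all add: wf arcs verts)

lemma ends: "a < m \<Longrightarrow> tail G a < n \<and> head G a < n"
  using wf_digraph.tail_in_verts[OF wf] wf_digraph.head_in_verts[OF wf] arcs verts by auto

definition latest :: "nat \<Rightarrow> nat \<Rightarrow> nat set \<Rightarrow> nat set set" where
  "latest k t E = exit_digraph.latest_upto (\<lambda>e f. head G e = tail G f) (\<lambda>e. head G e = t) k {..<m} E"

lemma latest_empty: "latest k t {} = {{}}"
  unfolding latest_def by (rule exit_digraph.latest_upto_empty) simp

lemma card_latest: "E \<subseteq> {..<m} \<Longrightarrow> card (latest k t E) \<le> 4 ^ k"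
  unfolding latest_def by (rule exit_digraph.card_latest_upto) simp_all

lemma latest_out:
  assumes "s < n" "t < n"
  shows "{M. st_latest G s t M \<and> minimal_st_cut G s t M \<and> card M \<le> k} =
    (if s = t then {} else latest k t {e \<in> {..<m}. tail G e = s})"
proof -
  interpret cut_digraph G t by (rule cut_digraph[OF assms(2)])
  have "{M. st_latest G s t M \<and> minimal_st_cut G s t M \<and> card M \<le> k} =
    {M. (s \<noteq> t \<and> best (arcs G) {e \<in> arcs G. tail G e = s} M) \<and> card M \<le> k}"
    using latest_iff_best[of s] assms verts by auto
  then show ?thesis by (auto simp: latest_def latest_upto_def arcs)
qed

text \<open>The converse of a finite acyclic relation is well-founded, and a minimal element of U
  for the converse has no arc into U.\<close>

lemma sink:
  assumes "U \<subseteq> {..<n}" "U \<noteq> {}"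
  shows "\<exists>v\<in>U. \<forall>a<m. tail G a = v \<longrightarrow> head G a \<notin> U"
proof -
  have "finite (arcs_ends G)" by (simp add: arcs_ends_def arcs)
  then have "wf ((arcs_ends G)\<inverse>)" using acyc by (rule finite_acyclic_wf_converse)
  then obtain v where "v \<in> U" "\<And>w. (w, v) \<in> (arcs_ends G)\<inverse> \<Longrightarrow> w \<notin> U"
    using assms(2) wfE_min' by metis
  then show ?thesis by (force simp: arcs_ends_def arc_to_ends_def arcs)
qed

text \<open>The family kept empty for the target serves two purposes: arcs leaving t produce no
  candidates, and for arcs entering t it is the empty \<open>L\<close> that
  \<open>latest_upto_step\<close> demands for exits.\<close>

lemma latest_step:
  assumes t: "t < n" and a: "a < m" and P: "P \<subseteq> {..<m}"
    and closed: "\<And>b f. b \<in> insert a P \<Longrightarrow> f < m \<Longrightarrow> tail G f = head G b \<Longrightarrow> f \<in> P"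
    and F: "\<And>s. s < n \<Longrightarrow> F s = (if s = t then {} else latest k t {e \<in> P. tail G e = s})"
  defines "K \<equiv> \<Union>Y\<in>F (tail G a). joins k Y (insert {a} (F (head G a)))"
  shows "{M \<in> K. \<forall>N\<in>K. card N \<le> card {b \<in> M. b \<in> N \<or> (\<exists>Y\<in>F (head G b). Y \<subseteq> N)} \<longrightarrow> N = M} =
    (if tail G a = t then {} else latest k t {e \<in> insert a P. tail G e = tail G a})"
proof (cases "tail G a = t")
  case True
  then have "K = {}" using F[of "tail G a"] ends[OF a] by (simp add: K_def)
  then show ?thesis using True by simp
next
  case False
  interpret exit_digraph "\<lambda>e f. head G e = tail G f" "\<lambda>e. head G e = t" .
  let ?X = "{e \<in> P. tail G e = tail G a}" and ?L = "\<lambda>b. F (head G b)"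
  have L: "?L b = (if head G b = t then {} else latest_upto k {..<m} (succs {..<m} b))" if "b \<in> insert a P" for b
  proof -
    have "{e \<in> P. tail G e = head G b} = succs {..<m} b" using closed[OF that] P by (auto simp: succs_def)
    moreover have "b < m" using that a P by auto
    ultimately show ?thesis using F[of "head G b"] ends[of b] by (simp add: latest_def)
  qed
  have K: "K = {Y \<union> Q |Y Q. Y \<in> latest_upto k {..<m} ?X \<and> Q \<in> insert {a} (?L a) \<and> card (Y \<union> Q) \<le> k}"
  proof -
    have eq: "(\<Union>Y\<in>S. joins k Y T) = {Y \<union> Q |Y Q. Y \<in> S \<and> Q \<in> T \<and> card (Y \<union> Q) \<le> k}" for S T
      unfolding joins_def by blast
    have "F (tail G a) = latest_upto k {..<m} ?X" using F[of "tail G a"] ends[OF a] False by (simp add: latest_def)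
    then show ?thesis unfolding K_def eq by simp
  qed
  have X: "insert a ?X = {e \<in> insert a P. tail G e = tail G a}" by auto
  have "{M \<in> K. \<forall>N\<in>K. card N \<le> card {b \<in> M. b \<in> N \<or> (\<exists>Y\<in>?L b. Y \<subseteq> N)} \<longrightarrow> N = M} =
      latest_upto k {..<m} (insert a ?X)"
    unfolding K
  proof (rule latest_upto_step[where L = ?L, OF finite_lessThan P])
    show "a \<in> {..<m}" using a by simp
    show "f \<in> P" if "b \<in> insert a P" "f \<in> {..<m}" "head G b = tail G f" for b f
      by (rule closed[OF that(1)]) (use that in simp_all)
  qed (use L in blast)+
  then show ?thesis unfolding X using False by (simp add: latest_def)
qed

definition computed :: "nat \<Rightarrow> (nat \<Rightarrow> nat set) \<Rightarrow> state \<Rightarrow> bool" where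
  "computed k P \<sigma> \<longleftrightarrow> (\<forall>s<n. \<forall>t<n. fam \<sigma> (s * n + t) = (if s = t then {} else latest k t {e \<in> P t. tail G e = s}))"

abbreviation "List_vars \<equiv> {''inn'', ''fd'', ''q'', ''l'', ''ok'', ''y'', ''gd'', ''x'', ''mark'', ''keep'', ''j'',
  ''cut_begin'', ''cut_end'', ''cf'', ''i'', ''p'', ''sing'', ''cut_arcs'', ''af'', ''kb'', ''ke'', ''pair_begin'', ''pair_end'',
  ''a'', ''t'', ''idx''}"

text \<open>c counts the updates made so far, each of which uses at most 6 * R^2 indices and cells.
  P maps a target to the arcs treated for it.\<close>

definition inv :: "nat \<Rightarrow> nat \<Rightarrow> state \<Rightarrow> nat \<Rightarrow> (nat \<Rightarrow> nat set) \<Rightarrow> state \<Rightarrow> bool" where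
  "inv k R \<sigma> c P \<tau> \<longleftrightarrow> frame List_vars \<sigma> \<tau> \<and> \<tau> ''mark'' = (\<lambda>_. 0) \<and> pool m k \<tau> \<and>
     \<tau> ''cf'' 0 \<le> 1 + c * (6 * R ^ 2) \<and> \<tau> ''af'' 0 \<le> c * (6 * R ^ 2) \<and>
     (\<forall>p<n * n. \<tau> ''pair_begin'' p \<le> \<tau> ''pair_end'' p \<and> \<tau> ''pair_end'' p \<le> \<tau> ''cf'' 0 \<and>
        \<tau> ''pair_end'' p - \<tau> ''pair_begin'' p = card (fam \<tau> p)) \<and>
     computed k P \<tau>"

lemma inv_upd:
  assumes "x \<in> {''a'', ''t'', ''idx''}"
  shows "inv k R \<sigma> c P (\<tau>(x := v)) = inv k R \<sigma> c P \<tau>"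
proof -
  have *: "(\<tau>(x := v)) y = \<tau> y" if "y \<notin> {''a'', ''t'', ''idx''}" for y
    using assms that by (metis fun_upd_other)
  have fr: "frame List_vars \<sigma> (\<tau>(x := v)) = frame List_vars \<sigma> \<tau>"
  proof (rule frame_upd)
    have "{''a'', ''t'', ''idx''} \<subseteq> List_vars" by simp
    then show "x \<in> List_vars" using assms by (rule subsetD)
  qed
  show ?thesis
    unfolding inv_def computed_def fam_def pool_def wfcut_def output_cut_def fr
    by (simp add: * del: fun_upd_apply)
qed

lemma wp_List_Cuts:
  assumes W: "1 < W" "n * n \<le> W" "k + 2 < W" "m < W" "n < W" "1 + m * n * (6 * R ^ 2) < W"
    and R: "k + 2 \<le> R" "4 ^ k * Suc (4 ^ k) \<le> R"
    and nmk: "\<sigma> ''n'' 0 = n" "\<sigma> ''m'' 0 = m" "\<sigma> ''k'' 0 = k"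
    and th: "\<And>a. a < m \<Longrightarrow> \<sigma> ''tail'' a = tail G a \<and> \<sigma> ''head'' a = head G a"
    and li: "listing m (tail G) (head G) {..<m} m (\<sigma> ''ord'')"
    and init: "inv k R \<sigma> 0 (\<lambda>_. {}) \<sigma>"
    and M: "M = max m n"
  shows "wp W List_Cuts (\<lambda>T \<tau>. T \<le> 4000 * R ^ 5 * (M * n) \<and> computed k (\<lambda>_. {..<m}) \<tau>) \<sigma>"
proof -
  let ?f = "\<sigma> ''ord''"
  \<comment> \<open>The first j arcs are treated for all targets, the arc at position j only for the
    targets below x.\<close>
  define P where "P j x t = ?f ` {..<j} \<union> (if t < x then {?f j} else {})" for j x t :: nat
  have R1: "1 \<le> R" using R by simp
  have fm: "?f ` {..<m} = {..<m}" using li by (simp add: listing_def)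
  have Pm: "P j x t \<subseteq> {..<m}" if "j < m" for j x t
    using that fm by (auto simp: P_def)
  have eq: "\<tau> ''n'' = \<sigma> ''n''" "\<tau> ''m'' = \<sigma> ''m''" "\<tau> ''k'' = \<sigma> ''k''" "\<tau> ''tail'' = \<sigma> ''tail''" "\<tau> ''head'' = \<sigma> ''head''"
    "\<tau> ''ord'' = \<sigma> ''ord''" if "frame List_vars \<sigma> \<tau>" for \<tau> by (rule frameD[OF that]; simp)+
  have pairs: "wp W (For ''t'' (Const 0) (V ''n'') Step)
      (\<lambda>T \<tau>'. T \<le> 2100 * R ^ 5 * n \<and> \<tau>' ''idx'' 0 = j \<and> inv k R \<sigma> (j * n + n) (P j n) \<tau>') \<tau>"
    if j: "j < m" and I: "inv k R \<sigma> (j * n) (P j 0) \<tau>" and v: "\<tau> ''a'' 0 = ?f j" "\<tau> ''idx'' 0 = j" for j \<tau>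
  proof (rule wp_For[where I = "\<lambda>x \<tau>. inv k R \<sigma> (j * n + x) (P j x) \<tau> \<and> \<tau> ''a'' 0 = ?f j \<and> \<tau> ''idx'' 0 = j"
        and B = "2000 * R ^ 5" and l = 0 and h = n, OF W(1)])
    show "inv k R \<sigma> (j * n + 0) (P j 0) (\<tau>(''t'' := (\<tau> ''t'')(0 := 0))) \<and>
       (\<tau>(''t'' := (\<tau> ''t'')(0 := 0))) ''a'' 0 = ?f j \<and> (\<tau>(''t'' := (\<tau> ''t'')(0 := 0))) ''idx'' 0 = j"
      using I v by (simp add: inv_upd)
  next
    fix x \<upsilon> assume "inv k R \<sigma> (j * n + x) (P j x) \<upsilon> \<and> \<upsilon> ''a'' 0 = ?f j \<and> \<upsilon> ''idx'' 0 = j"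
    then show "ok W \<upsilon> (V ''n'') \<and> val \<upsilon> (V ''n'') = n" using W nmk eq by (simp add: inv_def)
  next
    fix T \<upsilon> assume T: "T \<le> cost (Const 0) + cost (V ''n'') + 6 + (n - 0) * (2000 * R ^ 5 + cost (V ''n'') + 10)"
      and I: "inv k R \<sigma> (j * n + n) (P j n) \<upsilon> \<and> \<upsilon> ''a'' 0 = ?f j \<and> \<upsilon> ''idx'' 0 = j"
    have R5: "1 \<le> R ^ 5" using R1 by simp
    have "9 + n * (2000 * R ^ 5 + 12) \<le> (9 + 2000 + 12) * (n * R ^ 5)"
      by (rule loop_time2) (use pos R5 in auto)
    moreover have "T \<le> 9 + n * (2000 * R ^ 5 + 12)" using T by (simp add: add.commute)
    ultimately have "T \<le> (9 + 2000 + 12) * (n * R ^ 5)" by (rule order_trans[rotated])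
    also have "\<dots> \<le> 2100 * R ^ 5 * n" by (simp add: mult.commute)
    finally show "T \<le> 2100 * R ^ 5 * n \<and> \<upsilon> ''idx'' 0 = j \<and> inv k R \<sigma> (j * n + n) (P j n) \<upsilon>" using I by blast
  next
    fix x \<upsilon> assume x: "x < n" and I: "inv k R \<sigma> (j * n + x) (P j x) \<upsilon> \<and> \<upsilon> ''a'' 0 = ?f j \<and> \<upsilon> ''idx'' 0 = j"
      and tx: "\<upsilon> ''t'' 0 = x"
    let ?a = "?f j"
    have am: "?a < m" using j fm by auto
    have fr: "frame List_vars \<sigma> \<upsilon>" and mk: "\<upsilon> ''mark'' = (\<lambda>_. 0)" and pool: "pool m k \<upsilon>"
      and cf: "\<upsilon> ''cf'' 0 \<le> 1 + (j * n + x) * (6 * R ^ 2)" and af: "\<upsilon> ''af'' 0 \<le> (j * n + x) * (6 * R ^ 2)"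
      and pr: "\<And>p. p < n * n \<Longrightarrow> \<upsilon> ''pair_begin'' p \<le> \<upsilon> ''pair_end'' p \<and> \<upsilon> ''pair_end'' p \<le> \<upsilon> ''cf'' 0 \<and>
          \<upsilon> ''pair_end'' p - \<upsilon> ''pair_begin'' p = card (fam \<upsilon> p)"
      and cp: "\<And>s t. s < n \<Longrightarrow> t < n \<Longrightarrow> fam \<upsilon> (s * n + t) = (if s = t then {} else latest k t {e \<in> P j x t. tail G e = s})"
      using I by (simp_all add: inv_def computed_def)
    have c4: "card (fam \<upsilon> (s * n + t)) \<le> 4 ^ k" if "s < n" "t < n" for s t
    proof -
      have "{e \<in> P j x t. tail G e = s} \<subseteq> {..<m}" using Pm[OF j] by blast
      then show ?thesis using cp[OF that] card_latest by simp
    qed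
    have R4: "4 ^ k \<le> R" using R(2) by simp
    have "\<upsilon> ''pair_end'' p - \<upsilon> ''pair_begin'' p \<le> R" if p: "p < n * n" for p
    proof -
      have "p div n < n" "p mod n < n" using p pos by (auto simp: less_mult_imp_div_less)
      from c4[OF this] have "card (fam \<upsilon> p) \<le> 4 ^ k" by simp
      then show ?thesis using pr[OF p] R4 by simp
    qed
    then have env: "env W n m k R \<upsilon>"
      using W R nmk pool x tx pr eq[OF fr] th ends unfolding env_def by simp
    define p where "p = \<upsilon> ''tail'' ?a * n + x"
    define q where "q = \<upsilon> ''head'' ?a * n + x"
    have tl: "\<upsilon> ''tail'' ?a = tail G ?a" "tail G ?a < n" "head G ?a < n" and hl: "\<And>b. b < m \<Longrightarrow> \<upsilon> ''head'' b = head G b"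
      using eq[OF fr] th ends am by auto
    have pq: "p = tail G ?a * n + x" "q = head G ?a * n + x" using tl hl am by (auto simp: p_def q_def)
    have pq': "p < n * n" "q < n * n" unfolding pq by (rule pair_index; use tl x in simp)+
    have len: "\<upsilon> ''pair_end'' p - \<upsilon> ''pair_begin'' p \<le> 4 ^ k" "\<upsilon> ''pair_end'' q - \<upsilon> ''pair_begin'' q \<le> 4 ^ k"
      using pr pq' c4 tl x unfolding pq by simp_all
    have "j * n + x + 1 \<le> m * n"
    proof -
      have "j * n + x + 1 \<le> Suc j * n" using x by simp
      also have "\<dots> \<le> m * n" by (rule mult_le_mono1) (use j in simp)
      finally show ?thesis .
    qed
    from mult_le_mono1[OF this, of "6 * R ^ 2"]
    \<comment> \<open>There are m * n updates in all, so the share of the next one is still within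
      the word bound.\<close>
    have room: "(j * n + x) * (6 * R ^ 2) + 6 * R ^ 2 \<le> m * n * (6 * R ^ 2)" by (simp add: add_mult_distrib)
    have S: "\<upsilon> ''cf'' 0 + 6 * R ^ 2 < W" "\<upsilon> ''af'' 0 + 6 * R ^ 2 < W" using cf af room W(6) by linarith+
    have a0: "\<upsilon> ''a'' 0 = ?a" using I by simp
    have ta: "\<upsilon> ''tail'' ?a < n" using tl by simp
    let ?F = "\<lambda>s. fam \<upsilon> (s * n + x)"
    have Pjx: "P j x x = ?f ` {..<j}" by (simp add: P_def)
    \<comment> \<open>The successors of the arc at position i \<le> j are listed before i, hence
      among the first j arcs.\<close>
    have closed: "f \<in> ?f ` {..<j}" if b: "b \<in> insert ?a (?f ` {..<j})" and "f < m" "tail G f = head G b" for b f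
    proof -
      from b have "\<exists>i\<le>j. b = ?f i"
      proof (elim insertE imageE)
        fix i assume "b = ?f i" "i \<in> {..<j}"
        then show ?thesis by (intro exI[of _ i]) simp
      qed blast
      then obtain i where i: "i \<le> j" "b = ?f i" by blast
      have "i < m" using i j by simp
      then have "\<exists>i'<i. ?f i' = f" using li that(2,3) i(2) unfolding listing_def by blast
      then obtain i' where "i' < i" "?f i' = f" by blast
      then show ?thesis using i by (intro image_eqI[of _ _ i']) simp_all
    qed
    have K: "candidates k \<upsilon> p q ?a = (\<Union>Y\<in>?F (tail G ?a). joins k Y (insert {?a} (?F (head G ?a))))"
      unfolding candidates_def pq ..
    have Km: "M \<subseteq> {..<m}" if MK: "M \<in> candidates k \<upsilon> p q ?a" for M
    proof -
      have sub: "Y \<subseteq> {..<m}" if Y: "Y \<in> fam \<upsilon> p'" and p': "p' < n * n" for Y p'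
      proof -
        obtain c where c: "Y = output_cut \<upsilon> c" "c < \<upsilon> ''pair_end'' p'" using Y by (auto simp: fam_def)
        then have "c < \<upsilon> ''cf'' 0" using pr[OF p'] by linarith
        from poolD[OF pool this] show ?thesis using c(1) by (simp add: wfcut_def)
      qed
      obtain Y Q where "Y \<in> fam \<upsilon> p" "Q \<in> insert {?a} (fam \<upsilon> q)" "M = Y \<union> Q"
        using MK unfolding candidates_def joins_def by blast
      then show ?thesis using sub pq' am by blast
    qed
    have new: "{M \<in> candidates k \<upsilon> p q ?a. \<forall>N\<in>candidates k \<upsilon> p q ?a.
        card N \<le> card {b \<in> M. b \<in> N \<or> (\<exists>Y\<in>fam \<upsilon> (\<upsilon> ''head'' b * n + x). Y \<subseteq> N)} \<longrightarrow> N = M} =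
      (if tail G ?a = x then {} else latest k x {e \<in> insert ?a (?f ` {..<j}). tail G e = tail G ?a})"
    proof -
      have c: "{b \<in> M. b \<in> N \<or> (\<exists>Y\<in>fam \<upsilon> (\<upsilon> ''head'' b * n + x). Y \<subseteq> N)} = {b \<in> M. b \<in> N \<or> (\<exists>Y\<in>?F (head G b). Y \<subseteq> N)}"
        if "M \<in> candidates k \<upsilon> p q ?a" for M N
        using Km[OF that] hl by (intro Collect_cong) auto
      have "{M \<in> candidates k \<upsilon> p q ?a. \<forall>N\<in>candidates k \<upsilon> p q ?a.
        card N \<le> card {b \<in> M. b \<in> N \<or> (\<exists>Y\<in>fam \<upsilon> (\<upsilon> ''head'' b * n + x). Y \<subseteq> N)} \<longrightarrow> N = M} =
        {M \<in> candidates k \<upsilon> p q ?a. \<forall>N\<in>candidates k \<upsilon> p q ?a.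
        card N \<le> card {b \<in> M. b \<in> N \<or> (\<exists>Y\<in>?F (head G b). Y \<subseteq> N)} \<longrightarrow> N = M}"
        using c by (intro Collect_cong conj_cong refl) simp
      also have "\<dots> = (if tail G ?a = x then {} else latest k x {e \<in> insert ?a (?f ` {..<j}). tail G e = tail G ?a})"
        unfolding K
      proof (rule latest_step[OF x am])
        show "?f ` {..<j} \<subseteq> {..<m}" using Pm[OF j, of x x] unfolding Pjx .
        show "?F s = (if s = x then {} else latest k x {e \<in> ?f ` {..<j}. tail G e = s})" if "s < n" for s
          using cp[OF that x] unfolding Pjx .
      qed (rule closed)
      finally show ?thesis .
    qed
    show "wp W Step (\<lambda>T \<tau>'. T \<le> 2000 * R ^ 5 \<and> \<tau>' ''t'' 0 = x \<and>
        (inv k R \<sigma> (j * n + Suc x) (P j (Suc x)) (\<tau>'(''t'' := (\<tau>' ''t'')(0 := Suc x))) \<and>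
         (\<tau>'(''t'' := (\<tau>' ''t'')(0 := Suc x))) ''a'' 0 = ?f j \<and> (\<tau>'(''t'' := (\<tau>' ''t'')(0 := Suc x))) ''idx'' 0 = j)) \<upsilon>"
    proof (rule wp_mono[OF wp_Step[OF env mk a0 am ta tx p_def q_def len R(2) S]], elim conjE)
      fix T \<tau>' assume T: "T \<le> 2000 * R ^ 5" and f': "frame Step_vars \<upsilon> \<tau>'" and mk': "\<tau>' ''mark'' = (\<lambda>_. 0)"
        and pool': "pool m k \<tau>'" and cf': "\<tau>' ''cf'' 0 \<le> \<upsilon> ''cf'' 0 + 6 * R ^ 2" "\<tau>' ''af'' 0 \<le> \<upsilon> ''af'' 0 + 6 * R ^ 2"
           "\<upsilon> ''cf'' 0 \<le> \<tau>' ''cf'' 0"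
        and other: "\<forall>p'. p' \<noteq> p \<longrightarrow> \<tau>' ''pair_begin'' p' = \<upsilon> ''pair_begin'' p' \<and> \<tau>' ''pair_end'' p' = \<upsilon> ''pair_end'' p'"
           "\<forall>p'<n * n. p' \<noteq> p \<longrightarrow> fam \<tau>' p' = fam \<upsilon> p'"
        and pp: "\<tau>' ''pair_begin'' p \<le> \<tau>' ''pair_end'' p" "\<tau>' ''pair_end'' p \<le> \<tau>' ''cf'' 0"
           "\<tau>' ''pair_end'' p - \<tau>' ''pair_begin'' p = card (fam \<tau>' p)"
        and fp: "fam \<tau>' p = {M \<in> candidates k \<upsilon> p q ?a. \<forall>N\<in>candidates k \<upsilon> p q ?a.
           card N \<le> card {b \<in> M. b \<in> N \<or> (\<exists>P\<in>fam \<upsilon> (\<upsilon> ''head'' b * n + x). P \<subseteq> N)} \<longrightarrow> N = M}"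
      have fr': "frame List_vars \<sigma> \<tau>'" by (rule frame_trans[OF fr frame_mono[OF f']]) auto
      have regs: "\<tau>' ''t'' = \<upsilon> ''t''" "\<tau>' ''a'' = \<upsilon> ''a''" "\<tau>' ''idx'' = \<upsilon> ''idx''" by (rule frameD[OF f']; simp)+
      have cnt: "\<tau>' ''cf'' 0 \<le> 1 + (j * n + Suc x) * (6 * R ^ 2)" "\<tau>' ''af'' 0 \<le> (j * n + Suc x) * (6 * R ^ 2)"
        using cf' cf af by (simp_all add: add_mult_distrib)
      have pr': "\<tau>' ''pair_begin'' p' \<le> \<tau>' ''pair_end'' p' \<and> \<tau>' ''pair_end'' p' \<le> \<tau>' ''cf'' 0 \<and>
          \<tau>' ''pair_end'' p' - \<tau>' ''pair_begin'' p' = card (fam \<tau>' p')" if "p' < n * n" for p'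
        using pp other pr[OF that] cf'(3) that by (cases "p' = p") auto
      have "fam \<tau>' (s * n + t) = (if s = t then {} else latest k t {e \<in> P j (Suc x) t. tail G e = s})"
        if st: "s < n" "t < n" for s t
      proof (cases "s = tail G ?a \<and> t = x")
        case True
        have Px: "P j (Suc x) x = insert ?a (?f ` {..<j})" by (auto simp: P_def)
        have idx: "s * n + t = p" using True pq by simp
        show ?thesis unfolding idx using trans[OF fp new] True Px by simp
      next
        case False
        then have "s * n + t \<noteq> p" unfolding pq using pair_index_eq[OF st(2) x] by blast
        then have "fam \<tau>' (s * n + t) = fam \<upsilon> (s * n + t)" using other(2) pair_index[OF st] by blast
        \<comment> \<open>The current arc enters P only for the target x, and there it is an out-arc
          of its own tail only.\<close>
        moreover have "{e \<in> P j (Suc x) t. tail G e = s} = {e \<in> P j x t. tail G e = s}"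
          using False by (auto simp: P_def less_Suc_eq split: if_splits)
        ultimately show ?thesis using cp[OF st] by simp
      qed
      then have "inv k R \<sigma> (j * n + Suc x) (P j (Suc x)) \<tau>'"
        unfolding inv_def computed_def using fr' mk' pool' cnt pr' by blast
      then show "T \<le> 2000 * R ^ 5 \<and> \<tau>' ''t'' 0 = x \<and>
        (inv k R \<sigma> (j * n + Suc x) (P j (Suc x)) (\<tau>'(''t'' := (\<tau>' ''t'')(0 := Suc x))) \<and>
         (\<tau>'(''t'' := (\<tau>' ''t'')(0 := Suc x))) ''a'' 0 = ?f j \<and> (\<tau>'(''t'' := (\<tau>' ''t'')(0 := Suc x))) ''idx'' 0 = j)"
        using T tx I by (simp add: inv_upd regs)
    qed
  qed (use W in auto)
  have M1: "m \<le> M" "1 \<le> M" "1 \<le> n" using M pos by auto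
  have R5: "1 \<le> R ^ 5" using R1 by simp
  show ?thesis
    unfolding List_Cuts_def
  proof (rule wp_For[where I = "\<lambda>j \<tau>. inv k R \<sigma> (j * n) (P j 0) \<tau>" and B = "2110 * R ^ 5 * n" and l = 0 and h = m, OF W(1)])
    have "P 0 0 = (\<lambda>_. {})" by (auto simp: P_def)
    then show "inv k R \<sigma> (0 * n) (P 0 0) (\<sigma>(''idx'' := (\<sigma> ''idx'')(0 := 0)))" using init by (simp add: inv_upd)
  next
    fix j \<tau> assume "inv k R \<sigma> (j * n) (P j 0) \<tau>"
    then show "ok W \<tau> (V ''m'') \<and> val \<tau> (V ''m'') = m" using W nmk eq by (simp add: inv_def)
  next
    fix j \<tau> assume j: "j < m" and I: "inv k R \<sigma> (j * n) (P j 0) \<tau>" and ij: "\<tau> ''idx'' 0 = j"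
    have fr: "frame List_vars \<sigma> \<tau>" using I by (simp add: inv_def)
    let ?t = "\<tau>(''a'' := (\<tau> ''a'')(0 := ?f j))"
    have I': "inv k R \<sigma> (j * n) (P j 0) ?t" using I by (simp add: inv_upd)
    have "1 \<le> R ^ 5 * n" using R5 M1 by simp
    then have tm: "5 + T \<le> 2110 * R ^ 5 * n" if "T \<le> 2100 * R ^ 5 * n" for T using that by linarith
    have PS: "inv k R \<sigma> (Suc j * n) (P (Suc j) 0) \<tau>'" if "inv k R \<sigma> (j * n + n) (P j n) \<tau>'" for \<tau>'
    proof -
      have "computed k (P (Suc j) 0) \<tau>' = computed k (P j n) \<tau>'"
      proof -
        \<comment> \<open>Having treated position j for all n targets is the same as starting
          position j + 1, as far as targets below n are concerned.\<close>
        have "P (Suc j) 0 t = P j n t" if "t < n" for t using that by (auto simp: P_def less_Suc_eq)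
        then show ?thesis by (simp add: computed_def)
      qed
      then show ?thesis using that by (simp add: inv_def add.commute)
    qed
    show "wp W (''a'' ::= Read ''ord'' (V ''idx'') ;; For ''t'' (Const 0) (V ''n'') Step)
       (\<lambda>T \<tau>'. T \<le> 2110 * R ^ 5 * n \<and> \<tau>' ''idx'' 0 = j \<and>
          inv k R \<sigma> (Suc j * n) (P (Suc j) 0) (\<tau>'(''idx'' := (\<tau>' ''idx'')(0 := Suc j)))) \<tau>"
      apply (rule wp_Seq, rule wp_Assign_to[where f = "(\<tau> ''a'')(0 := ?f j)"])
      subgoal using W by simp
      subgoal using W by simp
      subgoal using ij eq[OF fr] by simp
      apply (rule wp_mono[OF pairs[OF j I']])
      subgoal by simp
      subgoal using ij by simp
      subgoal for T \<tau>' using tm[of T] PS[of \<tau>'] by (simp add: inv_upd)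
      done
  next
    fix T \<tau> assume T: "T \<le> cost (Const 0) + cost (V ''m'') + 6 + (m - 0) * (2110 * R ^ 5 * n + cost (V ''m'') + 10)"
      and I: "inv k R \<sigma> (m * n) (P m 0) \<tau>"
    have "9 + m * (2110 * R ^ 5 * n + 12) \<le> (9 + 2110 * R ^ 5 + 12) * (M * n)"
      by (rule loop_time2) (use M1 in auto)
    moreover have "T \<le> 9 + m * (2110 * R ^ 5 * n + 12)" using T by (simp add: add.commute)
    ultimately have "T \<le> (9 + 2110 * R ^ 5 + 12) * (M * n)" by (rule order_trans[rotated])
    also have "\<dots> \<le> (4000 * R ^ 5) * (M * n)" by (rule mult_le_mono1) (use R5 in linarith)
    finally have "T \<le> 4000 * R ^ 5 * (M * n)" .
    moreover have "P m 0 = (\<lambda>_. {..<m})" using fm by (auto simp: P_def)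
    ultimately show "T \<le> 4000 * R ^ 5 * (M * n) \<and> computed k (\<lambda>_. {..<m}) \<tau>" using I by (simp add: inv_def)
  qed (use W in auto)
qed

text \<open>B serves as time bound and as word bound: pair indices, arcs and all positions ever
  written stay below it.\<close>

lemma run_All_Cuts:
  assumes R: "R = 2 * 16 ^ k" and M: "M = max m n" and B: "5000 * R ^ 5 * (M * n) \<le> B"
  shows "\<exists>T \<sigma>. run B All_Cuts (input_state G n m k) T \<sigma> \<and> T \<le> B \<and> computed k (\<lambda>_. {..<m}) \<sigma>"
proof -
  let ?\<sigma> = "input_state G n m k"
  have M1: "m \<le> M" "n \<le> M" "1 \<le> M" "1 \<le> n" using M pos by auto
  have R1: "1 \<le> R" by (simp add: R)
  \<comment> \<open>The factor 2 in R absorbs the successor in \<open>Suc (4 ^ k)\<close> and the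
    summand in \<open>k + 2\<close>.\<close>
  have kR: "k + 2 \<le> R" "4 ^ k * Suc (4 ^ k) \<le> R"
  proof -
    have "k < 2 ^ k" by (rule less_exp)
    also have "(2::nat) ^ k \<le> 16 ^ k" by (rule power_mono) simp_all
    finally have "k + 1 \<le> 16 ^ k" by simp
    moreover have "(1::nat) \<le> 16 ^ k" by simp
    ultimately show "k + 2 \<le> R" unfolding R by linarith
    have "(4::nat) ^ k * 4 ^ k = 16 ^ k" by (simp flip: power_mult_distrib)
    moreover have "(4::nat) ^ k \<le> 16 ^ k" by (rule power_mono) simp_all
    ultimately show "4 ^ k * Suc (4 ^ k) \<le> R" unfolding R by simp
  qed
  have R5: "R \<le> R ^ 5" "R ^ 2 \<le> R ^ 5" "1 \<le> R ^ 5"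
    using R1 power_increasing[of 1 5 R] power_increasing[of 2 5 R] by simp_all
  define N where "N = R ^ 5 * (M * n)"
  have BN: "5000 * N \<le> B" using B by (simp add: N_def mult.assoc)
  have Mn: "M * n \<le> N" "R ^ 5 \<le> N" using R5 M1 by (simp_all add: N_def)
  have "n * n \<le> M * n" "M \<le> M * n" using M1 by simp_all
  then have le: "n * n \<le> N" "M \<le> N" "1 \<le> N" using Mn R5 by linarith+
  have room: "m * n * (6 * R ^ 2) \<le> 6 * N"
  proof -
    have "m * n * R ^ 2 \<le> M * n * R ^ 5" by (rule mult_le_mono) (use M1 R5 in simp_all)
    then show ?thesis by (simp add: N_def ac_simps)
  qed
  have W: "1 < B" "n * n \<le> B" "k + 2 < B" "m < B" "n < B" "1 + m * n * (6 * R ^ 2) < B"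
    using BN Mn le M1 R5 kR room by linarith+
  have bnd: "bnd B ?\<sigma>"
    using W ends unfolding bnd_def input_state_def by (auto intro: less_trans)
  have s: "?\<sigma> ''n'' 0 = n" "?\<sigma> ''m'' 0 = m" "?\<sigma> ''k'' 0 = k"
    "\<And>a. a < m \<Longrightarrow> ?\<sigma> ''tail'' a = tail G a" "\<And>a. a < m \<Longrightarrow> ?\<sigma> ''head'' a = head G a"
    "\<And>x. x \<notin> {''n'', ''m'', ''k'', ''tail'', ''head''} \<Longrightarrow> ?\<sigma> x = (\<lambda>_. 0)"
    by (auto simp: input_state_def)
  have "wp B All_Cuts (\<lambda>T \<tau>. T \<le> B \<and> computed k (\<lambda>_. {..<m}) \<tau>) ?\<sigma>"
    unfolding All_Cuts_def
    apply (rule wp_SeqI)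
     apply (rule wp_Init[where n = n and \<sigma> = ?\<sigma>, OF W(1,2,5) s(1) M1(4)])
     apply (rule s(6), simp)
    apply (elim conjE)
    subgoal premises P for T1 \<sigma>1
    proof -
      have f1: "frame {''s'', ''t'', ''pair_end'', ''cf''} ?\<sigma> \<sigma>1" by (fact P)
      have e1: "\<sigma>1 x = ?\<sigma> x" if "x \<notin> {''s'', ''t'', ''pair_end'', ''cf''}" for x
        by (rule frameD[OF f1 that])
      have O: "wp B Order (\<lambda>T \<tau>. T \<le> 300 * (M * n) \<and> frame {''r'', ''a'', ''blk'', ''ord'', ''cnt'', ''done''} \<sigma>1 \<tau> \<and>
          listing m (tail G) (head G) {..<m} m (\<tau> ''ord'')) \<sigma>1"
        by (rule wp_Order[OF W(1,4,5) _ _ M1(4) _ _ _ _ sink M]) (use s e1 ends in auto)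
      show ?thesis
        apply (rule wp_SeqI[OF O])
        apply (elim conjE)
        subgoal premises Q for T2 \<sigma>2
        proof -
          have f2: "frame {''r'', ''a'', ''blk'', ''ord'', ''cnt'', ''done''} \<sigma>1 \<sigma>2"
            and li: "listing m (tail G) (head G) {..<m} m (\<sigma>2 ''ord'')" by (fact Q)+
          have e2: "\<sigma>2 x = \<sigma>1 x" if "x \<notin> {''r'', ''a'', ''blk'', ''ord'', ''cnt'', ''done''}" for x
            by (rule frameD[OF f2 that])
          have z: "\<sigma>2 ''mark'' = (\<lambda>_. 0)" "\<sigma>2 ''af'' 0 = 0" "\<sigma>2 ''pair_begin'' = (\<lambda>_. 0)"
            "\<sigma>2 ''cut_begin'' = (\<lambda>_. 0)" "\<sigma>2 ''cut_end'' = (\<lambda>_. 0)"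
            using e1 e2 s(6) by simp_all
          have cf: "\<sigma>2 ''cf'' 0 = 1" using P e2 by simp
          have pe: "\<sigma>2 ''pair_end'' (s * n + t) = (if s = t then 0 else 1)" if "s < n" "t < n" for s t
            using P e2 that by simp
          have oc: "output_cut \<sigma>2 0 = {}" using z by (simp add: output_cut_def)
          have fam: "fam \<sigma>2 (s * n + t) = (if s = t then {} else {{}})" if "s < n" "t < n" for s t
            using pe[OF that] z oc by (simp add: fam_def)
          have pool: "pool m k \<sigma>2" using cf oc z by (simp add: pool_def wfcut_def)
          have prs: "\<sigma>2 ''pair_begin'' p \<le> \<sigma>2 ''pair_end'' p \<and> \<sigma>2 ''pair_end'' p \<le> \<sigma>2 ''cf'' 0 \<and>
             \<sigma>2 ''pair_end'' p - \<sigma>2 ''pair_begin'' p = card (fam \<sigma>2 p)" if p: "p < n * n" for p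
          proof -
            have "p div n < n" "p mod n < n" using p pos by (auto simp: less_mult_imp_div_less)
            from pe[OF this] fam[OF this] show ?thesis using z cf by simp
          qed
          have inv: "inv k R \<sigma>2 0 (\<lambda>_. {}) \<sigma>2"
          proof -
            have c: "computed k (\<lambda>_. {}) \<sigma>2" using fam by (simp add: computed_def latest_empty)
            have "\<sigma>2 ''cf'' 0 \<le> 1 + 0 * (6 * R ^ 2)" "\<sigma>2 ''af'' 0 \<le> 0 * (6 * R ^ 2)"
              using cf z by simp_all
            then show ?thesis
              unfolding inv_def using frame_refl z(1) pool prs c by blast
          qed
          have th: "\<And>a. a < m \<Longrightarrow> \<sigma>2 ''tail'' a = tail G a \<and> \<sigma>2 ''head'' a = head G a"
            and nmk: "\<sigma>2 ''n'' 0 = n" "\<sigma>2 ''m'' 0 = m" "\<sigma>2 ''k'' 0 = k"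
            using e1 e2 s by simp_all
          have time: "T1 + (T2 + T) \<le> B" if "T \<le> 4000 * R ^ 5 * (M * n)" for T
          proof -
            have "T \<le> 4000 * N" using that by (simp add: N_def mult.assoc)
            then show ?thesis using P(1) Q(1) BN Mn le by linarith
          qed
          show ?thesis
            by (rule wp_mono[OF wp_List_Cuts[OF W(1,2,3,4,5,6) kR nmk th li inv M]]) (use time in auto)
        qed
        done
    qed
    done
  then show ?thesis using bnd unfolding wp_def by blast
qed

end

theorem theorem21:
  shows "\<exists>(P :: com) (C :: nat) (c :: nat).
    \<forall>(G :: (nat, nat) pre_digraph) (n :: nat) (m :: nat) (k :: nat).
      wf_digraph G \<longrightarrow> verts G = {..<n} \<longrightarrow> arcs G = {..<m} \<longrightarrow> 0 < n \<longrightarrow>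
      acyclic (arcs_ends G) \<longrightarrow>
      (let B = C * 2 ^ (c * k ^ 2) * (max m n * n) in
       \<exists>T \<sigma>. run B P (input_state G n m k) T \<sigma> \<and> T \<le> B \<and>
         (\<forall>s < n. \<forall>t < n. output_cuts n \<sigma> s t =
            {M. st_latest G s t M \<and> minimal_st_cut G s t M \<and> card M \<le> k}))"
\<comment> \<open>R^5 = 32 * 2^(20 * k) for R = 2 * 16^k, which explains 20 and 160000 = 5000 * 32.
  The exponent of the statement follows from k \<le> k^2.\<close>
proof (rule exI[of _ All_Cuts], rule exI[of _ 160000], rule exI[of _ 20], intro allI impI)
  fix G :: "(nat, nat) pre_digraph" and n m k :: nat
  assume "wf_digraph G" "verts G = {..<n}" "arcs G = {..<m}" "0 < n" "acyclic (arcs_ends G)"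
  then interpret dag_input G n m by (rule dag_input.intro)
  define B where "B = 160000 * 2 ^ (20 * k ^ 2) * (max m n * n)"
  have "(16::nat) ^ k = 2 ^ (4 * k)" by (simp add: power_mult)
  moreover have "(2 ^ (4 * k)) ^ 5 = (2::nat) ^ (20 * k)" by (simp flip: power_mult)
  ultimately have "(2 * 16 ^ k) ^ 5 = 32 * (2::nat) ^ (20 * k)" by (simp add: power_mult_distrib)
  also have "(2::nat) ^ (20 * k) \<le> 2 ^ (20 * k ^ 2)"
    by (rule power_increasing) (simp_all add: power2_eq_square)
  finally have "(2 * 16 ^ k) ^ 5 \<le> 32 * (2::nat) ^ (20 * k ^ 2)" by simp
  then have "5000 * (2 * 16 ^ k) ^ 5 * (max m n * n) \<le> B"
    unfolding B_def by (intro mult_le_mono1) simp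
  then obtain T \<sigma> where T: "run B All_Cuts (input_state G n m k) T \<sigma>" "T \<le> B" and c: "computed k (\<lambda>_. {..<m}) \<sigma>"
    using run_All_Cuts[OF refl refl] by blast
  have "output_cuts n \<sigma> s t = {M. st_latest G s t M \<and> minimal_st_cut G s t M \<and> card M \<le> k}"
    if "s < n" "t < n" for s t
    using c that by (simp add: latest_out computed_def output_cuts_def fam_def)
  then show "let B = 160000 * 2 ^ (20 * k ^ 2) * (max m n * n) in
       \<exists>T \<sigma>. run B All_Cuts (input_state G n m k) T \<sigma> \<and> T \<le> B \<and>
         (\<forall>s < n. \<forall>t < n. output_cuts n \<sigma> s t =
            {M. st_latest G s t M \<and> minimal_st_cut G s t M \<and> card M \<le> k})"
    using T unfolding Let_def B_def[symmetric] by blast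
qed

end
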